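(* Let $d\geq 2$, let $\mu>0$ and $\lambda+\mu\geq 0$, and let $\gamma>0$ if $d=2$ and $\gamma\geq 0$ if $d\geq 3$. Then there exists a constant $c_{\gamma,d,\lambda,\mu}>0$, depending only on $\gamma,d,\lambda,\mu$, such that for every real-valued $a\in L^\infty(\mathbb{R}^d;\mathbb{R})$ the following holds. (i) If $a_-\in L^{\gamma+\frac d2}(\mathbb{R}^d)$, then every positive eigenvalue $z$ of the damped elastic wave operator $A_a^\ast$ satisfies $$z^{\gamma-\frac d2}\leq c_{\gamma,d,\lambda,\mu}\,\|a_-\|_{L^{\gamma+\frac d2}(\mathbb{R}^d)}^{\gamma+\frac d2}.$$ (ii) If $a_+\in L^{\gamma+\frac d2}(\mathbb{R}^d)$, then every negative eigenvalue $z$ of $A_a^\ast$ satisfies $$(-z)^{\gamma-\frac d2}\leq c_{\gamma,d,\lambda,\mu}\,\|a_+\|_{L^{\gamma+\frac d2}(\mathbb{R}^d)}^{\gamma+\frac d2}.$$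
   Context: The Lamé operator acts on vector fields $u:\mathbb{R}^d\to\mathbb{C}^d$ by $-\Delta^\ast u=-\mu\Delta u-(\lambda+\mu)\nabla\operatorname{div}u$, with domain $H^2(\mathbb{R}^d)^d$, where $H^2(\mathbb{R}^d)^d=H^2(\mathbb{R}^d;\mathbb{C}^d)$. For a bounded damping $a$ (a scalar function is identified with $a$ times the $d\times d$ identity matrix), the damped elastic wave operator is $$A_a^\ast=\begin{pmatrix}0&1\\ \Delta^\ast&-a\end{pmatrix},\qquad \mathcal{D}(A_a^\ast)=H^2(\mathbb{R}^d)^d\times\dot H^1(\mathbb{R}^d)^d,$$ where $\dot H^1$ is the homogeneous Sobolev space. A number $z\in\mathbb{C}$ is an eigenvalue of $A_a^\ast$ if there is a non-trivial $(\psi_1,\psi_2)\in\mathcal{D}(A_a^\ast)$ with $\psi_2=z\psi_1$ and $\Delta^\ast\psi_1-a\psi_2=z\psi_2$ almost everywhere. The positive and negative parts of $a$ are $a_\pm(x)=\max\{\pm a(x),0\}$. *)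

theory Defs
  imports "HOL-Analysis.Analysis"
begin

text \<open>Functions are not quotiented by almost-everywhere equality; identities between
  \<open>L\<^sup>p\<close> functions are stated almost everywhere instead. The space is meant for
  \<open>0 < p < \<infinity>\<close>.\<close>

definition Lp_space :: "real \<Rightarrow> ('a::euclidean_space \<Rightarrow> 'b::euclidean_space) set" where
  "Lp_space p = {f. f \<in> borel_measurable lebesgue \<and> integrable lebesgue (\<lambda>x. norm (f x) powr p)}"

definition Lp_norm :: "real \<Rightarrow> ('a::euclidean_space \<Rightarrow> 'b::euclidean_space) \<Rightarrow> real" where
  "Lp_norm p f = (LINT x|lebesgue. norm (f x) powr p) powr (1 / p)"

definition Linfty_space :: "('a::euclidean_space \<Rightarrow> 'b::euclidean_space) set" where
  "Linfty_space = {f. f \<in> borel_measurable lebesgue \<and> (\<exists>C. AE x in lebesgue. norm (f x) \<le> C)}"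

definition L1_loc :: "('a::euclidean_space \<Rightarrow> 'b::euclidean_space) set" where
  "L1_loc = {f. \<forall>K. compact K \<longrightarrow> set_integrable lebesgue K f}"

definition partial_deriv :: "'n::finite \<Rightarrow> (real^'n \<Rightarrow> complex) \<Rightarrow> real^'n \<Rightarrow> complex" where
  "partial_deriv i f x = frechet_derivative f (at x) (axis i 1)"

fun C_k :: "nat \<Rightarrow> (real^'n::finite \<Rightarrow> complex) \<Rightarrow> bool" where
  "C_k 0 f \<longleftrightarrow> continuous_on UNIV f"
| "C_k (Suc k) f \<longleftrightarrow> f differentiable_on UNIV \<and> (\<forall>i. C_k k (partial_deriv i f))"

definition test_functions :: "(real^'n::finite \<Rightarrow> complex) set" where
  "test_functions = {\<phi>. (\<forall>k. C_k k \<phi>) \<and> compact (closure {x. \<phi> x \<noteq> 0})}"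

definition has_weak_partial ::
  "'n::finite \<Rightarrow> (real^'n \<Rightarrow> complex) \<Rightarrow> (real^'n \<Rightarrow> complex) \<Rightarrow> bool" where
  "has_weak_partial i u g \<longleftrightarrow> u \<in> L1_loc \<and> g \<in> L1_loc \<and>
     (\<forall>\<phi>\<in>test_functions.
        (LINT x|lebesgue. u x * partial_deriv i \<phi> x) = - (LINT x|lebesgue. g x * \<phi> x))"

definition weakly_differentiable :: "'n::finite \<Rightarrow> (real^'n \<Rightarrow> complex) \<Rightarrow> bool" where
  "weakly_differentiable i u \<longleftrightarrow> (\<exists>g. has_weak_partial i u g)"

text \<open>An arbitrary representative; the weak derivative is determined only up to a null set, and
  the value is unspecified if \<open>u\<close> is not weakly differentiable in direction \<open>i\<close>.\<close>

definition weak_partial :: "'n::finite \<Rightarrow> (real^'n \<Rightarrow> complex) \<Rightarrow> real^'n \<Rightarrow> complex" where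
  "weak_partial i u = (SOME g. has_weak_partial i u g)"

definition H2 :: "(real^'n::finite \<Rightarrow> complex) set" where
  "H2 = {u. u \<in> Lp_space 2 \<and>
     (\<forall>i. weakly_differentiable i u \<and> weak_partial i u \<in> Lp_space 2 \<and>
       (\<forall>j. weakly_differentiable j (weak_partial i u) \<and>
            weak_partial j (weak_partial i u) \<in> Lp_space 2))}"

text \<open>The homogeneous Sobolev space, i.e. the completion of the test functions for the norm
  \<open>\<parallel>\<nabla>\<phi>\<parallel>\<^sub>2\<close>, realised by locally integrable functions: \<open>u\<close> belongs to it if some sequence of
  test functions converges to \<open>u\<close> in \<open>L1_loc\<close> with gradients converging to \<open>\<nabla>u\<close> in
  \<open>L\<^sup>2\<close>. In dimension at least 3 the \<open>L1_loc\<close> limit exists for every Cauchy sequence and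
  selects the unique representative of the class. In dimension 2 the elements of the completion
  are classes modulo additive constants, and all representatives of a class are included.\<close>

definition Hdot1 :: "(real^'n::finite \<Rightarrow> complex) set" where
  "Hdot1 = {u. u \<in> L1_loc \<and>
     (\<forall>i. weakly_differentiable i u \<and> weak_partial i u \<in> Lp_space 2) \<and>
     (\<exists>\<phi>. (\<forall>m. \<phi> m \<in> test_functions) \<and>
        (\<forall>i. (\<lambda>m. Lp_norm 2 (\<lambda>x. partial_deriv i (\<phi> m) x - weak_partial i u x))
                \<longlonglongrightarrow> 0) \<and>
        (\<forall>K. compact K \<longrightarrow> (\<lambda>m. LINT x:K|lebesgue. norm (\<phi> m x - u x)) \<longlonglongrightarrow> 0))}"

definition H2_vec :: "(real^'n::finite \<Rightarrow> complex^'n) set" where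
  "H2_vec = {u. \<forall>k. (\<lambda>x. u x $ k) \<in> H2}"

definition Hdot1_vec :: "(real^'n::finite \<Rightarrow> complex^'n) set" where
  "Hdot1_vec = {u. \<forall>k. (\<lambda>x. u x $ k) \<in> Hdot1}"

definition weak_laplacian :: "(real^'n::finite \<Rightarrow> complex) \<Rightarrow> real^'n \<Rightarrow> complex" where
  "weak_laplacian f x = (\<Sum>j\<in>UNIV. weak_partial j (weak_partial j f) x)"

definition weak_div :: "(real^'n::finite \<Rightarrow> complex^'n) \<Rightarrow> real^'n \<Rightarrow> complex" where
  "weak_div u x = (\<Sum>j\<in>UNIV. weak_partial j (\<lambda>y. u y $ j) x)"

text \<open>This is \<open>\<Delta>\<^sup>* = \<mu>\<Delta> + (\<lambda>+\<mu>)\<nabla>div\<close>, without the minus sign.\<close>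

definition lame :: "real \<Rightarrow> real \<Rightarrow> (real^'n::finite \<Rightarrow> complex^'n) \<Rightarrow> real^'n \<Rightarrow> complex^'n" where
  "lame lam mu u x = (\<chi> k. of_real mu * weak_laplacian (\<lambda>y. u y $ k) x
                         + of_real (lam + mu) * weak_partial k (weak_div u) x)"

definition wave_domain ::
  "((real^'n::finite \<Rightarrow> complex^'n) \<times> (real^'n \<Rightarrow> complex^'n)) set" where
  "wave_domain = H2_vec \<times> Hdot1_vec"

definition wave_op ::
  "real \<Rightarrow> real \<Rightarrow> (real^'n::finite \<Rightarrow> complex^'n^'n) \<Rightarrow>
   (real^'n \<Rightarrow> complex^'n) \<times> (real^'n \<Rightarrow> complex^'n) \<Rightarrow>
   (real^'n \<Rightarrow> complex^'n) \<times> (real^'n \<Rightarrow> complex^'n)" where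
  "wave_op lam mu a = (\<lambda>(u, v). (v, \<lambda>x. lame lam mu u x - a x *v v x))"

definition wave_eigenvalue ::
  "real \<Rightarrow> real \<Rightarrow> (real^'n::finite \<Rightarrow> complex^'n^'n) \<Rightarrow> complex \<Rightarrow> bool" where
  "wave_eigenvalue lam mu a z \<longleftrightarrow>
     (\<exists>\<psi>\<in>wave_domain.
        \<not> (AE x in lebesgue. fst \<psi> x = 0 \<and> snd \<psi> x = 0) \<and>
        (AE x in lebesgue. fst (wave_op lam mu a \<psi>) x = z *s fst \<psi> x) \<and>
        (AE x in lebesgue. snd (wave_op lam mu a \<psi>) x = z *s snd \<psi> x))"

definition scalar_damping :: "(real^'n::finite \<Rightarrow> real) \<Rightarrow> real^'n \<Rightarrow> complex^'n^'n" where
  "scalar_damping a x = mat (of_real (a x))"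

definition pos_part :: "('a \<Rightarrow> real) \<Rightarrow> 'a \<Rightarrow> real" where
  "pos_part a x = max (a x) 0"

definition neg_part :: "('a \<Rightarrow> real) \<Rightarrow> 'a \<Rightarrow> real" where
  "neg_part a x = max (- a x) 0"

end

(* Testing the eigenvalue equation with v = psi_2 and dropping the nonnegative divergence term
   gives  mu |grad v|^2 + z^2 |v|^2 <= |z| int a_-+ |v|^2  in L^2 norms. Hoelder's inequality and the
   Gagliardo-Nirenberg inequality bound the right-hand side by a multiple of
   |z|^{2 theta - 1} |a_-+|_p times the left-hand side, where p = gamma + d/2 and
   theta = d/(2p); dividing and raising to the power p gives the claim.
   The Gagliardo-Nirenberg inequality comes from the Loomis-Whitney inequality applied to |v|^s.
   The identity is obtained by testing with smooth functions converging to v together with their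
   gradients in L^2. The approximation supplied by the homogeneous Sobolev space controls v only
   locally in L^1, so it is truncated in size and then cut off, the cut-off being a dilate of
   one of the approximating test functions themselves. *)
theory Submission
  imports Defs
begin

subsection \<open>Hoelder and Loomis--Whitney inequalities\<close>

text \<open>Membership in \<open>H2\<close> is expressed by weak derivatives alone, while membership
  in \<open>Hdot1\<close> comes with an approximating sequence of test functions. A smooth bump
  function is never constructed either: if all approximants of a component of \<open>v\<close>
  vanished, so would that component, so a nontrivial eigenfunction always brings along a nonzero
  test function.

  For d >= 3 the value \<gamma> = 0 is allowed, that is p = d/2, and then |v|^2 has to be controlled
  at the critical Sobolev exponent. The route through Loomis--Whitney treats the critical and the
  subcritical case alike.

  Because z is real, z^2 |v|^2 has the same sign as the gradient terms, and only the part of the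
  damping with -z a > 0 can balance them. This is why positive eigenvalues see a_- and negative ones
  a_+.\<close>

text \<open>The value at infinity is meaningful only for \<open>r > 0\<close>.\<close>

definition epow :: "real \<Rightarrow> ennreal \<Rightarrow> ennreal" where
  "epow r x = (if x = \<infinity> then \<infinity> else ennreal (enn2real x powr r))"

lemma epow_ennreal [simp]: "0 \<le> x \<Longrightarrow> epow r (ennreal x) = ennreal (x powr r)"
  by (simp add: epow_def)

lemma epow_top [simp]: "epow r top = top" "epow r \<infinity> = \<infinity>"
  by (simp_all add: epow_def)

lemma epow_0 [simp]: "epow r 0 = 0"
  by (simp add: epow_def)

lemma epow_1 [simp]: "epow 1 x = x"
  by (cases x) (auto simp: epow_def)

lemma epow_eq_0_iff [simp]: "epow r x = 0 \<longleftrightarrow> x = 0"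
  by (cases x) (auto simp: epow_def)

lemma epow_mono: "0 \<le> r \<Longrightarrow> x \<le> y \<Longrightarrow> epow r x \<le> epow r y"
  by (cases x; cases y) (auto simp: epow_def intro!: powr_mono2 ennreal_leI simp: top_unique)

lemma epow_mult: "epow r (x * y) = epow r x * epow r y"
proof (cases "x = 0 \<or> y = 0")
  case False
  then show ?thesis
    by (cases x; cases y)
       (auto simp: epow_def ennreal_mult_top ennreal_top_mult powr_mult
             ennreal_mult[symmetric] enn2real_mult ennreal_mult_eq_top_iff)
qed auto

lemma epow_1_right [simp]: "epow r 1 = 1"
  by (simp add: epow_def)

lemma epow_prod: "epow r (\<Prod>i\<in>I. f i) = (\<Prod>i\<in>I. epow r (f i))"
  by (induction I rule: infinite_finite_induct) (auto simp: epow_mult)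

lemma epow_epow: "epow a (epow b x) = epow (a * b) x"
  by (cases x) (auto simp: powr_powr mult.commute)

lemma measurable_epow [measurable]:
  "f \<in> borel_measurable M \<Longrightarrow> (\<lambda>x. epow r (f x)) \<in> borel_measurable M"
proof -
  assume [measurable]: "f \<in> borel_measurable M"
  have [measurable]: "Measurable.pred M (\<lambda>x. f x = top)"
    using measurable_sets[of f M borel "{top}"] by (simp add: pred_def vimage_def Int_def conj_commute)
  show ?thesis unfolding epow_def infinity_ennreal_def by measurable
qed

text \<open>Young's inequality. Both weights are strictly positive, so an infinite argument makes
  the right-hand side infinite.\<close>

lemma weighted_AM_GM_epow:
  assumes "0 < \<alpha>" "\<alpha> < 1"
  shows "epow \<alpha> x * epow (1 - \<alpha>) y \<le> ennreal \<alpha> * x + ennreal (1 - \<alpha>) * y"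
proof (cases "x = \<infinity> \<or> y = \<infinity>")
  case True
  then show ?thesis using assms
    by (auto simp: ennreal_mult_top top_unique)
next
  case False
  then obtain a b where ab: "0 \<le> a" "0 \<le> b" "x = ennreal a" "y = ennreal b"
    by (cases x; cases y) auto
  have "a powr \<alpha> * b powr (1 - \<alpha>) \<le> \<alpha> * a + (1 - \<alpha>) * b"
    using Youngs_inequality_0[of \<alpha> "1 - \<alpha>" a b] assms ab
    by (cases "a = 0 \<or> b = 0") auto
  then show ?thesis using ab assms
    by (simp flip: ennreal_mult ennreal_plus)
qed

text \<open>Both integrals are normalised to 1, after which the pointwise weighted AM-GM inequality
  integrates to the claim; \<open>K\<close> undoes the normalisation.\<close>

lemma Holder_nn_integral:
  assumes \<alpha>: "0 < \<alpha>" "\<alpha> < 1"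
    and [measurable]: "f \<in> borel_measurable M" "g \<in> borel_measurable M"
  shows "(\<integral>\<^sup>+x. epow \<alpha> (f x) * epow (1 - \<alpha>) (g x) \<partial>M)
           \<le> epow \<alpha> (\<integral>\<^sup>+x. f x \<partial>M) * epow (1 - \<alpha>) (\<integral>\<^sup>+x. g x \<partial>M)"
    (is "?L \<le> epow \<alpha> ?A * epow (1 - \<alpha>) ?B")
proof -
  \<comment> \<open>The zero case comes first since \<open>0 * top = 0\<close> in
    \<open>ennreal\<close>: only when neither integral is zero does an infinite one make the
    right-hand side infinite.\<close>
  consider "?A = 0 \<or> ?B = 0" | "?A \<noteq> 0" "?B \<noteq> 0" "?A = \<infinity> \<or> ?B = \<infinity>"
    | "?A \<noteq> 0" "?B \<noteq> 0" "?A \<noteq> \<infinity>" "?B \<noteq> \<infinity>" by blast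
  then show ?thesis
  proof cases
    case 1
    then have "AE x in M. f x = 0 \<or> g x = 0"
      by (auto simp: nn_integral_0_iff_AE)
    then have "?L = (\<integral>\<^sup>+x. 0 \<partial>M)"
      by (intro nn_integral_cong_AE) auto
    then show ?thesis by simp
  next
    case 2
    then show ?thesis by (auto simp: ennreal_mult_top ennreal_top_mult)
  next
    case 3
    obtain a where a: "?A = ennreal a" "a > 0"
      using 3 by (cases ?A) (auto simp: less_le)
    obtain b where b: "?B = ennreal b" "b > 0"
      using 3 by (cases ?B) (auto simp: less_le)
    define K where "K = ennreal (a powr \<alpha> * b powr (1 - \<alpha>))"
    have scale: "epow r y = ennreal (c powr r) * epow r (ennreal (1 / c) * y)" if "c > 0" for c r y
    proof -
      have "ennreal (c powr r) * epow r (ennreal (1 / c) * y)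
              = ennreal (c powr r) * ennreal ((1 / c) powr r) * epow r y"
        using that by (simp add: epow_mult mult.assoc)
      also have "ennreal (c powr r) * ennreal ((1 / c) powr r) = 1"
        using that by (simp flip: ennreal_mult powr_mult)
      finally show ?thesis by simp
    qed
    have "?L \<le> (\<integral>\<^sup>+x. K * (ennreal \<alpha> * (ennreal (1 / a) * f x)
                          + ennreal (1 - \<alpha>) * (ennreal (1 / b) * g x)) \<partial>M)"
    proof (intro nn_integral_mono)
      fix x
      have "epow \<alpha> (f x) * epow (1 - \<alpha>) (g x)
              = K * (epow \<alpha> (ennreal (1 / a) * f x) * epow (1 - \<alpha>) (ennreal (1 / b) * g x))"
        unfolding K_def scale[OF a(2), of \<alpha> "f x"] scale[OF b(2), of "1 - \<alpha>" "g x"]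
        by (simp add: ennreal_mult mult_ac)
      also have "\<dots> \<le> K * (ennreal \<alpha> * (ennreal (1 / a) * f x)
                          + ennreal (1 - \<alpha>) * (ennreal (1 / b) * g x))"
        by (intro mult_left_mono weighted_AM_GM_epow \<alpha>) auto
      finally show "epow \<alpha> (f x) * epow (1 - \<alpha>) (g x) \<le> \<dots>" .
    qed
    also have "\<dots> = K * (ennreal \<alpha> * (ennreal (1 / a) * ?A) + ennreal (1 - \<alpha>) * (ennreal (1 / b) * ?B))"
      using assms(3,4) by (simp add: nn_integral_cmult nn_integral_add)
    also have "\<dots> = K * (ennreal \<alpha> + ennreal (1 - \<alpha>))"
    proof -
      have "ennreal (1 / c) * ennreal c = 1" if "c > 0" for c
        using that by (subst ennreal_mult[symmetric]) auto
      then show ?thesis using a b by (simp only: mult_1_right)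
    qed
    also have "\<dots> = K"
      using \<alpha> by (subst ennreal_plus[symmetric]) auto
    finally show ?thesis
      using a b by (simp add: K_def ennreal_mult)
  qed
qed

text \<open>One factor is split off with its weight \<alpha>; the other weights are divided by 1 -
  \<alpha>, so that they sum to 1 again and the induction hypothesis applies.\<close>

lemma Holder_nn_integral_prod:
  assumes "finite I" "I \<noteq> {}"
    and "\<And>i. i \<in> I \<Longrightarrow> 0 < w i" "(\<Sum>i\<in>I. w i) = 1"
    and "\<And>i. i \<in> I \<Longrightarrow> f i \<in> borel_measurable M"
  shows "(\<integral>\<^sup>+x. (\<Prod>i\<in>I. epow (w i) (f i x)) \<partial>M) \<le> (\<Prod>i\<in>I. epow (w i) (\<integral>\<^sup>+x. f i x \<partial>M))"
  using assms
proof (induction I arbitrary: w rule: finite_ne_induct)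
  case (singleton i)
  then show ?case by simp
next
  case (insert j I)
  note [measurable] = insert.prems(3)
  define \<alpha> where "\<alpha> = w j"
  have sum: "(\<Sum>i\<in>I. w i) = 1 - \<alpha>"
    using insert by (simp add: \<alpha>_def)
  have \<alpha>: "0 < \<alpha>" "\<alpha> < 1"
    using insert.prems(1)[of j] sum sum_pos[OF \<open>finite I\<close> \<open>I \<noteq> {}\<close>, of w] insert.prems(1)
    by (auto simp: \<alpha>_def)
  have eq: "(\<Prod>i\<in>I. epow (w i) (h i)) = epow (1 - \<alpha>) (\<Prod>i\<in>I. epow (w i / (1 - \<alpha>)) (h i))" for h
    using \<alpha> by (simp add: epow_prod epow_epow)
  have "(\<integral>\<^sup>+x. (\<Prod>i\<in>insert j I. epow (w i) (f i x)) \<partial>M)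
      = (\<integral>\<^sup>+x. epow \<alpha> (f j x) * epow (1 - \<alpha>) (\<Prod>i\<in>I. epow (w i / (1 - \<alpha>)) (f i x)) \<partial>M)"
    using insert by (simp add: eq \<alpha>_def)
  also have "\<dots> \<le> epow \<alpha> (\<integral>\<^sup>+x. f j x \<partial>M)
                   * epow (1 - \<alpha>) (\<integral>\<^sup>+x. (\<Prod>i\<in>I. epow (w i / (1 - \<alpha>)) (f i x)) \<partial>M)"
    by (intro Holder_nn_integral \<alpha>) auto
  also have "\<dots> \<le> epow \<alpha> (\<integral>\<^sup>+x. f j x \<partial>M)
                   * epow (1 - \<alpha>) (\<Prod>i\<in>I. epow (w i / (1 - \<alpha>)) (\<integral>\<^sup>+x. f i x \<partial>M))"
    using insert.prems \<alpha> sum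
    by (intro mult_left_mono epow_mono insert.IH) (auto simp flip: sum_divide_distrib)
  also have "\<dots> = (\<Prod>i\<in>insert j I. epow (w i) (\<integral>\<^sup>+x. f i x \<partial>M))"
    using insert by (simp add: eq \<alpha>_def)
  finally show ?case .
qed


lemma (in product_sigma_finite) measurable_nn_integral_fun_upd:
  assumes "i \<in> I" "f \<in> borel_measurable (PiM I M)"
  shows "(\<lambda>x. \<integral>\<^sup>+t. f (x(i := t)) \<partial>M i) \<in> borel_measurable (PiM I M)"
proof -
  interpret sigma_finite_measure "M i" by (rule sigma_finite_measures)
  have "(\<lambda>(x, t). x(i := t)) \<in> measurable (PiM I M \<Otimes>\<^sub>M M i) (PiM I M)"
    using assms(1) by (auto simp: case_prod_beta' intro!: measurable_fun_upd[where J = I])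
  from measurable_compose[OF this assms(2)] show ?thesis
    by (intro borel_measurable_nn_integral) (simp add: case_prod_beta')
qed

text \<open>In the usual form each factor is a function that omits one coordinate. Here it is the
  integral of \<open>F i\<close> over the coordinate \<open>i\<close>, so that all functions live on
  the same product space and no projections are needed. The induction removes a coordinate
  \<open>j\<close>: on each slice the factor of \<open>j\<close> is separated by Hoelder's
  inequality and the rest is covered by the induction hypothesis; the remaining integral over the
  \<open>j\<close>-coordinate is a Hoelder inequality with \<open>card I\<close> equal
  weights.\<close>

lemma (in product_sigma_finite) Loomis_Whitney:
  assumes "finite I" "card I \<ge> 2" "\<And>i. i \<in> I \<Longrightarrow> F i \<in> borel_measurable (PiM I M)"
  shows "(\<integral>\<^sup>+x. (\<Prod>i\<in>I. epow (1 / real (card I - 1)) (\<integral>\<^sup>+t. F i (x(i := t)) \<partial>M i)) \<partial>PiM I M)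
           \<le> (\<Prod>i\<in>I. epow (1 / real (card I - 1)) (\<integral>\<^sup>+x. F i x \<partial>PiM I M))"
proof -
  have "I \<noteq> {}" using assms(2) by auto
  with assms(1) show ?thesis using assms(2,3)
  proof (induction I arbitrary: F rule: finite_ne_induct)
    case (singleton i)
    then show ?case by simp
  next
    case (insert j I F)
    note F = insert.prems(2)
    define n where "n = card I"
    have n: "n > 0" "card (insert j I) - 1 = n"
      using insert by (auto simp: n_def card_gt_0_iff)
    have ij: "i \<noteq> j" if "i \<in> I" for i using that insert by auto
    \<comment> \<open>\<open>A\<close> is the factor of \<open>j\<close>, which does not depend on
      the \<open>j\<close>-coordinate; \<open>B y\<close> collects the other factors on the slice
      where that coordinate is \<open>y\<close>; \<open>G i y\<close> is the integral of
      \<open>F i\<close> over the slice.\<close>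
    define A where "A = (\<lambda>x. \<integral>\<^sup>+t. F j (x(j := t)) \<partial>M j)"
    define G where "G = (\<lambda>i y. \<integral>\<^sup>+x. F i (x(j := y)) \<partial>PiM I M)"
    define B where "B = (\<lambda>y x. \<Prod>i\<in>I. epow (1 / n) (\<integral>\<^sup>+t. F i ((x(j := y))(i := t)) \<partial>M i))"
    have upd: "(\<lambda>(x, y). x(j := y)) \<in> measurable (PiM I M \<Otimes>\<^sub>M M j) (PiM (insert j I) M)"
      by (auto simp: case_prod_beta' intro!: measurable_fun_upd[where J = I])
    have Fupd: "(\<lambda>x. F i (x(j := y))) \<in> borel_measurable (PiM I M)"
      if "i \<in> insert j I" "y \<in> space (M j)" for i y
    proof -
      have "(\<lambda>x. x(j := y)) \<in> measurable (PiM I M) (PiM (insert j I) M)"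
        using that(2) by (auto intro!: measurable_fun_upd[where J = I])
      from measurable_compose[OF this F[OF that(1)]] show ?thesis .
    qed
    have A[measurable]: "A \<in> borel_measurable (PiM I M)"
    proof -
      interpret sigma_finite_measure "M j" by (rule sigma_finite_measures)
      show ?thesis unfolding A_def
        using measurable_compose[OF upd F[of j]]
        by (intro borel_measurable_nn_integral) (simp add: case_prod_beta' fun_upd_def)
    qed
    have G[measurable]: "G i \<in> borel_measurable (M j)" if "i \<in> I" for i
    proof -
      interpret finite_product_sigma_finite M I by unfold_locales fact
      have "(\<lambda>(y, x). x(j := y)) \<in> measurable (M j \<Otimes>\<^sub>M PiM I M) (PiM (insert j I) M)"
        by (auto simp: case_prod_beta' intro!: measurable_fun_upd[where J = I])
      from measurable_compose[OF this F[of i]] that show ?thesis unfolding G_def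
        by (intro borel_measurable_nn_integral) (simp add: case_prod_beta' fun_upd_def)
    qed
    have int_A: "(\<integral>\<^sup>+x. A x \<partial>PiM I M) = (\<integral>\<^sup>+x. F j x \<partial>PiM (insert j I) M)"
      unfolding A_def using insert by (subst product_nn_integral_insert) auto
    have int_G: "(\<integral>\<^sup>+y. G i y \<partial>M j) = (\<integral>\<^sup>+x. F i x \<partial>PiM (insert j I) M)" if "i \<in> I" for i
      unfolding G_def using insert that by (subst product_nn_integral_insert_rev) auto
    have slice: "(\<integral>\<^sup>+x. epow (1 / n) (A x) * B y x \<partial>PiM I M)
        \<le> epow (1 / n) (\<integral>\<^sup>+x. A x \<partial>PiM I M) * (\<Prod>i\<in>I. epow (1 / n) (G i y))"
      if y: "y \<in> space (M j)" for y
    proof (cases "n = 1")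
      \<comment> \<open>This is dimension two, the true base case: the induction hypothesis demands
        at least two coordinates. Here \<open>B y\<close> does not depend on \<open>x\<close> at
        all, so the integral factorises.\<close>
      case True
      then obtain i where I: "I = {i}" unfolding n_def by (metis card_1_singletonE)
      have "B y x = G i y" if "x \<in> space (PiM I M)" for x
      proof -
        have "G i y = (\<integral>\<^sup>+t. F i ((\<lambda>_\<in>{i}. t)(j := y)) \<partial>M i)"
          unfolding G_def I using Fupd[of i y] y I
          by (subst distr_component[symmetric], subst nn_integral_distr) (auto intro!: measurable_restrict)
        also have "\<dots> = (\<integral>\<^sup>+t. F i ((x(j := y))(i := t)) \<partial>M i)"
        proof (intro nn_integral_cong arg_cong[of _ _ "F i"] ext)
          fix t k
          show "((\<lambda>_\<in>{i}. t)(j := y)) k = ((x(j := y))(i := t)) k"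
            using that ij[of i] by (auto simp: I space_PiM PiE_def extensional_def)
        qed
        finally show ?thesis by (simp add: B_def I True)
      qed
      then have "(\<integral>\<^sup>+x. epow (1 / n) (A x) * B y x \<partial>PiM I M) = (\<integral>\<^sup>+x. A x * G i y \<partial>PiM I M)"
        using True by (intro nn_integral_cong) simp
      also have "\<dots> = (\<integral>\<^sup>+x. A x \<partial>PiM I M) * G i y"
        by (simp add: nn_integral_multc)
      finally show ?thesis using True by (simp add: I)
    next
      case False
      then have n2: "n \<ge> 2" using n by simp
      define \<alpha> where "\<alpha> = 1 / real n"
      have \<alpha>: "0 < \<alpha>" "\<alpha> < 1" using n2 by (auto simp: \<alpha>_def)
      \<comment> \<open>The Hoelder exponent turns the power 1/(n-1) of the lower-dimensional
        inequality into the required power 1/n.\<close>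
      have \<alpha>': "(1 - \<alpha>) * (1 / real (n - 1)) = \<alpha>"
        using n2 by (simp add: \<alpha>_def field_simps of_nat_diff)
      define B' where "B' = (\<lambda>x. \<Prod>i\<in>I. epow (1 / real (n - 1)) (\<integral>\<^sup>+t. F i ((x(i := t))(j := y)) \<partial>M i))"
      have B': "B y x = epow (1 - \<alpha>) (B' x)" for x
      proof -
        have "(x(j := y))(i := t) = (x(i := t))(j := y)" if "i \<in> I" for i t
          using ij[OF that] by (simp add: fun_upd_twist)
        then show ?thesis
          unfolding B_def B'_def epow_prod epow_epow \<alpha>' by (simp add: \<alpha>_def)
      qed
      have [measurable]: "B' \<in> borel_measurable (PiM I M)"
        unfolding B'_def using Fupd y
        by (intro borel_measurable_prod_ennreal measurable_epow
                  measurable_nn_integral_fun_upd[where f = "\<lambda>x. F _ (x(j := y))"]) auto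
      have "(\<integral>\<^sup>+x. epow (1 / n) (A x) * B y x \<partial>PiM I M)
              \<le> epow \<alpha> (\<integral>\<^sup>+x. A x \<partial>PiM I M) * epow (1 - \<alpha>) (\<integral>\<^sup>+x. B' x \<partial>PiM I M)"
        unfolding B' \<alpha>_def[symmetric] by (intro Holder_nn_integral \<alpha>) auto
      also have "\<dots> \<le> epow \<alpha> (\<integral>\<^sup>+x. A x \<partial>PiM I M)
                       * epow (1 - \<alpha>) (\<Prod>i\<in>I. epow (1 / real (n - 1)) (G i y))"
        unfolding B'_def G_def n_def
        using n2 \<alpha> Fupd y
        by (intro mult_left_mono epow_mono insert.IH[of "\<lambda>i x. F i (x(j := y))"])
           (auto simp: n_def)
      finally show ?thesis
        unfolding epow_prod epow_epow \<alpha>' by (simp add: \<alpha>_def)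
    qed
    have "(\<integral>\<^sup>+x. (\<Prod>i\<in>insert j I. epow (1 / n) (\<integral>\<^sup>+t. F i (x(i := t)) \<partial>M i)) \<partial>PiM (insert j I) M)
            = (\<integral>\<^sup>+y. \<integral>\<^sup>+x. epow (1 / n) (A x) * B y x \<partial>PiM I M \<partial>M j)"
    proof (subst product_nn_integral_insert_rev)
      show "(\<lambda>x. \<Prod>i\<in>insert j I. epow (1 / n) (\<integral>\<^sup>+t. F i (x(i := t)) \<partial>M i))
              \<in> borel_measurable (PiM (insert j I) M)"
        using F by (intro borel_measurable_prod_ennreal measurable_epow
                          measurable_nn_integral_fun_upd)
    qed (use insert.hyps in \<open>auto simp: A_def B_def\<close>)
    also have "\<dots> \<le> (\<integral>\<^sup>+y. epow (1 / n) (\<integral>\<^sup>+x. A x \<partial>PiM I M) * (\<Prod>i\<in>I. epow (1 / n) (G i y)) \<partial>M j)"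
      by (intro nn_integral_mono slice)
    also have "\<dots> = epow (1 / n) (\<integral>\<^sup>+x. A x \<partial>PiM I M) * (\<integral>\<^sup>+y. (\<Prod>i\<in>I. epow (1 / n) (G i y)) \<partial>M j)"
      by (intro nn_integral_cmult borel_measurable_prod_ennreal measurable_epow G)
    also have "\<dots> \<le> epow (1 / n) (\<integral>\<^sup>+x. A x \<partial>PiM I M) * (\<Prod>i\<in>I. epow (1 / n) (\<integral>\<^sup>+y. G i y \<partial>M j))"
      using insert.hyps n by (intro mult_left_mono Holder_nn_integral_prod) (auto simp: n_def)
    also have "\<dots> = (\<Prod>i\<in>insert j I. epow (1 / n) (\<integral>\<^sup>+x. F i x \<partial>PiM (insert j I) M))"
      using insert.hyps by (simp add: int_A int_G)
    finally show ?case unfolding n(2) .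
  qed
qed

subsection \<open>The Gagliardo--Nirenberg inequality\<close>

text \<open>One formula covers the origin as well: for s > 1 the quotient |w|^s / |w| tends to 0
  there, and \<open>sgn 0 = 0\<close>.\<close>

lemma has_derivative_norm_powr:
  fixes z :: "'a::real_inner"
  assumes s: "s > 1"
  shows "((\<lambda>z. norm z powr s) has_derivative (\<lambda>w. s * norm z powr (s - 1) * (sgn z \<bullet> w))) (at z)"
proof (cases "z = 0")
  case False
  have "((\<lambda>z. norm z powr s) has_derivative (\<lambda>w. (w \<bullet> sgn z) * s * norm z powr (s - 1))) (at z)"
    using False by (auto intro!: derivative_eq_intros GDERIV_norm[unfolded gderiv_def] simp: fun_eq_iff powr_diff field_simps)
  then show ?thesis by (simp add: inner_commute mult_ac)
next
  case True
  have "((\<lambda>w. norm w powr (s - 1)) \<longlongrightarrow> 0 powr (s - 1)) (at (0::'a))"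
    using s by (intro tendsto_powr2 tendsto_norm_zero tendsto_const) (auto intro: always_eventually)
  then have "((\<lambda>w. norm w powr (s - 1)) \<longlongrightarrow> 0) (at (0::'a))" by simp
  moreover have "norm w powr (s - 1) = norm w powr s / norm w" if "w \<noteq> 0" for w :: 'a
    using that by (simp add: powr_diff)
  ultimately have "((\<lambda>w. norm w powr s / norm w) \<longlongrightarrow> 0) (at (0::'a))"
    by (auto intro: Lim_transform_eventually simp: eventually_at_filter)
  then have "((\<lambda>z. norm z powr s) has_derivative (\<lambda>w. 0)) (at (0::'a))"
    by (auto simp: has_derivative_at)
  then show ?thesis using True by simp
qed

text \<open>The fundamental theorem of calculus for |h|^s, started to the left of the support.
  Rather than integrating the derivative of |h|^s, which contains \<open>sgn\<close>, it is compared
  with an antiderivative of the continuous majorant \<open>g\<close>.\<close>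

lemma norm_powr_le_nn_integral:
  fixes h :: "real \<Rightarrow> 'a::real_inner"
  assumes s: "s > 1"
    and h: "\<And>t. (h has_vector_derivative h' t) (at t)" and h': "continuous_on UNIV h'"
    and zero: "\<And>t. R < norm t \<Longrightarrow> h t = 0"
  shows "ennreal (norm (h t) powr s)
           \<le> ennreal s * (\<integral>\<^sup>+\<tau>. ennreal (norm (h \<tau>) powr (s - 1) * norm (h' \<tau>)) \<partial>lborel)"
proof -
  \<comment> \<open>A point to the left of \<open>t\<close> and outside the support, whatever the
    sign of \<open>R\<close>.\<close>
  define a where "a = - \<bar>R\<bar> - 1 - \<bar>t\<bar>"
  have a: "a \<le> t" "h a = 0" using zero[of a] by (auto simp: a_def)
  define g where "g = (\<lambda>\<tau>. norm (h \<tau>) powr (s - 1) * norm (h' \<tau>))"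
  have "continuous_on UNIV h"
    using h by (intro continuous_at_imp_continuous_on) (auto intro: has_vector_derivative_continuous)
  then have cont: "continuous_on UNIV g"
    unfolding g_def using s h'
    by (intro continuous_on_mult continuous_on_powr' continuous_on_norm continuous_on_const) auto
  \<comment> \<open>The interval is enlarged by 1 on both sides so that the points of
    \<open>{a..t}\<close> are interior and the derivatives there are two-sided.\<close>
  obtain \<Phi> where \<Phi>: "\<And>\<tau>. \<tau> \<in> {a - 1..t + 1} \<Longrightarrow>
      (\<Phi> has_vector_derivative g \<tau>) (at \<tau> within {a - 1..t + 1})"
    using antiderivative_continuous[OF continuous_on_subset[OF cont]] by blast
  have \<Phi>': "DERIV \<Phi> \<tau> :> g \<tau>" if "a \<le> \<tau>" "\<tau> \<le> t" for \<tau>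
    using \<Phi>[of \<tau>] that at_within_interior[of \<tau> "{a - 1..t + 1}"]
    by (simp add: has_real_derivative_iff_has_vector_derivative)
  define f' where "f' = (\<lambda>\<tau>. s * norm (h \<tau>) powr (s - 1) * (sgn (h \<tau>) \<bullet> h' \<tau>))"
  have f': "DERIV (\<lambda>\<tau>. norm (h \<tau>) powr s) \<tau> :> f' \<tau>" for \<tau>
  proof -
    have "((\<lambda>\<tau>. norm (h \<tau>) powr s) has_derivative
        (\<lambda>x. s * norm (h \<tau>) powr (s - 1) * (sgn (h \<tau>) \<bullet> (x *\<^sub>R h' \<tau>)))) (at \<tau>)"
      using has_derivative_compose[OF h[unfolded has_vector_derivative_def]
              has_derivative_norm_powr[OF s]] .
    moreover have "(\<lambda>x. s * norm (h \<tau>) powr (s - 1) * (sgn (h \<tau>) \<bullet> (x *\<^sub>R h' \<tau>))) = (*) (f' \<tau>)"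
      by (auto simp: f'_def)
    ultimately show ?thesis
      by (simp add: has_field_derivative_def)
  qed
  have "f' \<tau> \<le> s * g \<tau>" for \<tau>
  proof -
    have "sgn (h \<tau>) \<bullet> h' \<tau> \<le> norm (sgn (h \<tau>)) * norm (h' \<tau>)" by (rule norm_cauchy_schwarz)
    also have "\<dots> \<le> 1 * norm (h' \<tau>)" by (intro mult_right_mono) (auto simp: norm_sgn)
    finally show ?thesis
      unfolding f'_def g_def mult.assoc using s by (intro mult_left_mono) auto
  qed
  then have "s * \<Phi> a - norm (h a) powr s \<le> s * \<Phi> t - norm (h t) powr s"
  proof (intro DERIV_nonneg_imp_nondecreasing[of a t "\<lambda>\<tau>. s * \<Phi> \<tau> - norm (h \<tau>) powr s"] a(1))
    fix \<tau> assume "a \<le> \<tau>" "\<tau> \<le> t"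
    then have "DERIV (\<lambda>\<tau>. s * \<Phi> \<tau> - norm (h \<tau>) powr s) \<tau> :> s * g \<tau> - f' \<tau>"
      by (intro DERIV_diff DERIV_cmult \<Phi>' f')
    with \<open>\<And>\<tau>. f' \<tau> \<le> s * g \<tau>\<close>[of \<tau>]
    show "\<exists>y. DERIV (\<lambda>\<tau>. s * \<Phi> \<tau> - norm (h \<tau>) powr s) \<tau> :> y \<and> y \<ge> 0"
      by auto
  qed
  then have "norm (h t) powr s \<le> s * (\<Phi> t - \<Phi> a)"
    using a(2) by (simp add: algebra_simps)
  then have "ennreal (norm (h t) powr s) \<le> ennreal (s * (\<Phi> t - \<Phi> a))"
    by (rule ennreal_leI)
  also have "\<dots> = ennreal s * (\<integral>\<^sup>+\<tau>. ennreal (g \<tau>) * indicator {a..t} \<tau> \<partial>lborel)"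
  proof (subst nn_integral_FTC_Icc)
    show "g \<in> borel_measurable borel" using cont by (rule borel_measurable_continuous_onI)
  qed (use s a \<Phi>' in \<open>auto simp: g_def ennreal_mult' intro: has_field_derivative_at_within\<close>)
  also have "\<dots> \<le> ennreal s * (\<integral>\<^sup>+\<tau>. ennreal (g \<tau>) \<partial>lborel)"
    by (intro mult_left_mono nn_integral_mono) (auto simp: indicator_def)
  finally show ?thesis by (simp add: g_def)
qed

text \<open>For every basis direction, |w|^s is bounded by a line integral that no longer depends on
  the corresponding coordinate. The product over all directions of the 1/(d-1)-th powers is exactly
  the integrand of the Loomis--Whitney inequality.\<close>

lemma Gagliardo_Nirenberg_L1:
  fixes w :: "'a::euclidean_space \<Rightarrow> 'b::real_inner" and s :: real
  assumes dim: "DIM('a) \<ge> 2" and s: "s > 1"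
    and D: "\<And>b x t. b \<in> Basis \<Longrightarrow> ((\<lambda>t. w (x + t *\<^sub>R b)) has_vector_derivative D b (x + t *\<^sub>R b)) (at t)"
    and contw: "continuous_on UNIV w" and cont: "\<And>b. b \<in> Basis \<Longrightarrow> continuous_on UNIV (D b)"
    and zero: "\<And>x. R < norm x \<Longrightarrow> w x = 0"
  shows "(\<integral>\<^sup>+x. ennreal (norm (w x) powr (s * real DIM('a) / (real DIM('a) - 1))) \<partial>lborel)
    \<le> (\<Prod>b\<in>Basis. epow (1 / (real DIM('a) - 1))
          (\<integral>\<^sup>+x. ennreal s * ennreal (norm (w x) powr (s - 1) * norm (D b x)) \<partial>lborel))"
proof -
  interpret product_sigma_finite "\<lambda>_::'a. lborel :: real measure" by unfold_locales
  define n where "n = DIM('a)"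
  have n: "n \<ge> 2" using dim by (simp add: n_def)
  \<comment> \<open>Passage from coordinate families to points; it transports the product measure to
    Lebesgue measure.\<close>
  define T :: "('a \<Rightarrow> real) \<Rightarrow> 'a" where "T = (\<lambda>f. \<Sum>b\<in>Basis. f b *\<^sub>R b)"
  define P where "P = PiM (Basis::'a set) (\<lambda>_. lborel :: real measure)"
  define F where "F = (\<lambda>b x. ennreal s * ennreal (norm (w x) powr (s - 1) * norm (D b x)))"
  have T[measurable]: "T \<in> borel_measurable P"
    unfolding T_def P_def by measurable
  have upd: "T (f(b := t)) = T f + (t - f b) *\<^sub>R b" if "b \<in> Basis" for f b t
  proof -
    have "T (f(b := t)) = (\<Sum>c\<in>Basis. f c *\<^sub>R c + (if c = b then (t - f b) *\<^sub>R b else 0))"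
      unfolding T_def by (intro sum.cong) (auto simp: algebra_simps)
    then show ?thesis using that by (simp add: T_def sum.distrib)
  qed
  have [measurable]: "w \<in> borel_measurable borel" "\<And>b. b \<in> Basis \<Longrightarrow> D b \<in> borel_measurable borel"
    using contw cont by (auto intro: borel_measurable_continuous_onI)
  have [measurable]: "F b \<in> borel_measurable borel" if [simp]: "b \<in> Basis" for b
    unfolding F_def by measurable
  have line: "ennreal (norm (w (T f)) powr s) \<le> (\<integral>\<^sup>+t. F b (T (f(b := t))) \<partial>lborel)"
    if b: "b \<in> Basis" for b f
  proof -
    \<comment> \<open>Base point of the line, with its coordinate along \<open>b\<close> set to 0,
      so that the line is parametrised by that coordinate itself.\<close>
    define T0 where "T0 = T (f(b := 0))"
    define h where "h = (\<lambda>t. w (T0 + t *\<^sub>R b))"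
    define h' where "h' = (\<lambda>t. D b (T0 + t *\<^sub>R b))"
    have T: "T (f(b := t)) = T0 + t *\<^sub>R b" for t
      unfolding T0_def upd[OF b] by (simp add: scaleR_diff_left)
    have "ennreal (norm (h (f b)) powr s)
        \<le> ennreal s * (\<integral>\<^sup>+\<tau>. ennreal (norm (h \<tau>) powr (s - 1) * norm (h' \<tau>)) \<partial>lborel)"
    proof (rule norm_powr_le_nn_integral[OF s])
      show "(h has_vector_derivative h' t) (at t)" for t
        unfolding h_def h'_def by (rule D[OF b])
      show "continuous_on UNIV h'"
        unfolding h'_def
        by (intro continuous_on_compose2[OF cont[OF b]] continuous_intros) auto
      show "h t = 0" if "R + norm (T0) < norm t" for t
      proof -
        have "norm (t *\<^sub>R b) \<le> norm (T0 + t *\<^sub>R b) + norm (T0)"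
          using norm_triangle_ineq4[of "T0 + t *\<^sub>R b" "T0"] by simp
        then show ?thesis using that b unfolding h_def by (intro zero) auto
      qed
    qed
    also have "\<dots> = (\<integral>\<^sup>+\<tau>. F b (T (f(b := \<tau>))) \<partial>lborel)"
      unfolding F_def T h_def h'_def
      using b by (intro nn_integral_cmult[symmetric]) measurable
    finally have "ennreal (norm (h (f b)) powr s) \<le> (\<integral>\<^sup>+\<tau>. F b (T (f(b := \<tau>))) \<partial>lborel)" .
    moreover have "h (f b) = w (T f)" using T[of "f b"] by (simp add: h_def)
    ultimately show ?thesis by simp
  qed
  have "(\<integral>\<^sup>+x. ennreal (norm (w x) powr (s * real n / (real n - 1))) \<partial>lborel)
      = (\<integral>\<^sup>+f. ennreal (norm (w (T f)) powr (s * real n / (real n - 1))) \<partial>P)"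
    unfolding P_def T_def by (subst lborel_eq, subst nn_integral_distr) auto
  also have "\<dots> \<le> (\<integral>\<^sup>+f. (\<Prod>b\<in>Basis. epow (1 / real (card (Basis::'a set) - 1))
                           (\<integral>\<^sup>+t. F b (T (f(b := t))) \<partial>lborel)) \<partial>P)"
  proof (rule nn_integral_mono)
    fix f
    \<comment> \<open>There are d equal factors, each with exponent s/(d-1); this is the origin of
      the exponent s d/(d-1).\<close>
    have "ennreal (norm (w (T f)) powr (s * real n / (real n - 1)))
        = (\<Prod>b\<in>(Basis::'a set). epow (1 / real (card (Basis::'a set) - 1)) (ennreal (norm (w (T f)) powr s)))"
      using n by (cases "w (T f) = 0") (auto simp: n_def powr_powr powr_power ennreal_power mult.commute)
    also have "\<dots> \<le> (\<Prod>b\<in>Basis. epow (1 / real (card (Basis::'a set) - 1)) (\<integral>\<^sup>+t. F b (T (f(b := t))) \<partial>lborel))"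
      by (intro prod_mono_ennreal epow_mono line) auto
    finally show "ennreal (norm (w (T f)) powr (s * real n / (real n - 1))) \<le> \<dots>" .
  qed
  also have "\<dots> \<le> (\<Prod>b\<in>Basis. epow (1 / real (card (Basis::'a set) - 1)) (\<integral>\<^sup>+f. F b (T f) \<partial>P))"
    unfolding P_def using dim
    by (intro Loomis_Whitney[where F = "\<lambda>b f. F b (T f)"]) (auto simp flip: P_def)
  also have "(\<integral>\<^sup>+f. F b (T f) \<partial>P) = (\<integral>\<^sup>+x. F b x \<partial>lborel)" if "b \<in> Basis" for b
    unfolding P_def T_def using that by (subst (2) lborel_eq, subst nn_integral_distr) auto
  then have "(\<Prod>b\<in>Basis. epow (1 / real (card (Basis::'a set) - 1)) (\<integral>\<^sup>+f. F b (T f) \<partial>P))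
      = (\<Prod>b\<in>Basis. epow (1 / real (card (Basis::'a set) - 1)) (\<integral>\<^sup>+x. F b x \<partial>lborel))"
    by (intro prod.cong) auto
  finally show ?thesis using n by (simp add: F_def n_def of_nat_diff)
qed


lemma Holder_integral:
  fixes f g :: "'a \<Rightarrow> real"
  assumes \<alpha>: "0 < \<alpha>" "\<alpha> < 1"
    and f: "integrable M f" "\<And>x. 0 \<le> f x" and g: "integrable M g" "\<And>x. 0 \<le> g x"
  shows "integrable M (\<lambda>x. f x powr \<alpha> * g x powr (1 - \<alpha>))"
    and "(LINT x|M. f x powr \<alpha> * g x powr (1 - \<alpha>))
           \<le> (LINT x|M. f x) powr \<alpha> * (LINT x|M. g x) powr (1 - \<alpha>)"
proof -
  let ?h = "\<lambda>x. f x powr \<alpha> * g x powr (1 - \<alpha>)"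
  have [measurable]: "f \<in> borel_measurable M" "g \<in> borel_measurable M" using f g by auto
  have "(\<integral>\<^sup>+x. ennreal (?h x) \<partial>M) = (\<integral>\<^sup>+x. epow \<alpha> (ennreal (f x)) * epow (1 - \<alpha>) (ennreal (g x)) \<partial>M)"
    using f g by (simp add: ennreal_mult)
  also have "\<dots> \<le> epow \<alpha> (\<integral>\<^sup>+x. f x \<partial>M) * epow (1 - \<alpha>) (\<integral>\<^sup>+x. g x \<partial>M)"
    by (rule Holder_nn_integral[OF \<alpha>]) auto
  also have "\<dots> = ennreal ((LINT x|M. f x) powr \<alpha> * (LINT x|M. g x) powr (1 - \<alpha>))"
    using f g by (simp add: nn_integral_eq_integral integral_nonneg ennreal_mult)
  finally have le: "(\<integral>\<^sup>+x. ennreal (?h x) \<partial>M) \<le> \<dots>" .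
  show int: "integrable M ?h"
    using order.strict_trans1[OF le] by (intro integrableI_bounded) (auto simp: abs_mult)
  then show "(LINT x|M. ?h x) \<le> (LINT x|M. f x) powr \<alpha> * (LINT x|M. g x) powr (1 - \<alpha>)"
    using le by (simp add: nn_integral_eq_integral)
qed

lemma integrable_continuous_bounded_support:
  fixes f :: "'a::euclidean_space \<Rightarrow> 'b::euclidean_space"
  assumes "continuous_on UNIV f" "\<And>x. R < norm x \<Longrightarrow> f x = 0"
  shows "integrable lborel f"
proof -
  have "integrable lborel (\<lambda>x. indicator (cball 0 R) x *\<^sub>R f x)"
    using assms(1) by (intro borel_integrable_compact continuous_on_subset[OF assms(1)]) auto
  also have "(\<lambda>x. indicator (cball 0 R) x *\<^sub>R f x) = f"
    using assms(2) by (force simp: indicator_def)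
  finally show ?thesis .
qed

text \<open>Taking |w|^s with s > 1 is what brings in the gradient in \<open>L^2\<close>:
  Cauchy--Schwarz separates |w|^(s-1) from the derivative. Each directional integral is enlarged to
  the full gradient sum, so that the d factors coincide and the product becomes a single
  power.\<close>

lemma Gagliardo_Nirenberg_step:
  fixes w :: "'a::euclidean_space \<Rightarrow> 'b::euclidean_space" and s :: real
  assumes dim: "DIM('a) \<ge> 2" and s: "s > 1"
    and D: "\<And>b x t. b \<in> Basis \<Longrightarrow> ((\<lambda>t. w (x + t *\<^sub>R b)) has_vector_derivative D b (x + t *\<^sub>R b)) (at t)"
    and contw: "continuous_on UNIV w" and cont: "\<And>b. b \<in> Basis \<Longrightarrow> continuous_on UNIV (D b)"
    and zero: "\<And>x. R < norm x \<Longrightarrow> w x = 0" and zero': "\<And>b x. b \<in> Basis \<Longrightarrow> R < norm x \<Longrightarrow> D b x = 0"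
  shows "(LINT x|lborel. norm (w x) powr (s * DIM('a) / (DIM('a) - 1))) powr ((DIM('a) - 1) / DIM('a))
    \<le> s * (LINT x|lborel. norm (w x) powr (2 * (s - 1))) powr (1 / 2)
        * (\<Sum>b\<in>Basis. LINT x|lborel. (norm (D b x))\<^sup>2) powr (1 / 2)"
proof -
  define d where "d = real DIM('a)"
  have d: "d \<ge> 2" using dim by (simp add: d_def)
  define J where "J = (LINT x|lborel. norm (w x) powr (s * d / (d - 1)))"
  define I where "I = (LINT x|lborel. norm (w x) powr (2 * (s - 1)))"
  define N where "N = (\<lambda>b. LINT x|lborel. (norm (D b x))\<^sup>2)"
  define S where "S = (\<Sum>b\<in>Basis. N b)"
  have powr_int: "integrable lborel (\<lambda>x. norm (w x) powr e)" if "e > 0" for e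
    using that contw zero
    by (intro integrable_continuous_bounded_support[of _ R] continuous_on_powr' continuous_intros) auto
  have N_int: "integrable lborel (\<lambda>x. (norm (D b x))\<^sup>2)" if "b \<in> Basis" for b
    using that cont zero'
    by (intro integrable_continuous_bounded_support[of _ R] continuous_intros) auto
  have nonneg: "0 \<le> J" "0 \<le> I" "\<And>b. 0 \<le> N b" "0 \<le> S"
    by (auto simp: J_def I_def N_def S_def intro!: integral_nonneg sum_nonneg)
  have factor: "(\<integral>\<^sup>+x. ennreal s * ennreal (norm (w x) powr (s - 1) * norm (D b x)) \<partial>lborel)
      \<le> ennreal (s * I powr (1 / 2) * S powr (1 / 2))" if b: "b \<in> Basis" for b
  proof -
    have eq: "norm (w x) powr (s - 1) * norm (D b x)
        = (norm (w x) powr (2 * (s - 1))) powr (1 / 2) * ((norm (D b x))\<^sup>2) powr (1 - 1 / 2)" for x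
      by (simp add: powr_powr powr_half_sqrt diff_divide_distrib)
    have int: "integrable lborel (\<lambda>x. norm (w x) powr (s - 1) * norm (D b x))"
      unfolding eq using s b by (intro Holder_integral powr_int N_int) auto
    have "(LINT x|lborel. norm (w x) powr (s - 1) * norm (D b x)) \<le> I powr (1 / 2) * N b powr (1 - 1 / 2)"
      unfolding eq I_def N_def using s b by (intro Holder_integral powr_int N_int) auto
    also have "\<dots> \<le> I powr (1 / 2) * S powr (1 - 1 / 2)"
      using nonneg b unfolding S_def by (intro mult_left_mono powr_mono2 member_le_sum) auto
    finally show ?thesis using int s
      by (simp add: nn_integral_cmult nn_integral_eq_integral ennreal_mult'[symmetric] mult.assoc
               borel_measurable_integrable)
  qed
  have "ennreal J = (\<integral>\<^sup>+x. ennreal (norm (w x) powr (s * d / (d - 1))) \<partial>lborel)"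
    unfolding J_def using s d by (intro nn_integral_eq_integral[symmetric] powr_int) auto
  also have "\<dots> \<le> (\<Prod>b\<in>Basis. epow (1 / (d - 1))
       (\<integral>\<^sup>+x. ennreal s * ennreal (norm (w x) powr (s - 1) * norm (D b x)) \<partial>lborel))"
    unfolding d_def by (rule Gagliardo_Nirenberg_L1[OF dim s D contw cont zero])
  also have "\<dots> \<le> (\<Prod>b\<in>(Basis::'a set). epow (1 / (d - 1)) (ennreal (s * I powr (1 / 2) * S powr (1 / 2))))"
    using d by (intro prod_mono_ennreal epow_mono factor) auto
  also have "\<dots> = ennreal ((s * I powr (1 / 2) * S powr (1 / 2)) powr (d / (d - 1)))"
    using s d by (cases "s * I powr (1 / 2) * S powr (1 / 2) = 0")
      (auto simp: ennreal_power powr_power d_def)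
  finally have "J \<le> (s * I powr (1 / 2) * S powr (1 / 2)) powr (d / (d - 1))"
    by simp
  then have "J powr ((d - 1) / d) \<le> ((s * I powr (1 / 2) * S powr (1 / 2)) powr (d / (d - 1))) powr ((d - 1) / d)"
    using nonneg d by (intro powr_mono2) auto
  also have "\<dots> = s * I powr (1 / 2) * S powr (1 / 2)"
    using d s by (simp add: powr_powr)
  finally show ?thesis
    using dim by (simp add: J_def I_def S_def N_def d_def of_nat_diff)
qed


text \<open>Arithmetic of the interpolation. \<open>M\<close>, \<open>N\<close> stand for the
  squared \<open>L^2\<close> norms of the function and its gradient, \<open>J\<close>,
  \<open>I\<close> for its integrals with exponents \<open>Q\<close>, \<open>q\<close>. After taking
  logarithms both hypotheses are linear, and \<open>ln J\<close> is eliminated.\<close>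

lemma Gagliardo_Nirenberg_exponents:
  fixes d p s q Q t t' \<theta> :: real
  assumes "d > 1" "p > 1" "s > 1" and q: "q = 2 * p / (p - 1)" and Q: "Q = s * d / (d - 1)" "Q > 2"
    and t: "t = (2 * s - 4) / (Q - 2)" and t': "t' = (q - 2) / (Q - 2)" "t' \<ge> 0" and \<theta>: "\<theta> = d / (2 * p)"
    and pos: "M > 0" "N > 0" "J > 0" "I > 0"
    and J: "J powr ((d - 1) / d) \<le> s * (M powr (1 - t) * J powr t) powr (1 / 2) * N powr (1 / 2)"
    and I: "I \<le> M powr (1 - t') * J powr t'"
  shows "I powr (1 - 1 / p) \<le> s powr (2 * \<theta>) * (N powr \<theta> * M powr (1 - \<theta>))"
proof -
  have lnJ: "(d - 1) / d * ln J \<le> ln s + ((1 - t) * ln M + t * ln J) / 2 + ln N / 2"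
  proof -
    have "ln (J powr ((d - 1) / d)) \<le> ln (s * (M powr (1 - t) * J powr t) powr (1 / 2) * N powr (1 / 2))"
      using J pos \<open>s > 1\<close> by (subst ln_le_cancel_iff) auto
    then show ?thesis
      using pos \<open>s > 1\<close> by (simp add: ln_mult ln_powr)
  qed
  have lnI: "ln I \<le> (1 - t') * ln M + t' * ln J"
  proof -
    have "ln I \<le> ln (M powr (1 - t') * J powr t')"
      using I pos by (subst ln_le_cancel_iff) auto
    then show ?thesis using pos by (simp add: ln_mult ln_powr)
  qed
  \<comment> \<open>The net power of \<open>J\<close> in the first hypothesis once its occurrence on
    the right has been absorbed on the left.\<close>
  define \<kappa> where "\<kappa> = (d - 1) / d - t / 2"
  define \<beta> where "\<beta> = 1 - 1 / p"
  have s: "s = Q * (d - 1) / d" using Q(1) \<open>d > 1\<close> by simp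
  have \<kappa>: "\<kappa> * d * (Q - 2) = 2"
  proof -
    have "\<kappa> * d * (Q - 2) = (d - 1) * (Q - 2) - (t * (Q - 2)) * d / 2"
      using \<open>d > 1\<close> by (simp add: \<kappa>_def field_simps)
    also have "t * (Q - 2) = 2 * s - 4" using Q(2) by (simp add: t)
    also have "(d - 1) * (Q - 2) - (2 * s - 4) * d / 2 = 2"
      using \<open>d > 1\<close> by (simp add: s field_simps)
    finally show ?thesis .
  qed
  have \<beta>: "\<beta> > 0" "\<beta> * q = 2" using \<open>p > 1\<close> by (auto simp: \<beta>_def q field_simps)
  \<comment> \<open>The power of \<open>J\<close> in the second hypothesis is a multiple of the net
    power in the first; the factor 2 \<theta> is also the exponent of \<open>s\<close> in the
    constant.\<close>
  have \<beta>t': "\<beta> * t' = 2 * \<theta> * \<kappa>"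
  proof -
    have "(\<beta> * t') * (d * (Q - 2)) = (\<beta> * q - 2 * \<beta>) * d"
      using Q(2) by (simp add: t' field_simps)
    also have "\<dots> = 2 * d / p" using \<beta> by (simp add: \<beta>_def field_simps)
    also have "\<dots> = 2 * \<theta> * (\<kappa> * d * (Q - 2))" unfolding \<kappa> by (simp add: \<theta>)
    finally have "(\<beta> * t') * (d * (Q - 2)) = (2 * \<theta> * \<kappa>) * (d * (Q - 2))" by (simp only: mult_ac)
    then show ?thesis using \<open>d > 1\<close> Q(2) by simp
  qed
  \<comment> \<open>The powers of \<open>M\<close> from both hypotheses add up to the exponent that
    homogeneity in \<open>w\<close> demands.\<close>
  have M: "\<beta> * (1 - t') + \<theta> * (1 - t) = 1 - \<theta>"
  proof -
    have "\<beta> * (1 - t') + \<theta> * (1 - t) = \<beta> + \<theta> - 2 * \<theta> * (\<kappa> + t / 2)"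
      using \<beta>t' by (simp add: algebra_simps)
    also have "\<kappa> + t / 2 = 1 - 1 / d" using \<open>d > 1\<close> by (simp add: \<kappa>_def field_simps)
    also have "\<beta> + \<theta> - 2 * \<theta> * (1 - 1 / d) = 1 - \<theta>"
      using \<open>d > 1\<close> \<open>p > 1\<close> by (simp add: \<beta>_def \<theta> field_simps)
    finally show ?thesis .
  qed
  have "\<theta> > 0" using \<open>d > 1\<close> \<open>p > 1\<close> by (simp add: \<theta>)
  have "\<beta> * ln I \<le> \<beta> * ((1 - t') * ln M + t' * ln J)"
    using lnI \<beta> by (intro mult_left_mono) auto
  also have "\<dots> = \<beta> * (1 - t') * ln M + 2 * \<theta> * (\<kappa> * ln J)"
    unfolding distrib_left mult.assoc[symmetric] \<beta>t' ..
  also have "\<kappa> * ln J \<le> ln s + (1 - t) * ln M / 2 + ln N / 2"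
    using lnJ by (simp add: \<kappa>_def algebra_simps add_divide_distrib diff_divide_distrib)
  then have "\<beta> * (1 - t') * ln M + 2 * \<theta> * (\<kappa> * ln J)
      \<le> \<beta> * (1 - t') * ln M + 2 * \<theta> * (ln s + (1 - t) * ln M / 2 + ln N / 2)"
    using \<open>\<theta> > 0\<close> by (intro add_left_mono mult_left_mono) auto
  also have "\<dots> = 2 * \<theta> * ln s + (\<theta> * ln N + (\<beta> * (1 - t') + \<theta> * (1 - t)) * ln M)"
    by (simp add: algebra_simps add_divide_distrib diff_divide_distrib)
  finally have "ln (I powr \<beta>) \<le> ln (s powr (2 * \<theta>) * (N powr \<theta> * M powr (1 - \<theta>)))"
    using pos \<open>s > 1\<close> unfolding M by (simp add: ln_mult ln_powr)
  then show ?thesis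
    using pos \<open>s > 1\<close> by (subst (asm) ln_le_cancel_iff) (auto simp: \<beta>_def)
qed


text \<open>The exponent q = 2p/(p-1) is the one for which |w|^2 pairs with a weight in
  \<open>L^p\<close>. The previous step bounds the integral with exponent Q by the one with exponent
  r = 2(s-1); the integrals with exponents r and q are both interpolated between 2 and Q, and the
  integral with exponent Q is then eliminated. For d >= 3 the condition p >= d/2 says precisely that
  q does not exceed the critical exponent.\<close>

lemma Gagliardo_Nirenberg:
  fixes p :: real
  assumes dim: "DIM('a) \<ge> 2" and p: "p > 1" "p \<ge> DIM('a) / 2"
  obtains C where "C > 0"
    "\<And>(w :: 'a::euclidean_space \<Rightarrow> 'b::euclidean_space) D R.
      (\<And>b x t. b \<in> Basis \<Longrightarrow> ((\<lambda>t. w (x + t *\<^sub>R b)) has_vector_derivative D b (x + t *\<^sub>R b)) (at t)) \<Longrightarrow>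
      continuous_on UNIV w \<Longrightarrow> (\<And>b. b \<in> Basis \<Longrightarrow> continuous_on UNIV (D b)) \<Longrightarrow>
      (\<And>x. R < norm x \<Longrightarrow> w x = 0) \<Longrightarrow> (\<And>b x. b \<in> Basis \<Longrightarrow> R < norm x \<Longrightarrow> D b x = 0) \<Longrightarrow>
      (LINT x|lborel. norm (w x) powr (2 * p / (p - 1))) powr (1 - 1 / p)
        \<le> C * ((\<Sum>b\<in>Basis. LINT x|lborel. (norm (D b x))\<^sup>2) powr (DIM('a) / (2 * p))
               * (LINT x|lborel. (norm (w x))\<^sup>2) powr (1 - DIM('a) / (2 * p)))"
proof -
  define d where "d = real DIM('a)"
  define q where "q = 2 * p / (p - 1)"
  \<comment> \<open>For \<open>d \<ge> 3\<close> this is the exponent for which \<open>Q = r\<close> is the critical Sobolev exponent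
      \<open>2 d / (d - 2)\<close>; for \<open>d = 2\<close> there is none, and any \<open>s\<close> with \<open>Q \<ge> q\<close> and \<open>r \<ge> 2\<close> will do.\<close>
  define s where "s = (if d = 2 then max 2 (q / 2) else 2 * (d - 1) / (d - 2))"
  define Q where "Q = s * d / (d - 1)"
  define r where "r = 2 * (s - 1)"
  define \<theta> where "\<theta> = d / (2 * p)"
  have d: "d \<ge> 2" "d = 2 \<or> d \<ge> 3"
  proof -
    have "DIM('a) = 2 \<or> DIM('a) \<ge> 3" using dim by linarith
    then show "d \<ge> 2" "d = 2 \<or> d \<ge> 3" by (auto simp: d_def)
  qed
  have q: "q > 2" using p by (simp add: q_def field_simps)
  have sQ: "s \<ge> 2" "Q \<ge> q" "Q \<ge> r"
  proof -
    have "s \<ge> 2 \<and> Q \<ge> q \<and> Q \<ge> r"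
    proof (cases "d = 2")
      case True
      then show ?thesis by (simp add: s_def Q_def r_def)
    next
      case False
      with d have d3: "d \<ge> 3" by simp
      have "q \<le> 2 * d / (d - 2)"
      proof -
        have "2 * p * (d - 2) \<le> 2 * d * (p - 1)"
          using p d3 by (simp add: d_def algebra_simps)
        then have "q * (d - 2) \<le> 2 * d" using p by (simp add: q_def field_simps)
        then show ?thesis using d3 by (simp add: pos_le_divide_eq)
      qed
      moreover have "Q = 2 * d / (d - 2)"
        using d3 by (simp add: Q_def s_def del: right_diff_distrib_numeral)
      moreover have "r = 2 * d / (d - 2)"
        using d3 by (simp add: r_def s_def field_simps)
      moreover have "s \<ge> 2" using d3 by (simp add: s_def pos_le_divide_eq)
      ultimately show ?thesis by simp
    qed
    then show "s \<ge> 2" "Q \<ge> q" "Q \<ge> r" by auto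
  qed
  have r: "r \<ge> 2" using sQ by (simp add: r_def)
  show thesis
  proof (rule that)
    show "s powr (2 * \<theta>) > 0" using sQ by simp
  next
    fix w :: "'a \<Rightarrow> 'b" and D R
    assume D: "\<And>b x t. b \<in> Basis \<Longrightarrow> ((\<lambda>t. w (x + t *\<^sub>R b)) has_vector_derivative D b (x + t *\<^sub>R b)) (at t)"
      and contw: "continuous_on UNIV w" and cont: "\<And>b. b \<in> Basis \<Longrightarrow> continuous_on UNIV (D b)"
      and zero: "\<And>x. R < norm x \<Longrightarrow> w x = 0" and zero': "\<And>b x. b \<in> Basis \<Longrightarrow> R < norm x \<Longrightarrow> D b x = 0"
    define I where "I = (\<lambda>e. LINT x|lborel. norm (w x) powr e)"
    define N where "N = (\<Sum>b\<in>Basis. LINT x|lborel. (norm (D b x))\<^sup>2)"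
    have [measurable]: "w \<in> borel_measurable borel"
      using contw by (rule borel_measurable_continuous_onI)
    have int: "integrable lborel (\<lambda>x. norm (w x) powr e)" if "e > 0" for e
      using that contw zero
      by (intro integrable_continuous_bounded_support[of _ R] continuous_on_powr' continuous_intros) auto
    have I2: "I 2 = (LINT x|lborel. (norm (w x))\<^sup>2)"
      unfolding I_def by (intro Bochner_Integration.integral_cong) auto
    have N_nonneg: "N \<ge> 0" by (auto simp: N_def intro!: sum_nonneg integral_nonneg)
    have I_nonneg: "I e \<ge> 0" for e by (auto simp: I_def)
    have "I q powr (1 - 1 / p) \<le> s powr (2 * \<theta>) * (N powr \<theta> * I 2 powr (1 - \<theta>))"
    \<comment> \<open>The elimination uses logarithms and needs positive integrals; for
      \<open>w\<close> vanishing almost everywhere the left-hand side is 0.\<close>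
    proof (cases "AE x in lborel. w x = 0")
      case True
      then have "I e = 0" for e
        unfolding I_def by (intro integral_eq_zero_AE) (auto elim: eventually_mono)
      then show ?thesis by simp
    next
      case False
      have I_pos: "I e > 0" if "e > 0" for e
      proof (rule ccontr)
        assume "\<not> ?thesis"
        then have "I e = 0" using I_nonneg[of e] by simp
        then have "AE x in lborel. norm (w x) powr e = 0"
          unfolding I_def using int[OF that] by (subst (asm) integral_nonneg_eq_0_iff_AE) auto
        with False show False by simp
      qed
      have interp: "I e \<le> I 2 powr (1 - (e - 2) / (Q - 2)) * I Q powr ((e - 2) / (Q - 2))"
        if e: "2 \<le> e" "e \<le> Q" for e
      proof -
        \<comment> \<open>The endpoints are separate because Hoelder's inequality is available only
          for weights strictly between 0 and 1.\<close>
        consider "e = 2" | "e = Q" | "2 < e" "e < Q" using e by linarith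
        then show ?thesis
        proof cases
          case 3
          define \<alpha> where "\<alpha> = (e - 2) / (Q - 2)"
          have \<alpha>: "0 < \<alpha>" "\<alpha> < 1" using 3 by (auto simp: \<alpha>_def)
          have e_eq: "e = Q * \<alpha> + 2 * (1 - \<alpha>)"
          proof -
            have "Q * \<alpha> + 2 * (1 - \<alpha>) = \<alpha> * (Q - 2) + 2" by (simp add: algebra_simps)
            also have "\<dots> = e" using 3 by (simp add: \<alpha>_def)
            finally show ?thesis by simp
          qed
          have "norm (w x) powr e = (norm (w x) powr Q) powr \<alpha> * (norm (w x) powr 2) powr (1 - \<alpha>)" for x
            unfolding powr_powr powr_add[symmetric] e_eq[symmetric] ..
          then have "I e = (LINT x|lborel. (norm (w x) powr Q) powr \<alpha> * (norm (w x) powr 2) powr (1 - \<alpha>))"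
            unfolding I_def by (intro Bochner_Integration.integral_cong) auto
          also have "\<dots> \<le> I Q powr \<alpha> * I 2 powr (1 - \<alpha>)"
            unfolding I_def using q sQ by (intro Holder_integral \<alpha> int) auto
          finally show ?thesis by (simp add: \<alpha>_def mult.commute)
        qed (use I_pos[of 2] I_pos[of e] I_pos[of Q] q sQ e in \<open>auto simp: powr_one\<close>)
      qed
      have step: "I Q powr ((d - 1) / d) \<le> s * I r powr (1 / 2) * N powr (1 / 2)"
        unfolding I_def N_def Q_def r_def d_def
        using Gagliardo_Nirenberg_step[OF dim _ D contw cont zero zero', of s] sQ dim
        by (simp add: of_nat_diff)
      have "I Q > 0" using I_pos q sQ by simp
      have "N > 0"
      proof (rule ccontr)
        assume "\<not> ?thesis"
        then have "I Q powr ((d - 1) / d) \<le> 0" using step N_nonneg by simp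
        moreover have "I Q powr ((d - 1) / d) > 0" using \<open>I Q > 0\<close> by simp
        ultimately show False by simp
      qed
      show ?thesis
      proof (rule Gagliardo_Nirenberg_exponents[where t = "(2 * s - 4) / (Q - 2)" and t' = "(q - 2) / (Q - 2)"])
        show "I Q powr ((d - 1) / d)
          \<le> s * (I 2 powr (1 - (2 * s - 4) / (Q - 2)) * I Q powr ((2 * s - 4) / (Q - 2))) powr (1 / 2) * N powr (1 / 2)"
        proof (rule order.trans[OF step], intro mult_right_mono mult_left_mono powr_mono2)
          show "I r \<le> I 2 powr (1 - (2 * s - 4) / (Q - 2)) * I Q powr ((2 * s - 4) / (Q - 2))"
            using interp[of r] r sQ by (simp add: r_def algebra_simps)
        qed (use sQ I_nonneg in auto)
        show "I q \<le> I 2 powr (1 - (q - 2) / (Q - 2)) * I Q powr ((q - 2) / (Q - 2))"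
          using interp[of q] q sQ by simp
      qed (use d p q sQ \<open>N > 0\<close> I_pos \<open>I Q > 0\<close> in \<open>auto simp: q_def[symmetric] Q_def[symmetric] \<theta>_def\<close>)
    qed
    then show "(LINT x|lborel. norm (w x) powr (2 * p / (p - 1))) powr (1 - 1 / p)
        \<le> s powr (2 * \<theta>) * ((\<Sum>b\<in>Basis. LINT x|lborel. (norm (D b x))\<^sup>2) powr (DIM('a) / (2 * p))
               * (LINT x|lborel. (norm (w x))\<^sup>2) powr (1 - DIM('a) / (2 * p)))"
      by (simp add: I2 N_def \<theta>_def d_def I_def q_def)
  qed
qed

subsection \<open>Test functions\<close>

lemmas frechet_derivative_worksD = frechet_derivative_works[THEN iffD1]

lemma partial_deriv_eq: "(f has_derivative f') (at x) \<Longrightarrow> partial_deriv i f x = f' (axis i 1)"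
  using frechet_derivative_at[of f f' x] by (simp add: partial_deriv_def)

lemma C_k_Suc_has_derivative:
  "C_k (Suc k) f \<Longrightarrow> (f has_derivative frechet_derivative f (at x)) (at x)"
  by (simp add: differentiable_on_eq_differentiable_at frechet_derivative_works)

lemma C_k_Suc_imp_C_k: "C_k (Suc k) f \<Longrightarrow> C_k k f"
proof (induction k arbitrary: f)
  case 0
  then show ?case by (simp add: differentiable_imp_continuous_on)
qed simp

lemma C_k_const: "C_k k (\<lambda>x::real^'n::finite. c)"
proof (induction k arbitrary: c)
  case (Suc k)
  have "partial_deriv i (\<lambda>x::real^'n. c) = (\<lambda>x. 0)" for i
    by (auto intro!: ext partial_deriv_eq[OF has_derivative_const])
  with Suc show ?case by simp
qed simp

lemma C_k_add: "C_k k f \<Longrightarrow> C_k k g \<Longrightarrow> C_k k (\<lambda>x. f x + g x)"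
proof (induction k arbitrary: f g)
  case (Suc k)
  have "partial_deriv i (\<lambda>x. f x + g x) = (\<lambda>x. partial_deriv i f x + partial_deriv i g x)" for i
    using partial_deriv_eq[OF has_derivative_add[OF C_k_Suc_has_derivative[OF Suc.prems(1)]
                                C_k_Suc_has_derivative[OF Suc.prems(2)]], of i]
    by (auto simp: partial_deriv_def)
  with Suc show ?case by (simp add: differentiable_on_add)
qed (auto intro: continuous_intros)

lemma partial_deriv_mult:
  assumes "f differentiable at x" "g differentiable at x"
  shows "partial_deriv i (\<lambda>x. f x * g x) x = f x * partial_deriv i g x + partial_deriv i f x * g x"
  using partial_deriv_eq[OF has_derivative_mult[OF assms[THEN frechet_derivative_worksD]], of i]
  by (simp add: partial_deriv_def)

lemma C_k_Suc_differentiable: "C_k (Suc k) f \<Longrightarrow> f differentiable at x"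
  by (simp add: differentiable_on_eq_differentiable_at)

lemma C_k_mult: "C_k k f \<Longrightarrow> C_k k g \<Longrightarrow> C_k k (\<lambda>x. f x * g x)"
proof (induction k arbitrary: f g)
  case (Suc k)
  have "partial_deriv i (\<lambda>x. f x * g x) = (\<lambda>x. f x * partial_deriv i g x + partial_deriv i f x * g x)" for i
    using Suc.prems by (auto simp only: partial_deriv_mult C_k_Suc_differentiable)
  with Suc C_k_Suc_imp_C_k[OF Suc.prems(1)] C_k_Suc_imp_C_k[OF Suc.prems(2)] show ?case
    by (auto intro!: C_k_add differentiable_on_mult)
qed (auto intro: continuous_intros)

lemma partial_deriv_inverse:
  assumes "f differentiable at x" "f x \<noteq> 0"
  shows "partial_deriv i (\<lambda>x. inverse (f x)) x = - partial_deriv i f x * (inverse (f x) * inverse (f x))"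
  using partial_deriv_eq[OF Deriv.has_derivative_inverse[OF assms(2) assms(1)[THEN frechet_derivative_worksD]], of i]
  by (simp add: partial_deriv_def mult_ac)

text \<open>The derivative is a product of the derivative of \<open>f\<close> and two copies of the
  inverse, to which the induction hypothesis applies for the same \<open>f\<close>. This closure
  property is what makes the rational truncation below smooth.\<close>

lemma C_k_inverse:
  assumes "\<And>x. f x \<noteq> 0"
  shows "C_k k f \<Longrightarrow> C_k k (\<lambda>x. inverse (f x))"
proof (induction k)
  case 0
  then show ?case using assms by (auto intro: continuous_intros)
next
  case (Suc k)
  have "partial_deriv i (\<lambda>x. inverse (f x))
      = (\<lambda>x. - 1 * partial_deriv i f x * (inverse (f x) * inverse (f x)))" for i
    by (simp add: partial_deriv_inverse C_k_Suc_differentiable[OF Suc.prems] assms fun_eq_iff)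
  moreover have "C_k k (\<lambda>x. inverse (f x))" by (rule Suc.IH[OF C_k_Suc_imp_C_k[OF Suc.prems]])
  ultimately have "C_k k (partial_deriv i (\<lambda>x. inverse (f x)))" for i
    using Suc.prems by (simp only: C_k.simps C_k_mult C_k_const)
  then show ?case using Suc.prems assms
    by (auto intro!: differentiable_on_inverse)
qed

lemma partial_deriv_cnj:
  assumes "f differentiable at x"
  shows "partial_deriv i (\<lambda>x. cnj (f x)) x = cnj (partial_deriv i f x)"
  using partial_deriv_eq[OF has_derivative_cnj[OF assms[THEN frechet_derivative_worksD]], of i]
  by (simp add: partial_deriv_def)

lemma C_k_cnj: "C_k k f \<Longrightarrow> C_k k (\<lambda>x. cnj (f x))"
proof (induction k arbitrary: f)
  case (Suc k)
  have "partial_deriv i (\<lambda>x. cnj (f x)) = (\<lambda>x. cnj (partial_deriv i f x))" for i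
    using Suc.prems by (auto simp only: partial_deriv_cnj C_k_Suc_differentiable)
  moreover have "(\<lambda>x. cnj (f x)) differentiable at x" for x
    using has_derivative_cnj[OF C_k_Suc_has_derivative[OF Suc.prems, of x]] by (auto simp: differentiable_def)
  ultimately show ?case using Suc
    by (simp add: differentiable_on_eq_differentiable_at)
qed (auto intro: continuous_intros)

lemma has_derivative_affine:
  assumes "f differentiable at (a + c *\<^sub>R x)"
  shows "((\<lambda>x. f (a + c *\<^sub>R x)) has_derivative
           (\<lambda>h. frechet_derivative f (at (a + c *\<^sub>R x)) (c *\<^sub>R h))) (at x)"
  by (rule has_derivative_compose[where g = f and f = "\<lambda>x. a + c *\<^sub>R x", OF _ assms[THEN frechet_derivative_worksD]])
     (auto intro!: derivative_eq_intros)

lemma partial_deriv_affine: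
  assumes "f differentiable at (a + c *\<^sub>R x)"
  shows "partial_deriv i (\<lambda>x. f (a + c *\<^sub>R x)) x = of_real c * partial_deriv i f (a + c *\<^sub>R x)"
  using partial_deriv_eq[OF has_derivative_affine[OF assms], of i]
    linear_scale[OF has_derivative_linear[OF assms[THEN frechet_derivative_worksD]], of c "axis i 1"]
  by (simp add: partial_deriv_def scaleR_conv_of_real)

lemma C_k_affine: "C_k k f \<Longrightarrow> C_k k (\<lambda>x. f (a + c *\<^sub>R x))"
proof (induction k arbitrary: f)
  case 0
  then show ?case by (auto intro!: continuous_intros continuous_on_compose2[of UNIV f])
next
  case (Suc k)
  have "partial_deriv i (\<lambda>x. f (a + c *\<^sub>R x)) = (\<lambda>x. of_real c * partial_deriv i f (a + c *\<^sub>R x))" for i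
    using Suc.prems by (auto simp only: partial_deriv_affine C_k_Suc_differentiable)
  moreover have "(\<lambda>x. f (a + c *\<^sub>R x)) differentiable at x" for x
    using has_derivative_affine[OF C_k_Suc_differentiable[OF Suc.prems]] by (auto simp: differentiable_def)
  ultimately show ?case using Suc
    by (auto intro!: C_k_mult C_k_const simp: differentiable_on_eq_differentiable_at)
qed

lemma test_functions_iff:
  "\<phi> \<in> test_functions \<longleftrightarrow> (\<forall>k. C_k k \<phi>) \<and> (\<exists>R. \<forall>x. R < norm x \<longrightarrow> \<phi> x = 0)"
proof -
  have "bounded {x. \<phi> x \<noteq> 0} \<longleftrightarrow> (\<exists>R. \<forall>x. R < norm x \<longrightarrow> \<phi> x = 0)"
    by (auto simp: bounded_iff) (meson not_le)+
  then show ?thesis by (simp add: test_functions_def compact_closure)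
qed

lemma test_function_differentiable: "\<phi> \<in> test_functions \<Longrightarrow> \<phi> differentiable at x"
  using C_k_Suc_differentiable[of 0 \<phi> x] by (auto simp: test_functions_iff)

lemma test_function_continuous: "\<phi> \<in> test_functions \<Longrightarrow> continuous_on UNIV \<phi>"
  by (auto simp: test_functions_iff dest: spec[of _ 0])

lemma partial_deriv_zero:
  assumes "\<And>x. R < norm x \<Longrightarrow> f x = 0" "R < norm x"
  shows "partial_deriv i f x = 0"
proof -
  have "open {x. R < norm x}" by (intro open_Collect_less continuous_intros)
  then have "(f has_derivative (\<lambda>_. 0)) (at x)"
    by (rule has_derivative_transform_within_open[OF has_derivative_const[of 0]])
       (use assms in auto)
  from partial_deriv_eq[OF this] show ?thesis .
qed

lemma test_function_partial_deriv: "\<phi> \<in> test_functions \<Longrightarrow> partial_deriv i \<phi> \<in> test_functions"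
  unfolding test_functions_iff using partial_deriv_zero[of _ \<phi>] by (metis C_k.simps(2))

lemma test_function_mult: "\<phi> \<in> test_functions \<Longrightarrow> (\<And>k. C_k k f) \<Longrightarrow> (\<lambda>x. \<phi> x * f x) \<in> test_functions"
  unfolding test_functions_iff by (auto intro: C_k_mult)

lemma test_function_cnj: "\<phi> \<in> test_functions \<Longrightarrow> (\<lambda>x. cnj (\<phi> x)) \<in> test_functions"
  unfolding test_functions_iff by (auto intro: C_k_cnj)

lemma test_function_affine:
  assumes "\<phi> \<in> test_functions" "c \<noteq> 0"
  shows "(\<lambda>x. \<phi> (a + c *\<^sub>R x)) \<in> test_functions"
proof -
  obtain R where R: "\<And>x. R < norm x \<Longrightarrow> \<phi> x = 0" using assms by (auto simp: test_functions_iff)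
  have "\<phi> (a + c *\<^sub>R x) = 0" if "(R + norm a) / \<bar>c\<bar> < norm x" for x
  proof (rule R)
    have "R + norm a < norm (c *\<^sub>R x)" using that assms(2) by (simp add: field_simps)
    also have "\<dots> \<le> norm (a + c *\<^sub>R x) + norm a"
      using norm_triangle_ineq4[of "a + c *\<^sub>R x" a] by simp
    finally show "R < norm (a + c *\<^sub>R x)" by simp
  qed
  then show ?thesis using assms by (auto simp: test_functions_iff intro: C_k_affine)
qed

lemma test_function_has_vector_derivative:
  assumes "\<phi> \<in> test_functions"
  shows "((\<lambda>t. \<phi> (x + t *\<^sub>R axis i 1)) has_vector_derivative partial_deriv i \<phi> (x + t *\<^sub>R axis i 1)) (at t)"
proof -
  have "((\<lambda>t. \<phi> (x + t *\<^sub>R axis i 1)) has_derivative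
      (\<lambda>h. frechet_derivative \<phi> (at (x + t *\<^sub>R axis i 1)) (h *\<^sub>R axis i 1))) (at t)"
    by (rule has_derivative_compose[where g = \<phi> and f = "\<lambda>t. x + t *\<^sub>R axis i 1", OF _ test_function_differentiable[OF assms, THEN frechet_derivative_worksD]])
       (auto intro!: derivative_eq_intros)
  then show ?thesis
    using linear_scale[OF has_derivative_linear[OF test_function_differentiable[OF assms,
            THEN frechet_derivative_worksD]]]
    by (simp add: has_vector_derivative_def partial_deriv_def)
qed

lemma test_function_bounded:
  assumes "\<phi> \<in> test_functions"
  obtains B where "B > 0" "\<And>x. norm (\<phi> x) \<le> B"
proof -
  have "\<phi> ` UNIV \<subseteq> insert 0 (\<phi> ` closure {x. \<phi> x \<noteq> 0})"
    using closure_subset[of "{x. \<phi> x \<noteq> 0}"] by blast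
  moreover have "compact (\<phi> ` closure {x. \<phi> x \<noteq> 0})"
    using assms test_function_continuous[OF assms]
    by (intro compact_continuous_image) (auto simp: test_functions_def intro: continuous_on_subset)
  ultimately have "bounded (\<phi> ` UNIV)"
    by (meson bounded_insert bounded_subset compact_imp_bounded)
  then show thesis using that unfolding bounded_pos by auto
qed

subsection \<open>Approximation in the Sobolev norm\<close>

definition L2_sq :: "('a::euclidean_space \<Rightarrow> 'b::euclidean_space) \<Rightarrow> real" where
  "L2_sq f = (LINT x|lebesgue. (norm (f x))\<^sup>2)"

lemma Lp_space_2_iff:
  "f \<in> Lp_space 2 \<longleftrightarrow> f \<in> borel_measurable lebesgue \<and> integrable lebesgue (\<lambda>x. (norm (f x))\<^sup>2)"
  by (simp add: Lp_space_def)

lemma Lp_space_measurable: "f \<in> Lp_space p \<Longrightarrow> f \<in> borel_measurable lebesgue"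
  by (simp add: Lp_space_def)

lemma L2_sq_nonneg: "0 \<le> L2_sq f"
  by (simp add: L2_sq_def)

lemma Lp_norm_2: "Lp_norm 2 f = sqrt (L2_sq f)"
  by (simp add: Lp_norm_def L2_sq_def powr_half_sqrt)

lemma
  fixes f :: "'a::euclidean_space \<Rightarrow> 'b::euclidean_space" and h :: "'a \<Rightarrow> 'c::euclidean_space"
  assumes h: "h \<in> Lp_space 2" and f: "f \<in> borel_measurable lebesgue"
    and le: "AE x in lebesgue. norm (f x) \<le> B * norm (h x)"
  shows Lp_space_2_bound: "f \<in> Lp_space 2" and L2_sq_bound: "L2_sq f \<le> B\<^sup>2 * L2_sq h"
proof -
  have le': "AE x in lebesgue. (norm (f x))\<^sup>2 \<le> B\<^sup>2 * (norm (h x))\<^sup>2"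
    using le by eventually_elim (metis norm_ge_zero power_mono power_mult_distrib)
  have int: "integrable lebesgue (\<lambda>x. B\<^sup>2 * (norm (h x))\<^sup>2)"
    using h by (simp add: Lp_space_2_iff)
  have "integrable lebesgue (\<lambda>x. (norm (f x))\<^sup>2)"
    using le' borel_measurable_power[OF measurable_compose[OF f borel_measurable_norm], of 2]
    by (intro Bochner_Integration.integrable_bound[OF int]) (auto elim!: eventually_mono)
  then show "f \<in> Lp_space 2" using f by (simp add: Lp_space_2_iff)
  then show "L2_sq f \<le> B\<^sup>2 * L2_sq h"
    unfolding L2_sq_def using le' int
    by (subst integral_mult_right_zero[symmetric], intro integral_mono_AE) (auto simp: Lp_space_2_iff)
qed

text \<open>The bound 2 s^2 + 2 t^2 for (s + t)^2 takes the place of Minkowski's inequality; for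
  null sequences the constant is harmless.\<close>

lemma
  assumes f: "f \<in> Lp_space 2" and g: "g \<in> Lp_space 2"
  shows Lp_space_2_add: "(\<lambda>x. f x + g x) \<in> Lp_space 2"
    and L2_sq_add: "L2_sq (\<lambda>x. f x + g x) \<le> 2 * L2_sq f + 2 * L2_sq g"
proof -
  have le: "(norm (f x + g x))\<^sup>2 \<le> 2 * (norm (f x))\<^sup>2 + 2 * (norm (g x))\<^sup>2" for x
  proof -
    have "(norm (f x + g x))\<^sup>2 \<le> (norm (f x) + norm (g x))\<^sup>2"
      by (intro power_mono norm_triangle_ineq) auto
    also have "\<dots> \<le> 2 * (norm (f x))\<^sup>2 + 2 * (norm (g x))\<^sup>2"
      using sum_squares_bound[of "norm (f x)" "norm (g x)"] by (simp add: power2_sum)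
    finally show ?thesis .
  qed
  have int: "integrable lebesgue (\<lambda>x. 2 * (norm (f x))\<^sup>2 + 2 * (norm (g x))\<^sup>2)"
    using f g by (simp add: Lp_space_2_iff)
  have [measurable]: "f \<in> borel_measurable lebesgue" "g \<in> borel_measurable lebesgue"
    using f g by (auto simp: Lp_space_2_iff)
  have "integrable lebesgue (\<lambda>x. (norm (f x + g x))\<^sup>2)"
    by (rule Bochner_Integration.integrable_bound[OF int]) (use le in auto)
  then show *: "(\<lambda>x. f x + g x) \<in> Lp_space 2" by (simp add: Lp_space_2_iff)
  have "L2_sq (\<lambda>x. f x + g x) \<le> (LINT x|lebesgue. 2 * (norm (f x))\<^sup>2 + 2 * (norm (g x))\<^sup>2)"
    unfolding L2_sq_def using * int le by (intro integral_mono) (auto simp: Lp_space_2_iff)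
  also have "\<dots> = 2 * L2_sq f + 2 * L2_sq g"
    using f g by (simp add: L2_sq_def Lp_space_2_iff)
  finally show "L2_sq (\<lambda>x. f x + g x) \<le> 2 * L2_sq f + 2 * L2_sq g" .
qed

lemma Lp_space_2_diff:
  assumes "f \<in> Lp_space 2" "g \<in> Lp_space 2"
  shows "(\<lambda>x. f x - g x) \<in> Lp_space 2"
  using Lp_space_2_add[OF assms(1), of "\<lambda>x. - g x"] assms(2) by (simp add: Lp_space_2_iff)

lemma L2_null_add:
  assumes "\<And>m. f m \<in> Lp_space 2" "\<And>m. g m \<in> Lp_space 2"
    and "(\<lambda>m. L2_sq (f m)) \<longlonglongrightarrow> 0" "(\<lambda>m. L2_sq (g m)) \<longlonglongrightarrow> 0"
  shows "(\<lambda>m. L2_sq (\<lambda>x. f m x + g m x)) \<longlonglongrightarrow> 0"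
proof (rule tendsto_sandwich[OF _ _ tendsto_const])
  show "(\<lambda>m. 2 * L2_sq (f m) + 2 * L2_sq (g m)) \<longlonglongrightarrow> 0"
    using tendsto_add[OF tendsto_mult_left[OF assms(3), of 2] tendsto_mult_left[OF assms(4), of 2]]
    by simp
qed (auto simp: L2_sq_nonneg intro!: always_eventually L2_sq_add assms)

lemma L2_null_bound:
  assumes "\<And>m. h m \<in> Lp_space 2" "\<And>m. f m \<in> borel_measurable lebesgue"
    and "\<And>m. AE x in lebesgue. norm (f m x) \<le> B * norm (h m x)"
    and "(\<lambda>m. L2_sq (h m)) \<longlonglongrightarrow> 0"
  shows "(\<lambda>m. L2_sq (f m)) \<longlonglongrightarrow> 0"
proof (rule tendsto_sandwich[OF _ _ tendsto_const])
  show "(\<lambda>m. B\<^sup>2 * L2_sq (h m)) \<longlonglongrightarrow> 0"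
    using tendsto_mult_left[OF assms(4), of "B\<^sup>2"] by simp
qed (auto simp: L2_sq_nonneg intro!: always_eventually L2_sq_bound assms)

lemma L2_null_dominated:
  fixes f :: "nat \<Rightarrow> 'a::euclidean_space \<Rightarrow> 'b::euclidean_space"
  assumes h: "h \<in> Lp_space 2" and [measurable]: "\<And>m. f m \<in> borel_measurable lebesgue"
    and le: "\<And>m. AE x in lebesgue. norm (f m x) \<le> B * norm (h x)"
    and lim: "AE x in lebesgue. (\<lambda>m. f m x) \<longlonglongrightarrow> 0"
  shows "(\<lambda>m. L2_sq (f m)) \<longlonglongrightarrow> 0"
proof -
  have "(\<lambda>m. LINT x|lebesgue. (norm (f m x))\<^sup>2) \<longlonglongrightarrow> (LINT x|(lebesgue::'a measure). 0)"
  proof (rule integral_dominated_convergence[where w = "\<lambda>x. B\<^sup>2 * (norm (h x))\<^sup>2"])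
    show "integrable lebesgue (\<lambda>x. B\<^sup>2 * (norm (h x))\<^sup>2)"
      using h by (simp add: Lp_space_2_iff)
    show "AE x in lebesgue. (\<lambda>m. (norm (f m x))\<^sup>2) \<longlonglongrightarrow> 0"
      using lim by eventually_elim (auto intro!: tendsto_eq_intros)
    show "AE x in lebesgue. norm ((norm (f m x))\<^sup>2) \<le> B\<^sup>2 * (norm (h x))\<^sup>2" for m
      using le[of m] by eventually_elim (simp add: power_mono flip: power_mult_distrib)
  qed auto
  then show ?thesis by (simp add: L2_sq_def)
qed

text \<open>The truncation \<open>s \<mapsto> s / (1 + \<epsilon> \<bar>s\<bar>\<^sup>2)\<close> is bounded, and unlike a cut-off of \<open>\<bar>s\<bar>\<close> it is
  built from field operations, so that it preserves smoothness.\<close>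

definition damp :: "real \<Rightarrow> complex \<Rightarrow> complex" where
  "damp \<epsilon> s = inverse (1 + of_real \<epsilon> * (s * cnj s))"

definition trunc :: "real \<Rightarrow> complex \<Rightarrow> complex" where
  "trunc \<epsilon> s = s * damp \<epsilon> s"

text \<open>The real differential of \<open>trunc\<close> at \<open>s\<close> in direction
  \<open>h\<close>; the truncation is not holomorphic, so \<open>cnj h\<close> occurs too.\<close>

definition trunc_deriv :: "real \<Rightarrow> complex \<Rightarrow> complex \<Rightarrow> complex" where
  "trunc_deriv \<epsilon> s h = h * damp \<epsilon> s - s * (damp \<epsilon> s)\<^sup>2 * of_real \<epsilon> * (s * cnj h + h * cnj s)"

lemma damp_eq: "damp \<epsilon> s = of_real (inverse (1 + \<epsilon> * (norm s)\<^sup>2))"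
  by (simp add: damp_def complex_norm_square flip: of_real_power)

lemma damp_denom_pos: "\<epsilon> > 0 \<Longrightarrow> 0 < 1 + \<epsilon> * (norm s)\<^sup>2" for s :: complex
  by (intro add_pos_nonneg) auto

lemma damp_denom_nonzero:
  assumes "\<epsilon> > 0"
  shows "1 + of_real \<epsilon> * (s * cnj s) \<noteq> 0"
proof -
  have "of_real (1 + \<epsilon> * (norm s)\<^sup>2) \<noteq> (0 :: complex)"
    using damp_denom_pos[OF assms, of s] by (simp only: of_real_eq_0_iff)
  then show ?thesis
    by (simp only: of_real_add of_real_mult of_real_1 complex_norm_square not_False_eq_True)
qed

lemma norm_damp:
  assumes "\<epsilon> > 0"
  shows "norm (damp \<epsilon> s) = inverse (1 + \<epsilon> * (norm s)\<^sup>2)"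
  unfolding damp_eq norm_of_real using damp_denom_pos[OF assms, of s] by (intro abs_of_pos) simp

lemma norm_damp_le_1: "\<epsilon> > 0 \<Longrightarrow> norm (damp \<epsilon> s) \<le> 1"
  using damp_denom_pos[of \<epsilon> s] by (simp add: norm_damp inverse_le_1_iff)

lemma norm_trunc_le: "\<epsilon> > 0 \<Longrightarrow> norm (trunc \<epsilon> s) \<le> norm s"
  using norm_damp_le_1[of \<epsilon> s] by (simp add: trunc_def norm_mult mult_left_le)

text \<open>Only finiteness for fixed \<epsilon> matters; the crude constant follows from |s| <= 1 +
  |s|^2.\<close>

lemma norm_trunc_bounded:
  assumes "\<epsilon> > 0"
  shows "norm (trunc \<epsilon> s) \<le> 1 + 1 / \<epsilon>"
proof -
  have "norm s \<le> 1 + (norm s)\<^sup>2"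
    using sum_squares_bound[of "norm s" 1] norm_ge_zero[of s] by (simp del: norm_ge_zero)
  also have "\<dots> \<le> (1 + 1 / \<epsilon>) * (1 + \<epsilon> * (norm s)\<^sup>2)"
    using assms by (simp add: field_simps)
  finally show ?thesis
    using damp_denom_pos[OF assms, of s]
    by (simp add: trunc_def norm_mult norm_damp assms divide_inverse[symmetric] pos_divide_le_eq)
qed

text \<open>The constant does not depend on \<epsilon>, so the same majorant serves while the
  truncation is removed.\<close>

lemma norm_trunc_deriv_le:
  assumes "\<epsilon> > 0"
  shows "norm (trunc_deriv \<epsilon> s h) \<le> 3 * norm h"
proof -
  define r where "r = inverse (1 + \<epsilon> * (norm s)\<^sup>2)"
  have r: "0 < r" "r \<le> 1" "\<epsilon> * (norm s)\<^sup>2 * r \<le> 1"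
    using damp_denom_pos[OF assms, of s] assms by (auto simp: r_def divide_inverse[symmetric] inverse_le_1_iff pos_divide_le_eq)
  have "norm (trunc_deriv \<epsilon> s h) \<le> norm (h * damp \<epsilon> s)
      + norm (s * (damp \<epsilon> s)\<^sup>2 * of_real \<epsilon>) * norm (s * cnj h + h * cnj s)"
    unfolding trunc_deriv_def by (metis norm_triangle_ineq4 norm_mult)
  also have "\<dots> \<le> norm h * r + norm s * r\<^sup>2 * \<epsilon> * (2 * norm s * norm h)"
    using assms norm_triangle_ineq[of "s * cnj h" "h * cnj s"]
    by (intro add_mono mult_mono) (auto simp: norm_mult norm_power norm_damp r_def mult_ac)
  also have "\<dots> = norm h * r + 2 * norm h * ((\<epsilon> * (norm s)\<^sup>2 * r) * r)"
    by (simp add: power2_eq_square algebra_simps)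
  also have "\<dots> \<le> norm h * 1 + 2 * norm h * (1 * 1)"
    using r assms by (intro add_mono mult_mono) auto
  finally show ?thesis by simp
qed

lemma trunc_deriv_diff: "trunc_deriv \<epsilon> s (h - h') = trunc_deriv \<epsilon> s h - trunc_deriv \<epsilon> s h'"
  by (simp add: trunc_deriv_def algebra_simps)

lemma tendsto_damp:
  "\<epsilon> > 0 \<Longrightarrow> (f \<longlongrightarrow> s) F \<Longrightarrow> ((\<lambda>x. damp \<epsilon> (f x)) \<longlongrightarrow> damp \<epsilon> s) F"
  unfolding damp_def by (intro tendsto_intros damp_denom_nonzero)

lemma tendsto_trunc:
  "\<epsilon> > 0 \<Longrightarrow> (f \<longlongrightarrow> s) F \<Longrightarrow> ((\<lambda>x. trunc \<epsilon> (f x)) \<longlongrightarrow> trunc \<epsilon> s) F"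
  unfolding trunc_def by (intro tendsto_intros tendsto_damp)

lemma tendsto_trunc_deriv:
  "\<epsilon> > 0 \<Longrightarrow> (f \<longlongrightarrow> s) F \<Longrightarrow> ((\<lambda>x. trunc_deriv \<epsilon> (f x) h) \<longlongrightarrow> trunc_deriv \<epsilon> s h) F"
  unfolding trunc_deriv_def by (intro tendsto_intros tendsto_damp)

lemma tendsto_damp_0: "(\<epsilon> \<longlongrightarrow> 0) F \<Longrightarrow> ((\<lambda>x. damp (\<epsilon> x) s) \<longlongrightarrow> 1) F"
  unfolding damp_def by (auto intro!: tendsto_eq_intros)

lemma tendsto_trunc_0: "(\<epsilon> \<longlongrightarrow> 0) F \<Longrightarrow> ((\<lambda>x. trunc (\<epsilon> x) s) \<longlongrightarrow> s) F"
  unfolding trunc_def by (auto intro!: tendsto_eq_intros tendsto_damp_0)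

lemma tendsto_trunc_deriv_0: "(\<epsilon> \<longlongrightarrow> 0) F \<Longrightarrow> ((\<lambda>x. trunc_deriv (\<epsilon> x) s h) \<longlongrightarrow> h) F"
  unfolding trunc_deriv_def by (auto intro!: tendsto_eq_intros tendsto_damp_0)

lemma measurable_cnj [measurable]:
  "f \<in> borel_measurable M \<Longrightarrow> (\<lambda>x. cnj (f x)) \<in> borel_measurable M"
  by (rule measurable_compose) (auto intro!: borel_measurable_continuous_onI continuous_intros)

lemma measurable_trunc [measurable]:
  assumes [measurable]: "f \<in> borel_measurable M"
  shows "(\<lambda>x. trunc \<epsilon> (f x)) \<in> borel_measurable M"
  unfolding trunc_def damp_eq by measurable

lemma measurable_trunc_deriv [measurable]:
  assumes [measurable]: "f \<in> borel_measurable M" "g \<in> borel_measurable M"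
  shows "(\<lambda>x. trunc_deriv \<epsilon> (f x) (g x)) \<in> borel_measurable M"
  unfolding trunc_deriv_def damp_eq by measurable

lemma C_k_trunc: "\<epsilon> > 0 \<Longrightarrow> C_k k f \<Longrightarrow> C_k k (\<lambda>x. trunc \<epsilon> (f x))"
  unfolding trunc_def damp_def
  by (intro C_k_mult C_k_inverse C_k_add C_k_const C_k_cnj damp_denom_nonzero)

lemma partial_deriv_trunc:
  assumes "\<epsilon> > 0" and f: "f differentiable at x"
  shows "partial_deriv i (\<lambda>x. trunc \<epsilon> (f x)) x = trunc_deriv \<epsilon> (f x) (partial_deriv i f x)"
proof -
  note f' = f[THEN frechet_derivative_worksD]
  let ?f' = "frechet_derivative f (at x)"
  have "((\<lambda>x. trunc \<epsilon> (f x)) has_derivative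
      (\<lambda>h. f x * - (damp \<epsilon> (f x) * (of_real \<epsilon> * (f x * cnj (?f' h) + ?f' h * cnj (f x))) * damp \<epsilon> (f x))
           + ?f' h * damp \<epsilon> (f x))) (at x)"
    unfolding trunc_def damp_def
    by (intro has_derivative_mult Deriv.has_derivative_inverse f' damp_denom_nonzero assms
           has_derivative_add_const has_derivative_mult_right has_derivative_cnj
           has_derivative_add[where f = "\<lambda>_. 1" and f' = "\<lambda>_. 0", simplified] has_derivative_const)
  from partial_deriv_eq[OF this, of i] show ?thesis
    by (simp add: partial_deriv_def trunc_deriv_def power2_eq_square algebra_simps)
qed


section \<open>Test functions in Lebesgue spaces and their approximation property\<close>

lemma test_function_measurable:
  "\<phi> \<in> test_functions \<Longrightarrow> \<phi> \<in> borel_measurable lebesgue"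
  using borel_measurable_continuous_onI[OF test_function_continuous]
  by (intro measurable_completion) simp

lemma test_function_integrable:
  assumes "\<phi> \<in> test_functions"
  shows "integrable lebesgue \<phi>"
proof -
  obtain R where "\<And>x. R < norm x \<Longrightarrow> \<phi> x = 0" using assms by (auto simp: test_functions_iff)
  then have "integrable lborel \<phi>"
    by (intro integrable_continuous_bounded_support[OF test_function_continuous[OF assms]])
  then show ?thesis by (simp add: integrable_completion borel_measurable_integrable)
qed

lemma test_function_Lp_space_2:
  assumes "\<phi> \<in> test_functions"
  shows "\<phi> \<in> Lp_space 2"
proof -
  obtain R where "\<And>x. R < norm x \<Longrightarrow> \<phi> x = 0" using assms by (auto simp: test_functions_iff)
  then have "integrable lborel (\<lambda>x. (norm (\<phi> x))\<^sup>2)"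
    by (intro integrable_continuous_bounded_support[of _ R] continuous_intros
          test_function_continuous assms) auto
  then show ?thesis
    using test_function_measurable[OF assms]
    by (auto simp: Lp_space_2_iff intro!: integrable_completion[THEN iffD2]
             dest: borel_measurable_integrable)
qed

lemma L1_loc_measurable:
  assumes "f \<in> L1_loc"
  shows "f \<in> borel_measurable lebesgue"
proof (rule borel_measurable_LIMSEQ_metric)
  show "(\<lambda>x. indicator (cball 0 (real n)) x *\<^sub>R f x) \<in> borel_measurable lebesgue" for n
    using assms by (auto simp: L1_loc_def set_integrable_def dest!: spec[of _ "cball 0 (real n)"])
  show "(\<lambda>n. indicator (cball 0 (real n)) x *\<^sub>R f x) \<longlonglongrightarrow> f x" for x
  proof (rule tendsto_eventually)
    obtain N where "norm x \<le> real N" using real_arch_simple by blast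
    then show "\<forall>\<^sub>F n in sequentially. indicator (cball 0 (real n)) x *\<^sub>R f x = f x"
      by (auto simp: eventually_sequentially intro!: exI[of _ N])
  qed
qed

text \<open>The approximants converge only locally in \<open>L^1\<close>. Once truncated at a fixed
  \<epsilon> they are uniformly bounded, and multiplied by a fixed cut-off they have a square
  integrable majorant, so dominated convergence yields convergence in \<open>L^2\<close>. The
  expected gradient is written out by the chain and product rules; no weak differentiability of the
  truncated \<open>v\<close> is claimed.\<close>

lemma cutoff_trunc_approx:
  fixes v :: "real^'n::finite \<Rightarrow> complex" and g :: "'n \<Rightarrow> real^'n \<Rightarrow> complex"
  assumes v: "v \<in> L1_loc" and g: "\<And>i. g i \<in> Lp_space 2"
    and \<phi>: "\<And>m. \<phi> m \<in> test_functions"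
    and grad: "\<And>i. (\<lambda>m. L2_sq (\<lambda>x. partial_deriv i (\<phi> m) x - g i x)) \<longlonglongrightarrow> 0"
    and loc: "\<And>K. compact K \<Longrightarrow> (\<lambda>m. LINT x:K|lebesgue. norm (\<phi> m x - v x)) \<longlonglongrightarrow> 0"
    and \<rho>: "\<rho> \<in> test_functions" and \<epsilon>: "\<epsilon> > 0" and \<eta>: "\<eta> > 0"
  shows "\<exists>w\<in>test_functions. L2_sq (\<lambda>x. w x - \<rho> x * trunc \<epsilon> (v x)) < \<eta> \<and>
    (\<forall>i. L2_sq (\<lambda>x. partial_deriv i w x
            - (partial_deriv i \<rho> x * trunc \<epsilon> (v x) + \<rho> x * trunc_deriv \<epsilon> (v x) (g i x))) < \<eta>)"
proof -
  obtain R where R: "\<And>x. R < norm x \<Longrightarrow> \<rho> x = 0" using \<rho> by (auto simp: test_functions_iff)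
  obtain B where B: "B > 0" "\<And>x. norm (\<rho> x) \<le> B" using test_function_bounded[OF \<rho>] by metis
  note R' = partial_deriv_zero[OF R]
  define K where "K = cball (0::real^'n) R"
  have [measurable]: "v \<in> borel_measurable lebesgue" using L1_loc_measurable[OF v] .
  have [measurable]: "\<phi> m \<in> borel_measurable lebesgue" "\<rho> \<in> borel_measurable lebesgue"
    "partial_deriv i (\<phi> m) \<in> borel_measurable lebesgue"
    "partial_deriv i \<rho> \<in> borel_measurable lebesgue" for m i
    using \<phi> \<rho> by (auto intro!: test_function_measurable test_function_partial_deriv)
  have [measurable]: "g i \<in> borel_measurable lebesgue" for i using g by (rule Lp_space_measurable)
  define u where "u = (\<lambda>m x. indicator K x *\<^sub>R (\<phi> m x - v x))"
  \<comment> \<open>A subsequence converges almost everywhere on the ball. This suffices, because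
    the cut-off and its derivatives vanish outside it.\<close>
  have "\<exists>r. strict_mono r \<and> (AE x in lebesgue. (\<lambda>m. u (r m) x) \<longlonglongrightarrow> 0)"
  proof (rule tendsto_L1_AE_subseq)
    have "integrable lebesgue (\<lambda>x. indicator K x *\<^sub>R v x)"
      using v by (auto simp: L1_loc_def K_def set_integrable_def)
    moreover have "integrable lebesgue (\<lambda>x. indicator K x *\<^sub>R \<phi> m x)" for m
      by (rule integrable_mult_indicator[OF _ test_function_integrable[OF \<phi>]]) (auto simp: K_def)
    ultimately show "integrable lebesgue (u m)" for m
      unfolding u_def scaleR_diff_right by (intro Bochner_Integration.integrable_diff)
    have "(LINT x|lebesgue. norm (u m x)) = (LINT x:K|lebesgue. norm (\<phi> m x - v x))" for m
      unfolding u_def set_lebesgue_integral_def by (intro Bochner_Integration.integral_cong) auto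
    then show "(\<lambda>m. LINT x|lebesgue. norm (u m x)) \<longlonglongrightarrow> 0"
      using loc[of K] by (simp add: K_def)
  qed
  then obtain r where r: "strict_mono r" "AE x in lebesgue. (\<lambda>m. u (r m) x) \<longlonglongrightarrow> 0" by blast
  have conv: "AE x in lebesgue. norm x \<le> R \<longrightarrow> (\<lambda>m. \<phi> (r m) x) \<longlonglongrightarrow> v x"
    using r(2)
  proof eventually_elim
    case (elim x)
    then show ?case by (auto simp: u_def K_def LIM_zero_iff)
  qed
  define w where "w = (\<lambda>m x. \<rho> x * trunc \<epsilon> (\<phi> (r m) x))"
  have w: "w m \<in> test_functions" for m
    unfolding w_def using \<phi> by (intro test_function_mult \<rho> C_k_trunc \<epsilon>) (auto simp: test_functions_iff)
  have dw: "partial_deriv i (w m) x = partial_deriv i \<rho> x * trunc \<epsilon> (\<phi> (r m) x)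
      + \<rho> x * trunc_deriv \<epsilon> (\<phi> (r m) x) (partial_deriv i (\<phi> (r m)) x)" for m i x
  proof -
    have "C_k (Suc 0) (\<lambda>x. trunc \<epsilon> (\<phi> (r m) x))"
      using \<phi> \<epsilon> by (intro C_k_trunc) (auto simp: test_functions_iff simp del: C_k.simps)
    then show ?thesis unfolding w_def
      using \<phi>[of "r m"] \<rho>
      by (subst partial_deriv_mult)
         (auto simp: partial_deriv_trunc \<epsilon> test_function_differentiable simp del: C_k.simps
               intro: C_k_Suc_differentiable)
  qed
  have trunc_diff: "norm (trunc \<epsilon> s - trunc \<epsilon> s') \<le> 2 * (1 + 1 / \<epsilon>)" for s s'
    using norm_triangle_ineq4[of "trunc \<epsilon> s" "trunc \<epsilon> s'"]
      norm_trunc_bounded[OF \<epsilon>, of s] norm_trunc_bounded[OF \<epsilon>, of s']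
    by (simp only: distrib_left mult_2)
  have null_trunc: "(\<lambda>m. L2_sq (\<lambda>x. \<psi> x * (trunc \<epsilon> (\<phi> (r m) x) - trunc \<epsilon> (v x)))) \<longlonglongrightarrow> 0"
    if \<psi>: "\<psi> \<in> test_functions" and zero: "\<And>x. R < norm x \<Longrightarrow> \<psi> x = 0" for \<psi>
  proof (rule L2_null_dominated[OF test_function_Lp_space_2[OF \<psi>], where B = "2 * (1 + 1 / \<epsilon>)"])
    have [measurable]: "\<psi> \<in> borel_measurable lebesgue" using \<psi> by (rule test_function_measurable)
    show "(\<lambda>x. \<psi> x * (trunc \<epsilon> (\<phi> (r m) x) - trunc \<epsilon> (v x))) \<in> borel_measurable lebesgue" for m
      by measurable
    show "AE x in lebesgue. norm (\<psi> x * (trunc \<epsilon> (\<phi> (r m) x) - trunc \<epsilon> (v x)))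
            \<le> 2 * (1 + 1 / \<epsilon>) * norm (\<psi> x)" for m
      unfolding norm_mult by (subst mult.commute) (intro AE_I2 mult_right_mono trunc_diff norm_ge_zero)
    show "AE x in lebesgue. (\<lambda>m. \<psi> x * (trunc \<epsilon> (\<phi> (r m) x) - trunc \<epsilon> (v x))) \<longlonglongrightarrow> 0"
      using conv
    proof eventually_elim
      case (elim x)
      show ?case
      proof (cases "norm x \<le> R")
        case True
        with elim have "(\<lambda>m. trunc \<epsilon> (\<phi> (r m) x)) \<longlonglongrightarrow> trunc \<epsilon> (v x)"
          by (intro tendsto_trunc \<epsilon>) auto
        then show ?thesis by (auto intro!: tendsto_eq_intros)
      qed (simp add: zero)
    qed
  qed
  have "(\<lambda>m. L2_sq (\<lambda>x. w m x - \<rho> x * trunc \<epsilon> (v x))) \<longlonglongrightarrow> 0"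
    using null_trunc[OF \<rho> R] by (simp add: w_def right_diff_distrib)
  then have ev1: "\<forall>\<^sub>F m in sequentially. L2_sq (\<lambda>x. w m x - \<rho> x * trunc \<epsilon> (v x)) < \<eta>"
    by (rule order_tendstoD) (rule \<eta>)
  define E where "E = (\<lambda>i m x. partial_deriv i (w m) x
      - (partial_deriv i \<rho> x * trunc \<epsilon> (v x) + \<rho> x * trunc_deriv \<epsilon> (v x) (g i x)))"
  have "(\<lambda>m. L2_sq (E i m)) \<longlonglongrightarrow> 0" for i
  proof -
    \<comment> \<open>The error of the gradient has three sources: truncated values under the
      derivative of the cut-off, the gradient error under a bounded linear map, and the change of
      that map at the fixed gradient \<open>g i\<close>. The first and third tend to 0 by dominated
      convergence, the second by the convergence of gradients.\<close>
    define E1 where "E1 = (\<lambda>m x. partial_deriv i \<rho> x * (trunc \<epsilon> (\<phi> (r m) x) - trunc \<epsilon> (v x)))"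
    define E2 where "E2 = (\<lambda>m x. \<rho> x * trunc_deriv \<epsilon> (\<phi> (r m) x) (partial_deriv i (\<phi> (r m)) x - g i x))"
    define E3 where "E3 = (\<lambda>m x. \<rho> x * (trunc_deriv \<epsilon> (\<phi> (r m) x) (g i x) - trunc_deriv \<epsilon> (v x) (g i x)))"
    have E: "E i m = (\<lambda>x. E1 m x + (E2 m x + E3 m x))" for m
      unfolding E_def E1_def E2_def E3_def dw trunc_deriv_diff by (simp add: algebra_simps fun_eq_iff)
    have "(\<lambda>m. L2_sq (E1 m)) \<longlonglongrightarrow> 0"
      unfolding E1_def by (intro null_trunc test_function_partial_deriv \<rho> R')
    moreover have E1: "E1 m \<in> Lp_space 2" for m
    proof (rule Lp_space_2_bound[where B = "2 * (1 + 1 / \<epsilon>)"])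
      show "partial_deriv i \<rho> \<in> Lp_space 2"
        by (intro test_function_Lp_space_2 test_function_partial_deriv \<rho>)
      show "AE x in lebesgue. norm (E1 m x) \<le> 2 * (1 + 1 / \<epsilon>) * norm (partial_deriv i \<rho> x)"
        unfolding E1_def norm_mult
        by (subst mult.commute) (intro AE_I2 mult_right_mono trunc_diff norm_ge_zero)
    qed (simp add: E1_def)
    moreover have E2_le: "AE x in lebesgue. norm (E2 m x) \<le> (B * 3) * norm (partial_deriv i (\<phi> (r m)) x - g i x)" for m
      unfolding E2_def norm_mult mult.assoc using B
      by (intro AE_I2 mult_mono norm_trunc_deriv_le \<epsilon>) auto
    moreover have diff: "(\<lambda>x. partial_deriv i (\<phi> (r m)) x - g i x) \<in> Lp_space 2" for m
      by (intro Lp_space_2_diff g test_function_Lp_space_2 test_function_partial_deriv \<phi>)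
    moreover have E2: "E2 m \<in> Lp_space 2" for m
      by (rule Lp_space_2_bound[OF diff _ E2_le]) (simp add: E2_def)
    moreover have "(\<lambda>m. L2_sq (E2 m)) \<longlonglongrightarrow> 0"
    proof (rule L2_null_bound[OF diff _ E2_le])
      show "(\<lambda>m. L2_sq (\<lambda>x. partial_deriv i (\<phi> (r m)) x - g i x)) \<longlonglongrightarrow> 0"
        using LIMSEQ_subseq_LIMSEQ[OF grad r(1)] by (simp add: comp_def)
    qed (simp add: E2_def)
    moreover have E3_le: "AE x in lebesgue. norm (E3 m x) \<le> (B * 6) * norm (g i x)" for m
    proof (rule AE_I2)
      fix x
      have "norm (trunc_deriv \<epsilon> (\<phi> (r m) x) (g i x) - trunc_deriv \<epsilon> (v x) (g i x)) \<le> 6 * norm (g i x)"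
        using norm_triangle_ineq4[of "trunc_deriv \<epsilon> (\<phi> (r m) x) (g i x)" "trunc_deriv \<epsilon> (v x) (g i x)"]
          norm_trunc_deriv_le[OF \<epsilon>, of "\<phi> (r m) x" "g i x"] norm_trunc_deriv_le[OF \<epsilon>, of "v x" "g i x"]
        by linarith
      then show "norm (E3 m x) \<le> (B * 6) * norm (g i x)"
        unfolding E3_def norm_mult mult.assoc using B by (intro mult_mono) auto
    qed
    moreover have E3: "E3 m \<in> Lp_space 2" for m
      by (rule Lp_space_2_bound[OF g _ E3_le]) (simp add: E3_def)
    moreover have "(\<lambda>m. L2_sq (E3 m)) \<longlonglongrightarrow> 0"
    proof (rule L2_null_dominated[OF g _ E3_le])
      show "AE x in lebesgue. (\<lambda>m. E3 m x) \<longlonglongrightarrow> 0"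
        using conv
      proof eventually_elim
        case (elim x)
        show ?case
        proof (cases "norm x \<le> R")
          case True
          with elim have "(\<lambda>m. trunc_deriv \<epsilon> (\<phi> (r m) x) (g i x)) \<longlonglongrightarrow> trunc_deriv \<epsilon> (v x) (g i x)"
            by (intro tendsto_trunc_deriv \<epsilon>) auto
          then show ?thesis by (auto simp: E3_def intro!: tendsto_eq_intros)
        qed (simp add: R E3_def)
      qed
    qed (simp add: E3_def)
    ultimately show ?thesis unfolding E by (intro L2_null_add Lp_space_2_add)
  qed
  then have "\<forall>\<^sub>F m in sequentially. L2_sq (E i m) < \<eta>" for i
    by (rule order_tendstoD) (rule \<eta>)
  then have "\<forall>\<^sub>F m in sequentially. \<forall>i. L2_sq (E i m) < \<eta>"
    by (rule eventually_all_finite)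
  from eventually_happens'[OF sequentially_bot eventually_conj[OF ev1 this]]
  show ?thesis using w unfolding E_def by blast
qed


text \<open>The cut-off and the truncation are removed simultaneously. The term with the derivative
  of the cut-off is controlled by a small multiple of |v|, and this is where \<open>v\<close> in
  \<open>L^2\<close> enters. Any test function that is nonzero at some point can serve as the
  profile of the cut-off.\<close>

lemma L2_approx_by_test_functions:
  fixes v :: "real^'n::finite \<Rightarrow> complex" and g :: "'n \<Rightarrow> real^'n \<Rightarrow> complex"
  assumes v: "v \<in> L1_loc" "v \<in> Lp_space 2" and g: "\<And>i. g i \<in> Lp_space 2"
    and \<phi>: "\<And>m. \<phi> m \<in> test_functions"
    and grad: "\<And>i. (\<lambda>m. L2_sq (\<lambda>x. partial_deriv i (\<phi> m) x - g i x)) \<longlonglongrightarrow> 0"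
    and loc: "\<And>K. compact K \<Longrightarrow> (\<lambda>m. LINT x:K|lebesgue. norm (\<phi> m x - v x)) \<longlonglongrightarrow> 0"
    and \<psi>: "\<psi> \<in> test_functions" "\<psi> (x\<^sub>0 :: real^'n) \<noteq> 0"
  obtains w where "\<And>k. w k \<in> test_functions"
    "(\<lambda>k. L2_sq (\<lambda>x. w k x - v x)) \<longlonglongrightarrow> 0"
    "\<And>i. (\<lambda>k. L2_sq (\<lambda>x. partial_deriv i (w k) x - g i x)) \<longlonglongrightarrow> 0"
proof -
  \<comment> \<open>One null sequence plays three roles: dilation factor of the cut-off, parameter
    of the truncation, and tolerance of the approximation by test functions.\<close>
  define \<delta> where "\<delta> = (\<lambda>k. 1 / real (Suc k))"
  have \<delta>: "\<delta> k > 0" "\<delta> k \<le> 1" for k by (auto simp: \<delta>_def)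
  have \<delta>0: "\<delta> \<longlonglongrightarrow> 0" unfolding \<delta>_def by (rule LIMSEQ_Suc[OF lim_1_over_n])
  \<comment> \<open>Dilation about \<open>x\<^sub>0\<close> and normalisation there give pointwise
    convergence to 1, uniform boundedness and derivatives of order \<open>\<delta> k\<close>. The
    values may be complex and need not equal 1 on any ball.\<close>
  define \<rho> where "\<rho> = (\<lambda>k x. \<psi> (x\<^sub>0 + \<delta> k *\<^sub>R x) * inverse (\<psi> x\<^sub>0))"
  have \<rho>: "\<rho> k \<in> test_functions" for k
    unfolding \<rho>_def using \<delta>(1)[of k] by (intro test_function_mult test_function_affine \<psi> C_k_const) auto
  obtain B where B: "B > 0" "\<And>x. norm (\<psi> x) \<le> B" using test_function_bounded[OF \<psi>(1)] by metis
  have "\<exists>b. \<forall>i x. norm (partial_deriv i \<psi> x) \<le> b"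
  proof -
    have "\<exists>b. \<forall>x. norm (partial_deriv i \<psi> x) \<le> b" for i
      using test_function_bounded[OF test_function_partial_deriv[OF \<psi>(1)]] by metis
    then obtain b where "norm (partial_deriv i \<psi> x) \<le> b i" for i x by metis
    then have "norm (partial_deriv i \<psi> x) \<le> Max (range b)" for i x
      by (meson Max_ge finite finite_imageI order.trans rangeI)
    then show ?thesis by blast
  qed
  then obtain B' where B': "norm (partial_deriv i \<psi> x) \<le> B'" for i x by blast
  define c where "c = norm (inverse (\<psi> x\<^sub>0))"
  have c: "c > 0" using \<psi> by (simp add: c_def)
  have \<rho>_le: "norm (\<rho> k x) \<le> B * c" for k x
    unfolding \<rho>_def norm_mult c_def by (intro mult_right_mono B) auto
  have d\<rho>: "norm (partial_deriv i (\<rho> k) x) \<le> \<delta> k * (B' * c)" for k i x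
  proof -
    have "partial_deriv i (\<lambda>x. \<psi> (x\<^sub>0 + \<delta> k *\<^sub>R x) * inverse (\<psi> x\<^sub>0)) x
        = partial_deriv i (\<lambda>x. \<psi> (x\<^sub>0 + \<delta> k *\<^sub>R x)) x * inverse (\<psi> x\<^sub>0)"
      using partial_deriv_mult[of "\<lambda>x. \<psi> (x\<^sub>0 + \<delta> k *\<^sub>R x)" x "\<lambda>x. inverse (\<psi> x\<^sub>0)" i]
        test_function_differentiable[OF test_function_affine[OF \<psi>(1)], of "\<delta> k" x\<^sub>0 x] \<delta>(1)[of k]
        partial_deriv_eq[OF has_derivative_const[of "inverse (\<psi> x\<^sub>0)" "at x"], of i]
      by simp
    also have "\<dots> = of_real (\<delta> k) * partial_deriv i \<psi> (x\<^sub>0 + \<delta> k *\<^sub>R x) * inverse (\<psi> x\<^sub>0)"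
      by (simp add: partial_deriv_affine test_function_differentiable \<psi>)
    finally show ?thesis
      unfolding \<rho>_def c_def using \<delta>(1)[of k] B'
      by (simp add: norm_mult mult.assoc mult_right_mono)
  qed
  have \<rho>_lim: "(\<lambda>k. \<rho> k x) \<longlonglongrightarrow> 1" for x
  proof -
    have "isCont \<psi> x\<^sub>0"
      using test_function_continuous[OF \<psi>(1)] by (simp add: continuous_on_eq_continuous_at)
    moreover have "(\<lambda>k. x\<^sub>0 + \<delta> k *\<^sub>R x) \<longlonglongrightarrow> x\<^sub>0"
      using \<delta>0 by (auto intro!: tendsto_eq_intros)
    ultimately have "(\<lambda>k. \<psi> (x\<^sub>0 + \<delta> k *\<^sub>R x)) \<longlonglongrightarrow> \<psi> x\<^sub>0"
      by (rule isCont_tendsto_compose)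
    then show ?thesis unfolding \<rho>_def using \<psi>(2) by (auto intro!: tendsto_eq_intros)
  qed
  have [measurable]: "v \<in> borel_measurable lebesgue" "g i \<in> borel_measurable lebesgue"
    "\<rho> k \<in> borel_measurable lebesgue" "partial_deriv i (\<rho> k) \<in> borel_measurable lebesgue" for i k
    using v(2) g \<rho> by (auto intro: Lp_space_measurable test_function_measurable test_function_partial_deriv)
  define W where "W = (\<lambda>k x. \<rho> k x * trunc (\<delta> k) (v x))"
  define G where "G = (\<lambda>i k x. partial_deriv i (\<rho> k) x * trunc (\<delta> k) (v x) + \<rho> k x * trunc_deriv (\<delta> k) (v x) (g i x))"
  have W_le: "AE x in lebesgue. norm (W k x - v x) \<le> (B * c + 1) * norm (v x)" for k
  proof (rule AE_I2)
    fix x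
    have "norm (W k x) \<le> (B * c) * norm (v x)"
      unfolding W_def norm_mult using B c
      by (intro mult_mono \<rho>_le norm_trunc_le \<delta>) auto
    then show "norm (W k x - v x) \<le> (B * c + 1) * norm (v x)"
      using norm_triangle_ineq4[of "W k x" "v x"] by (simp add: algebra_simps)
  qed
  have W_Lp: "(\<lambda>x. W k x - v x) \<in> Lp_space 2" for k
    by (rule Lp_space_2_bound[OF v(2) _ W_le]) (simp add: W_def)
  have W_lim: "(\<lambda>k. L2_sq (\<lambda>x. W k x - v x)) \<longlonglongrightarrow> 0"
  proof (rule L2_null_dominated[OF v(2) _ W_le])
    have "(\<lambda>k. W k x) \<longlonglongrightarrow> 1 * v x" for x
      unfolding W_def by (intro tendsto_mult \<rho>_lim tendsto_trunc_0 \<delta>0)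
    then show "AE x in lebesgue. (\<lambda>k. W k x - v x) \<longlonglongrightarrow> 0"
      by (simp add: LIM_zero_iff)
  qed (simp add: W_def)
  have G_Lp_lim: "(\<forall>k. (\<lambda>x. G i k x - g i x) \<in> Lp_space 2) \<and> (\<lambda>k. L2_sq (\<lambda>x. G i k x - g i x)) \<longlonglongrightarrow> 0" for i
  proof -
    \<comment> \<open>\<open>G1\<close> carries the derivative of the cut-off and is small through
      its factor \<open>\<delta> k\<close>; \<open>G2\<close> tends to 0 pointwise with majorant a
      multiple of |g i|.\<close>
    define G1 where "G1 = (\<lambda>k x. partial_deriv i (\<rho> k) x * trunc (\<delta> k) (v x))"
    define G2 where "G2 = (\<lambda>k x. \<rho> k x * trunc_deriv (\<delta> k) (v x) (g i x) - g i x)"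
    have G: "(\<lambda>x. G i k x - g i x) = (\<lambda>x. G1 k x + G2 k x)" for k
      unfolding G_def G1_def G2_def by (rule ext) simp
    have "B' \<ge> 0" using B'[of i 0] norm_ge_zero order.trans by blast
    have G1_le': "norm (G1 k x) \<le> \<delta> k * (B' * c) * norm (v x)" for k x
      unfolding G1_def norm_mult using \<open>B' \<ge> 0\<close> c \<delta>(1)[of k]
      by (intro mult_mono d\<rho> norm_trunc_le \<delta>) auto
    have G1_le: "AE x in lebesgue. norm (G1 k x) \<le> (B' * c) * norm (v x)" for k
    proof (rule AE_I2, rule order.trans[OF G1_le'])
      fix x show "\<delta> k * (B' * c) * norm (v x) \<le> (B' * c) * norm (v x)"
        using \<open>B' \<ge> 0\<close> c \<delta>[of k] by (intro mult_right_mono mult_left_le_one_le) auto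
    qed
    have G2_le: "AE x in lebesgue. norm (G2 k x) \<le> (B * c * 3 + 1) * norm (g i x)" for k
    proof (rule AE_I2)
      fix x
      have "norm (\<rho> k x * trunc_deriv (\<delta> k) (v x) (g i x)) \<le> (B * c) * (3 * norm (g i x))"
        unfolding norm_mult using B c
        by (intro mult_mono \<rho>_le norm_trunc_deriv_le \<delta>) auto
      then show "norm (G2 k x) \<le> (B * c * 3 + 1) * norm (g i x)"
        using norm_triangle_ineq4[of "\<rho> k x * trunc_deriv (\<delta> k) (v x) (g i x)" "g i x"]
        by (simp add: G2_def algebra_simps)
    qed
    have G1: "G1 k \<in> Lp_space 2" for k
      by (rule Lp_space_2_bound[OF v(2) _ G1_le]) (simp add: G1_def)
    have G2: "G2 k \<in> Lp_space 2" for k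
      by (rule Lp_space_2_bound[OF g _ G2_le]) (simp add: G2_def)
    have "(\<lambda>k. L2_sq (G1 k)) \<longlonglongrightarrow> 0"
    proof (rule L2_null_dominated[OF v(2) _ G1_le])
      have "(\<lambda>k. G1 k x) \<longlonglongrightarrow> 0" for x
      proof (rule Lim_null_comparison)
        show "\<forall>\<^sub>F k in sequentially. norm (G1 k x) \<le> \<delta> k * (B' * c) * norm (v x)"
          using G1_le' by simp
        show "(\<lambda>k. \<delta> k * (B' * c) * norm (v x)) \<longlonglongrightarrow> 0"
          using \<delta>0 by (auto intro!: tendsto_eq_intros)
      qed
      then show "AE x in lebesgue. (\<lambda>k. G1 k x) \<longlonglongrightarrow> 0" by simp
    qed (simp add: G1_def)
    moreover have "(\<lambda>k. L2_sq (G2 k)) \<longlonglongrightarrow> 0"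
    proof (rule L2_null_dominated[OF g _ G2_le])
      have "(\<lambda>k. \<rho> k x * trunc_deriv (\<delta> k) (v x) (g i x)) \<longlonglongrightarrow> 1 * g i x" for x
        by (intro tendsto_mult \<rho>_lim tendsto_trunc_deriv_0 \<delta>0)
      then show "AE x in lebesgue. (\<lambda>k. G2 k x) \<longlonglongrightarrow> 0"
        by (simp add: G2_def LIM_zero_iff)
    qed (simp add: G2_def)
    ultimately show ?thesis unfolding G
      by (auto intro: L2_null_add Lp_space_2_add G1 G2)
  qed
  have "\<forall>k. \<exists>w. w \<in> test_functions \<and> L2_sq (\<lambda>x. w x - W k x) < \<delta> k \<and>
      (\<forall>i. L2_sq (\<lambda>x. partial_deriv i w x - G i k x) < \<delta> k)"
    unfolding W_def G_def using cutoff_trunc_approx[OF v(1) g \<phi> grad loc \<rho> \<delta>(1) \<delta>(1)] by blast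
  then obtain w where w: "\<And>k. w k \<in> test_functions" "\<And>k. L2_sq (\<lambda>x. w k x - W k x) < \<delta> k"
      "\<And>i k. L2_sq (\<lambda>x. partial_deriv i (w k) x - G i k x) < \<delta> k"
    by metis
  show thesis
  proof (rule that[OF w(1)])
    have W': "W k \<in> Lp_space 2" for k using Lp_space_2_add[OF W_Lp v(2)] by simp
    have G': "G i k \<in> Lp_space 2" for i k using Lp_space_2_add[OF _ g, of "\<lambda>x. G i k x - g i x" i] G_Lp_lim by simp
    have "(\<lambda>k. L2_sq (\<lambda>x. w k x - W k x)) \<longlonglongrightarrow> 0"
      by (rule tendsto_sandwich[OF _ _ tendsto_const \<delta>0])
         (auto intro!: always_eventually less_imp_le[OF w(2)] simp: L2_sq_nonneg)
    from L2_null_add[OF _ _ this W_lim]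
    show "(\<lambda>k. L2_sq (\<lambda>x. w k x - v x)) \<longlonglongrightarrow> 0"
      by (simp add: W_Lp Lp_space_2_diff test_function_Lp_space_2 w W')
    fix i
    have "(\<lambda>k. L2_sq (\<lambda>x. partial_deriv i (w k) x - G i k x)) \<longlonglongrightarrow> 0"
      by (rule tendsto_sandwich[OF _ _ tendsto_const \<delta>0])
         (auto intro!: always_eventually less_imp_le[OF w(3)] simp: L2_sq_nonneg)
    from L2_null_add[OF _ _ this, of "\<lambda>k x. G i k x - g i x"] G_Lp_lim[of i]
    show "(\<lambda>k. L2_sq (\<lambda>x. partial_deriv i (w k) x - g i x)) \<longlonglongrightarrow> 0"
      by (simp add: Lp_space_2_diff test_function_Lp_space_2 test_function_partial_deriv w G')
  qed
qed

text \<open>Hoelder's inequality puts the weight into \<open>L^p\<close> and |w|^2 into the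
  conjugate space. The geometric mean of gradient and function is turned into a sum with free
  weights \<open>X\<close> and \<open>Y\<close>, so that the sum can later be matched with the
  energy of the eigenvalue equation.\<close>

lemma weighted_Gagliardo_Nirenberg:
  fixes p :: real
  assumes dim: "CARD('n::finite) \<ge> 2" and p: "p > 1" "p \<ge> CARD('n) / 2"
  defines "\<theta> \<equiv> CARD('n) / (2 * p)"
  obtains C where "C > 0"
    "\<And>(w :: real^'n \<Rightarrow> complex) V X Y. w \<in> test_functions \<Longrightarrow> V \<in> Lp_space p \<Longrightarrow> (\<And>x. 0 \<le> V x) \<Longrightarrow>
      X > 0 \<Longrightarrow> Y > 0 \<Longrightarrow>
      (LINT x|lebesgue. V x * (norm (w x))\<^sup>2)
        \<le> C * Lp_norm p V * ((X * (\<Sum>i\<in>UNIV. L2_sq (partial_deriv i w)) + Y * L2_sq w)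
             / (X powr \<theta> * Y powr (1 - \<theta>)))"
proof -
  have Basis: "Basis = range (\<lambda>i::'n. axis i (1::real))" by (auto simp: Basis_vec_def)
  have inj: "inj (\<lambda>i::'n. axis i (1::real))" by (auto simp: inj_on_def axis_eq_axis)
  have DIM: "DIM(real^'n) = CARD('n)" by simp
  obtain C where C: "C > 0" and GN: "\<And>(w :: real^'n \<Rightarrow> complex) D R.
      (\<And>b x t. b \<in> Basis \<Longrightarrow> ((\<lambda>t. w (x + t *\<^sub>R b)) has_vector_derivative D b (x + t *\<^sub>R b)) (at t)) \<Longrightarrow>
      continuous_on UNIV w \<Longrightarrow> (\<And>b. b \<in> Basis \<Longrightarrow> continuous_on UNIV (D b)) \<Longrightarrow>
      (\<And>x. R < norm x \<Longrightarrow> w x = 0) \<Longrightarrow> (\<And>b x. b \<in> Basis \<Longrightarrow> R < norm x \<Longrightarrow> D b x = 0) \<Longrightarrow>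
      (LINT x|lborel. norm (w x) powr (2 * p / (p - 1))) powr (1 - 1 / p)
        \<le> C * ((\<Sum>b\<in>Basis. LINT x|lborel. (norm (D b x))\<^sup>2) powr (DIM(real^'n) / (2 * p))
               * (LINT x|lborel. (norm (w x))\<^sup>2) powr (1 - DIM(real^'n) / (2 * p)))"
  proof (rule Gagliardo_Nirenberg[where 'a = "real^'n" and 'b = complex and p = p])
    show "DIM(real^'n) \<ge> 2" "p > 1" "p \<ge> DIM(real^'n) / 2" using dim p by simp_all
  next
    fix C
    assume "C > 0" and "\<And>(w :: real^'n \<Rightarrow> complex) D R.
      (\<And>b x t. b \<in> Basis \<Longrightarrow> ((\<lambda>t. w (x + t *\<^sub>R b)) has_vector_derivative D b (x + t *\<^sub>R b)) (at t)) \<Longrightarrow>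
      continuous_on UNIV w \<Longrightarrow> (\<And>b. b \<in> Basis \<Longrightarrow> continuous_on UNIV (D b)) \<Longrightarrow>
      (\<And>x. R < norm x \<Longrightarrow> w x = 0) \<Longrightarrow> (\<And>b x. b \<in> Basis \<Longrightarrow> R < norm x \<Longrightarrow> D b x = 0) \<Longrightarrow>
      (LINT x|lborel. norm (w x) powr (2 * p / (p - 1))) powr (1 - 1 / p)
        \<le> C * ((\<Sum>b\<in>Basis. LINT x|lborel. (norm (D b x))\<^sup>2) powr (DIM(real^'n) / (2 * p))
               * (LINT x|lborel. (norm (w x))\<^sup>2) powr (1 - DIM(real^'n) / (2 * p)))"
    then show thesis by (rule that)
  qed
  show thesis
  proof (rule that[OF C])
    fix w :: "real^'n \<Rightarrow> complex" and V :: "real^'n \<Rightarrow> real" and X Y :: real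
    assume w: "w \<in> test_functions" and V: "V \<in> Lp_space p" "\<And>x. 0 \<le> V x" and XY: "X > 0" "Y > 0"
    define D where "D = (\<lambda>b x. frechet_derivative w (at x) b)"
    have D_axis: "D (axis i 1) = partial_deriv i w" for i
      by (simp add: D_def partial_deriv_def fun_eq_iff)
    obtain R where R: "\<And>x. R < norm x \<Longrightarrow> w x = 0" using w by (auto simp: test_functions_iff)
    define q where "q = 2 * p / (p - 1)"
    have q: "q > 0" using p by (simp add: q_def)
    define N where "N = (\<Sum>i\<in>UNIV. L2_sq (partial_deriv i w))"
    define M where "M = L2_sq w"
    have NM: "N \<ge> 0" "M \<ge> 0" by (auto simp: N_def M_def intro!: sum_nonneg L2_sq_nonneg)
    have w_borel: "w \<in> borel_measurable borel" "\<And>i. partial_deriv i w \<in> borel_measurable borel"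
      by (auto intro!: borel_measurable_continuous_onI test_function_continuous test_function_partial_deriv w)
    have lborel: "L2_sq f = (LINT x|lborel. (norm (f x))\<^sup>2)" if "f \<in> borel_measurable borel" for f :: "real^'n \<Rightarrow> complex"
      unfolding L2_sq_def using that by (intro integral_completion) simp
    have wq: "integrable lborel (\<lambda>x. norm (w x) powr q)"
      using q R by (intro integrable_continuous_bounded_support[of _ R] continuous_on_powr' continuous_intros
          test_function_continuous w) auto
    have wq': "integrable lebesgue (\<lambda>x. norm (w x) powr q)"
      "(LINT x|lebesgue. norm (w x) powr q) = (LINT x|lborel. norm (w x) powr q)"
      using wq by (auto simp: integrable_completion integral_completion borel_measurable_integrable)
    have "(LINT x|lborel. norm (w x) powr q) powr (1 - 1 / p)
        \<le> C * ((\<Sum>b\<in>Basis. LINT x|lborel. (norm (D b x))\<^sup>2) powr \<theta> * (LINT x|lborel. (norm (w x))\<^sup>2) powr (1 - \<theta>))"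
      unfolding q_def \<theta>_def DIM[symmetric]
    proof (rule GN)
      show "((\<lambda>t. w (x + t *\<^sub>R b)) has_vector_derivative D b (x + t *\<^sub>R b)) (at t)" if "b \<in> Basis" for b x t
        using that test_function_has_vector_derivative[OF w] unfolding Basis by (auto simp: D_axis)
      show "continuous_on UNIV (D b)" if "b \<in> Basis" for b
        using that unfolding Basis
        by (auto simp: D_axis intro!: test_function_continuous test_function_partial_deriv w)
      show "D b x = 0" if "b \<in> Basis" "R < norm x" for b x
        using that partial_deriv_zero[OF R] unfolding Basis by (auto simp: D_axis)
    qed (use R test_function_continuous w in auto)
    also have "(LINT x|lborel. (norm (w x))\<^sup>2) = M" by (simp add: M_def lborel w_borel)
    also have "(\<Sum>b\<in>Basis. LINT x|lborel. (norm (D b x))\<^sup>2) = N"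
      unfolding Basis by (simp add: sum.reindex[OF inj] N_def lborel w_borel D_axis)
    finally have GN': "(LINT x|lborel. norm (w x) powr q) powr (1 - 1 / p) \<le> C * (N powr \<theta> * M powr (1 - \<theta>))" .
    have \<theta>: "0 < \<theta>" "\<theta> \<le> 1" using p by (simp_all add: \<theta>_def divide_le_eq_1)
    have "N powr \<theta> * M powr (1 - \<theta>) \<le> (X * N + Y * M) / (X powr \<theta> * Y powr (1 - \<theta>))"
    proof -
      define P Q where "P = X * N" and "Q = Y * M"
      have PQ: "0 \<le> P" "0 \<le> Q" using NM XY by (simp_all add: P_def Q_def)
      \<comment> \<open>Monotonicity of powers takes the place of Young's inequality and includes
        the endpoint \<theta> = 1, which occurs for p = d/2.\<close>
      have "P powr \<theta> \<le> (P + Q) powr \<theta>" "Q powr (1 - \<theta>) \<le> (P + Q) powr (1 - \<theta>)"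
        using PQ \<theta> by (auto intro: powr_mono2)
      then have "P powr \<theta> * Q powr (1 - \<theta>) \<le> (P + Q) powr \<theta> * (P + Q) powr (1 - \<theta>)"
        by (intro mult_mono) simp_all
      also have "\<dots> = P + Q"
        using PQ by (simp flip: powr_add)
      also have "P powr \<theta> * Q powr (1 - \<theta>) = (N powr \<theta> * M powr (1 - \<theta>)) * (X powr \<theta> * Y powr (1 - \<theta>))"
        using NM XY by (simp add: P_def Q_def powr_mult mult_ac)
      finally show ?thesis
        using XY by (simp add: pos_le_divide_eq P_def Q_def)
    qed
    then have GN'': "(LINT x|lborel. norm (w x) powr q) powr (1 - 1 / p)
        \<le> C * ((X * N + Y * M) / (X powr \<theta> * Y powr (1 - \<theta>)))"
      using C by (intro order.trans[OF GN'] mult_left_mono) auto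
    have eq: "V x * (norm (w x))\<^sup>2 = (V x powr p) powr (1 / p) * (norm (w x) powr q) powr (1 - 1 / p)" for x
    proof -
      have "q * (1 - 1 / p) = 2" using p by (simp add: q_def field_simps)
      then show ?thesis using p V by (simp add: powr_powr)
    qed
    have "(LINT x|lebesgue. V x * (norm (w x))\<^sup>2)
        \<le> (LINT x|lebesgue. V x powr p) powr (1 / p) * (LINT x|lebesgue. norm (w x) powr q) powr (1 - 1 / p)"
      unfolding eq using p V wq' by (intro Holder_integral) (auto simp: Lp_space_def)
    also have "\<dots> \<le> Lp_norm p V * (C * ((X * N + Y * M) / (X powr \<theta> * Y powr (1 - \<theta>))))"
      unfolding wq'(2) Lp_norm_def using V by (intro mult_mono GN'') auto
    finally show "(LINT x|lebesgue. V x * (norm (w x))\<^sup>2)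
        \<le> C * Lp_norm p V * ((X * (\<Sum>i\<in>UNIV. L2_sq (partial_deriv i w)) + Y * L2_sq w)
             / (X powr \<theta> * Y powr (1 - \<theta>)))"
      by (simp add: N_def M_def mult_ac)
  qed
qed

section \<open>Pairings and limits in \<open>L^2\<close>\<close>

lemma
  assumes f: "f \<in> Lp_space 2" and g: "g \<in> Lp_space 2"
  shows Cauchy_Schwarz_integrable: "integrable lebesgue (\<lambda>x. norm (f x) * norm (g x))"
    and Cauchy_Schwarz_integral: "(LINT x|lebesgue. norm (f x) * norm (g x)) \<le> sqrt (L2_sq f) * sqrt (L2_sq g)"
proof -
  have eq: "norm (f x) * norm (g x) = ((norm (f x))\<^sup>2) powr (1 / 2) * ((norm (g x))\<^sup>2) powr (1 - 1 / 2)" for x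
    by (simp add: powr_half_sqrt)
  show "integrable lebesgue (\<lambda>x. norm (f x) * norm (g x))"
    unfolding eq using f g by (intro Holder_integral) (auto simp: Lp_space_2_iff)
  have "(LINT x|lebesgue. norm (f x) * norm (g x)) \<le> L2_sq f powr (1 / 2) * L2_sq g powr (1 - 1 / 2)"
    unfolding eq L2_sq_def using f g by (intro Holder_integral) (auto simp: Lp_space_2_iff)
  then show "(LINT x|lebesgue. norm (f x) * norm (g x)) \<le> sqrt (L2_sq f) * sqrt (L2_sq g)"
    by (simp add: powr_half_sqrt L2_sq_nonneg)
qed

lemma L2_cnj_integrable:
  fixes f g :: "'a::euclidean_space \<Rightarrow> complex"
  assumes "f \<in> Lp_space 2" "g \<in> Lp_space 2"
  shows "integrable lebesgue (\<lambda>x. f x * cnj (g x))"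
proof -
  have [measurable]: "f \<in> borel_measurable lebesgue" "g \<in> borel_measurable lebesgue"
    using assms by (auto intro: Lp_space_measurable)
  show ?thesis
    by (rule Bochner_Integration.integrable_bound[OF Cauchy_Schwarz_integrable[OF assms]])
       (auto simp: norm_mult)
qed

lemma L2_cnj_tendsto:
  fixes f h :: "'a::euclidean_space \<Rightarrow> complex"
  assumes f: "f \<in> Lp_space 2" and w: "\<And>m. w m \<in> Lp_space 2" and h: "h \<in> Lp_space 2"
    and lim: "(\<lambda>m. L2_sq (\<lambda>x. w m x - h x)) \<longlonglongrightarrow> 0"
  shows "(\<lambda>m. LINT x|lebesgue. f x * cnj (w m x)) \<longlonglongrightarrow> (LINT x|lebesgue. f x * cnj (h x))"
proof (rule LIM_zero_cancel, rule Lim_null_comparison)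
  note wh = Lp_space_2_diff[OF w h]
  have "norm ((LINT x|lebesgue. f x * cnj (w m x)) - (LINT x|lebesgue. f x * cnj (h x)))
      \<le> sqrt (L2_sq f) * sqrt (L2_sq (\<lambda>x. w m x - h x))" for m
  proof -
    have "(LINT x|lebesgue. f x * cnj (w m x)) - (LINT x|lebesgue. f x * cnj (h x))
        = (LINT x|lebesgue. f x * cnj (w m x - h x))"
      using L2_cnj_integrable[OF f w] L2_cnj_integrable[OF f h]
      by (simp add: right_diff_distrib)
    also have "norm \<dots> \<le> (LINT x|lebesgue. norm (f x * cnj (w m x - h x)))"
      by (rule integral_norm_bound)
    also have "\<dots> = (LINT x|lebesgue. norm (f x) * norm (w m x - h x))"
      by (simp add: norm_mult del: complex_cnj_diff)
    also have "\<dots> \<le> sqrt (L2_sq f) * sqrt (L2_sq (\<lambda>x. w m x - h x))"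
      by (rule Cauchy_Schwarz_integral[OF f wh])
    finally show ?thesis .
  qed
  then show "\<forall>\<^sub>F m in sequentially. norm ((LINT x|lebesgue. f x * cnj (w m x)) - (LINT x|lebesgue. f x * cnj (h x)))
      \<le> sqrt (L2_sq f) * sqrt (L2_sq (\<lambda>x. w m x - h x))" by simp
  show "(\<lambda>m. sqrt (L2_sq f) * sqrt (L2_sq (\<lambda>x. w m x - h x))) \<longlonglongrightarrow> 0"
    using tendsto_mult_left[OF tendsto_real_sqrt[OF lim], of "sqrt (L2_sq f)"] by simp
qed

lemma L2_sq_cnj:
  fixes f :: "'a::euclidean_space \<Rightarrow> complex"
  shows "(LINT x|lebesgue. f x * cnj (f x)) = of_real (L2_sq f)"
  by (simp only: L2_sq_def complex_norm_square[symmetric] integral_complex_of_real)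

text \<open>The polarisation |w|^2 = |w - h|^2 + 2 Re (h cnj w) - |h|^2 reduces the claim to the
  convergence of pairings with the fixed function \<open>h\<close>.\<close>

lemma L2_sq_tendsto:
  fixes h :: "'a::euclidean_space \<Rightarrow> complex"
  assumes w: "\<And>m. w m \<in> Lp_space 2" and h: "h \<in> Lp_space 2"
    and lim: "(\<lambda>m. L2_sq (\<lambda>x. w m x - h x)) \<longlonglongrightarrow> 0"
  shows "(\<lambda>m. L2_sq (w m)) \<longlonglongrightarrow> L2_sq h"
proof -
  have eq: "L2_sq (w m) = L2_sq (\<lambda>x. w m x - h x) + 2 * Re (LINT x|lebesgue. h x * cnj (w m x)) - L2_sq h" for m
  proof -
    note wh = Lp_space_2_diff[OF w h]
    define P where "P = (\<lambda>x. (w m x - h x) * cnj (w m x - h x))"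
    define Q where "Q = (\<lambda>x. h x * cnj (w m x))"
    define S where "S = (\<lambda>x. h x * cnj (h x))"
    have int: "integrable lebesgue P" "integrable lebesgue Q" "integrable lebesgue (\<lambda>x. cnj (Q x))"
      "integrable lebesgue S"
      unfolding P_def Q_def S_def
      by (intro L2_cnj_integrable integrable_cnj w h wh)+
    have "complex_of_real (L2_sq (w m)) = (LINT x|lebesgue. P x + Q x + cnj (Q x) - S x)"
      unfolding L2_sq_cnj[symmetric] P_def Q_def S_def
      by (intro Bochner_Integration.integral_cong) (auto simp: algebra_simps)
    also have "\<dots> = (LINT x|lebesgue. P x) + (LINT x|lebesgue. Q x) + cnj (LINT x|lebesgue. Q x)
        - (LINT x|lebesgue. S x)"
      using int by simp
    also have "\<dots> = of_real (L2_sq (\<lambda>x. w m x - h x)) + (LINT x|lebesgue. h x * cnj (w m x))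
        + cnj (LINT x|lebesgue. h x * cnj (w m x)) - of_real (L2_sq h)"
      unfolding P_def Q_def S_def L2_sq_cnj ..
    finally show ?thesis by (simp add: complex_eq_iff)
  qed
  have "(\<lambda>m. L2_sq (\<lambda>x. w m x - h x) + 2 * Re (LINT x|lebesgue. h x * cnj (w m x)) - L2_sq h)
      \<longlonglongrightarrow> 0 + 2 * Re (of_real (L2_sq h)) - L2_sq h"
    unfolding L2_sq_cnj[symmetric]
    by (intro tendsto_intros lim tendsto_Re L2_cnj_tendsto[OF h w h])
  then show ?thesis by (simp flip: eq)
qed

text \<open>Multiplication by the bounded function \<open>sqrt (V x)\<close> preserves
  \<open>L^2\<close> convergence, which reduces the weighted case to the unweighted one.\<close>

lemma L2_sq_weighted_tendsto:
  fixes h :: "'a::euclidean_space \<Rightarrow> complex" and V :: "'a \<Rightarrow> real"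
  assumes w: "\<And>m. w m \<in> Lp_space 2" and h: "h \<in> Lp_space 2"
    and lim: "(\<lambda>m. L2_sq (\<lambda>x. w m x - h x)) \<longlonglongrightarrow> 0"
    and V: "V \<in> borel_measurable lebesgue" "\<And>x. 0 \<le> V x" "AE x in lebesgue. V x \<le> B"
  shows "(\<lambda>m. LINT x|lebesgue. V x * (norm (w m x))\<^sup>2) \<longlonglongrightarrow> (LINT x|lebesgue. V x * (norm (h x))\<^sup>2)"
proof -
  define s where "s = (\<lambda>f x. of_real (sqrt (V x)) * f x :: complex)"
  have s: "(LINT x|lebesgue. V x * (norm (f x))\<^sup>2) = L2_sq (s f)" for f
    unfolding L2_sq_def s_def
    by (intro Bochner_Integration.integral_cong) (auto simp: norm_mult power_mult_distrib V)
  have meas: "s f \<in> borel_measurable lebesgue" if "f \<in> borel_measurable lebesgue" for f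
    using that V(1) unfolding s_def by measurable
  have le: "AE x in lebesgue. norm (s f x) \<le> sqrt B * norm (f x)" for f
    using V(3) by eventually_elim (auto simp: s_def norm_mult V intro!: mult_right_mono)
  have Lp: "s f \<in> Lp_space 2" if "f \<in> Lp_space 2" for f
    by (rule Lp_space_2_bound[OF that meas[OF Lp_space_measurable[OF that]] le])
  note wh = Lp_space_2_diff[OF w h]
  show ?thesis unfolding s
  proof (rule L2_sq_tendsto[OF Lp[OF w] Lp[OF h]])
    have "(\<lambda>x. s (w m) x - s h x) = s (\<lambda>x. w m x - h x)" for m
      by (auto simp: s_def right_diff_distrib)
    then show "(\<lambda>m. L2_sq (\<lambda>x. s (w m) x - s h x)) \<longlonglongrightarrow> 0"
      using L2_null_bound[OF wh _ le lim] meas[OF Lp_space_measurable[OF wh]] by simp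
  qed
qed

section \<open>Weak derivatives under the integral sign\<close>

lemma L1_loc_mult_test_integrable:
  fixes f \<phi> :: "real^'n::finite \<Rightarrow> complex"
  assumes f: "f \<in> L1_loc" and \<phi>: "\<phi> \<in> test_functions"
  shows "integrable lebesgue (\<lambda>x. f x * \<phi> x)"
proof -
  obtain R where R: "\<And>x. R < norm x \<Longrightarrow> \<phi> x = 0" using \<phi> by (auto simp: test_functions_iff)
  obtain B where B: "B > 0" "\<And>x. norm (\<phi> x) \<le> B" using test_function_bounded[OF \<phi>] by metis
  have "integrable lebesgue (\<lambda>x. indicator (cball 0 R) x *\<^sub>R f x)"
    using f by (simp add: L1_loc_def set_integrable_def)
  then have "integrable lebesgue (\<lambda>x. B *\<^sub>R (indicator (cball 0 R) x *\<^sub>R f x))"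
    by (rule integrable_scaleR_right)
  then show ?thesis
  proof (rule Bochner_Integration.integrable_bound)
    show "(\<lambda>x. f x * \<phi> x) \<in> borel_measurable lebesgue"
      using L1_loc_measurable[OF f] test_function_measurable[OF \<phi>] by measurable
    have "norm (f x * \<phi> x) \<le> norm (B *\<^sub>R (indicator (cball 0 R) x *\<^sub>R f x))" for x
      using R[of x] B(1) mult_right_mono[OF B(2)[of x], of "norm (f x)"]
      by (cases "norm x \<le> R") (auto simp: norm_mult mult.commute)
    then show "AE x in lebesgue. norm (f x * \<phi> x) \<le> norm (B *\<^sub>R (indicator (cball 0 R) x *\<^sub>R f x))"
      by simp
  qed
qed

lemma L1_loc_sum:
  assumes "\<And>j. j \<in> J \<Longrightarrow> f j \<in> L1_loc"
  shows "(\<lambda>x. \<Sum>j\<in>J. f j x) \<in> L1_loc"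
  using assms by (auto simp: L1_loc_def set_integrable_def scaleR_sum_right
                 intro!: Bochner_Integration.integrable_sum)

lemma has_weak_partial_weak_partial:
  "weakly_differentiable i u \<Longrightarrow> has_weak_partial i u (weak_partial i u)"
  unfolding weakly_differentiable_def weak_partial_def by (erule someI_ex)

text \<open>Needed for the divergence: the domain gives weak derivatives of the individual
  components and partials only, whereas \<open>weak_partial\<close> of their sum is an arbitrary
  choice that is meaningful once some weak derivative is known to exist.\<close>

lemma has_weak_partial_sum:
  assumes "finite J" "\<And>j. j \<in> J \<Longrightarrow> has_weak_partial i (u j) (g j)"
  shows "has_weak_partial i (\<lambda>x. \<Sum>j\<in>J. u j x) (\<lambda>x. \<Sum>j\<in>J. g j x)"
proof -
  have "(LINT x|lebesgue. (\<Sum>j\<in>J. u j x) * partial_deriv i \<phi> x) = - (LINT x|lebesgue. (\<Sum>j\<in>J. g j x) * \<phi> x)"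
    if \<phi>: "\<phi> \<in> test_functions" for \<phi>
  proof -
    have "(LINT x|lebesgue. (\<Sum>j\<in>J. u j x) * partial_deriv i \<phi> x)
        = (\<Sum>j\<in>J. LINT x|lebesgue. u j x * partial_deriv i \<phi> x)"
      unfolding sum_distrib_right using assms(2) \<phi>
      by (intro Bochner_Integration.integral_sum L1_loc_mult_test_integrable test_function_partial_deriv)
         (auto simp: has_weak_partial_def)
    also have "\<dots> = (\<Sum>j\<in>J. - (LINT x|lebesgue. g j x * \<phi> x))"
      using assms(2) \<phi> by (intro sum.cong) (auto simp: has_weak_partial_def)
    also have "\<dots> = - (LINT x|lebesgue. (\<Sum>j\<in>J. g j x) * \<phi> x)"
      unfolding sum_distrib_right sum_negf using assms(2) \<phi>
      by (subst Bochner_Integration.integral_sum)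
         (auto simp: has_weak_partial_def intro!: L1_loc_mult_test_integrable)
    finally show ?thesis .
  qed
  then show ?thesis
    using assms(2) unfolding has_weak_partial_def by (auto intro!: L1_loc_sum)
qed

text \<open>Both sides equal minus the integral of \<open>v\<close> against the derivative of
  \<phi>. Agreement under the integral is all that is required, so the uniqueness of weak
  derivatives is avoided.\<close>

lemma integral_weak_partial_scale:
  assumes u: "has_weak_partial i u h" and v: "has_weak_partial i v g"
    and eq: "AE x in lebesgue. v x = z * u x" and \<phi>: "\<phi> \<in> test_functions"
  shows "z * (LINT x|lebesgue. h x * \<phi> x) = (LINT x|lebesgue. g x * \<phi> x)"
proof -
  have "(LINT x|lebesgue. g x * \<phi> x) = - (LINT x|lebesgue. v x * partial_deriv i \<phi> x)"
    using v \<phi> by (simp add: has_weak_partial_def)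
  also have "(LINT x|lebesgue. v x * partial_deriv i \<phi> x) = (LINT x|lebesgue. z * (u x * partial_deriv i \<phi> x))"
  proof (rule integral_cong_AE)
    have [measurable]: "u \<in> borel_measurable lebesgue" "v \<in> borel_measurable lebesgue"
      "partial_deriv i \<phi> \<in> borel_measurable lebesgue"
      using u v \<phi> by (auto simp: has_weak_partial_def L1_loc_measurable
          intro: test_function_measurable test_function_partial_deriv)
    show "(\<lambda>x. v x * partial_deriv i \<phi> x) \<in> borel_measurable lebesgue"
      "(\<lambda>x. z * (u x * partial_deriv i \<phi> x)) \<in> borel_measurable lebesgue"
      by measurable
    show "AE x in lebesgue. v x * partial_deriv i \<phi> x = z * (u x * partial_deriv i \<phi> x)"
      using eq by eventually_elim simp
  qed
  also have "\<dots> = z * (LINT x|lebesgue. u x * partial_deriv i \<phi> x)" by simp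
  also have "(LINT x|lebesgue. u x * partial_deriv i \<phi> x) = - (LINT x|lebesgue. h x * \<phi> x)"
    using u \<phi> by (simp add: has_weak_partial_def)
  finally show ?thesis by simp
qed

subsection \<open>The energy identity and the eigenvalue bound\<close>

lemma bounded_mult_L2_integrable:
  fixes a :: "'a::euclidean_space \<Rightarrow> real"
  assumes a: "a \<in> borel_measurable lebesgue" "AE x in lebesgue. \<bar>a x\<bar> \<le> A" and f: "f \<in> Lp_space 2"
  shows "integrable lebesgue (\<lambda>x. a x * (norm (f x))\<^sup>2)"
proof (rule Bochner_Integration.integrable_bound)
  show "integrable lebesgue (\<lambda>x. A * (norm (f x))\<^sup>2)" using f by (simp add: Lp_space_2_iff)
  show "(\<lambda>x. a x * (norm (f x))\<^sup>2) \<in> borel_measurable lebesgue"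
    using borel_measurable_times[OF a(1) borel_measurable_integrable] f
    by (auto simp: Lp_space_2_iff)
  show "AE x in lebesgue. norm (a x * (norm (f x))\<^sup>2) \<le> norm (A * (norm (f x))\<^sup>2)"
    using a(2) by eventually_elim (auto simp: abs_mult intro!: mult_right_mono)
qed

lemma mat_vector_mult: "(mat c *v y) $ k = c * y $ k" for y :: "'a::semiring_1^'n::finite"
  by (simp add: matrix_vector_mult_def mat_def if_distribR if_distrib[of "\<lambda>c. c * _"] cong: if_cong)

lemma
  fixes u :: "real^'n::finite \<Rightarrow> complex^'n"
  assumes "u \<in> H2_vec"
  shows H2_vec_weak_partial: "has_weak_partial j (\<lambda>y. u y $ k) (weak_partial j (\<lambda>y. u y $ k))"
    and H2_vec_weak_partial2: "has_weak_partial i (weak_partial j (\<lambda>y. u y $ k))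
          (weak_partial i (weak_partial j (\<lambda>y. u y $ k)))"
    and H2_vec_weak_div: "has_weak_partial i (weak_div u) (weak_partial i (weak_div u))"
proof -
  have "(\<lambda>y. u y $ k) \<in> H2" for k using assms by (simp add: H2_vec_def)
  then show 1: "has_weak_partial j (\<lambda>y. u y $ k) (weak_partial j (\<lambda>y. u y $ k))"
    and 2: "has_weak_partial i (weak_partial j (\<lambda>y. u y $ k)) (weak_partial i (weak_partial j (\<lambda>y. u y $ k)))"
    for i j k
    by (auto simp: H2_def intro!: has_weak_partial_weak_partial)
  have "has_weak_partial i (weak_div u) (\<lambda>x. \<Sum>j\<in>UNIV. weak_partial i (weak_partial j (\<lambda>y. u y $ j)) x)"
    unfolding weak_div_def[abs_def] by (intro has_weak_partial_sum 2) auto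
  then show "has_weak_partial i (weak_div u) (weak_partial i (weak_div u))"
    by (auto simp: weakly_differentiable_def intro!: has_weak_partial_weak_partial)
qed

lemma Hdot1_vec_weak_partial:
  "v \<in> Hdot1_vec \<Longrightarrow> has_weak_partial j (\<lambda>y. v y $ k) (weak_partial j (\<lambda>y. v y $ k))"
  by (auto simp: Hdot1_vec_def Hdot1_def intro!: has_weak_partial_weak_partial)

lemma lame_component_measurable:
  assumes u: "u \<in> H2_vec"
  shows "(\<lambda>x. lame lam mu u x $ k) \<in> borel_measurable lebesgue"
proof -
  have [measurable]: "weak_partial k (weak_div u) \<in> borel_measurable lebesgue"
    "weak_partial j (weak_partial j (\<lambda>y. u y $ k)) \<in> borel_measurable lebesgue" for j
    using H2_vec_weak_div[OF u, of k] H2_vec_weak_partial2[OF u, of j j k]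
    by (auto simp: has_weak_partial_def intro: L1_loc_measurable)
  show ?thesis unfolding lame_def weak_laplacian_def by simp
qed

text \<open>All derivatives are moved onto the test function, where \<open>u\<close> may be replaced by \<open>v = z u\<close>;
  this avoids comparing the weak derivatives of \<open>u\<close> with those of \<open>v\<close>.\<close>

lemma integral_lame_test_function:
  fixes u v :: "real^'n::finite \<Rightarrow> complex^'n"
  assumes u: "u \<in> H2_vec" and v: "v \<in> Hdot1_vec" and eq: "AE x in lebesgue. v x = z *s u x"
    and W: "W \<in> test_functions"
  shows "z * (LINT x|lebesgue. lame lam mu u x $ k * W x)
    = - (of_real mu * (\<Sum>j\<in>UNIV. LINT x|lebesgue. weak_partial j (\<lambda>y. v y $ k) x * partial_deriv j W x)
       + of_real (lam + mu) * (LINT x|lebesgue. (\<Sum>j\<in>UNIV. weak_partial j (\<lambda>y. v y $ j) x) * partial_deriv k W x))"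
proof -
  define D1 where "D1 = (\<lambda>j k. weak_partial j (\<lambda>y. u y $ k))"
  define g where "g = (\<lambda>j k. weak_partial j (\<lambda>y. v y $ k))"
  have D1: "has_weak_partial j (\<lambda>y. u y $ k) (D1 j k)"
    and D2: "has_weak_partial i (D1 j k) (weak_partial i (D1 j k))"
    and g: "has_weak_partial j (\<lambda>y. v y $ k) (g j k)" for i j k
    unfolding D1_def g_def
    by (rule H2_vec_weak_partial[OF u] H2_vec_weak_partial2[OF u] Hdot1_vec_weak_partial[OF v])+
  note D = H2_vec_weak_div[OF u]
  have eq': "AE x in lebesgue. v x $ k = z * u x $ k" for k
    using eq by eventually_elim simp
  have dW: "partial_deriv j W \<in> test_functions" for j by (rule test_function_partial_deriv[OF W])
  have ibp: "(LINT x|lebesgue. h x * W x) = - (LINT x|lebesgue. f x * partial_deriv i W x)"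
    if "has_weak_partial i f h" for f h i
    using that W by (simp add: has_weak_partial_def)
  have int: "integrable lebesgue (\<lambda>x. h x * \<phi> x)" if "has_weak_partial i f h" "\<phi> \<in> test_functions" for f h i \<phi>
    using that by (intro L1_loc_mult_test_integrable) (auto simp: has_weak_partial_def)
  \<comment> \<open>The outer derivative goes to \<open>W\<close> by definition; the inner one is
    exchanged for that of \<open>v\<close> by testing with the derivative of
    \<open>W\<close>.\<close>
  have lap: "z * (LINT x|lebesgue. weak_partial j (D1 j k) x * W x)
      = - (LINT x|lebesgue. g j k x * partial_deriv j W x)" for j
    using ibp[OF D2[of j j k]] integral_weak_partial_scale[OF D1[of j k] g[of j k] eq' dW[of j]] by simp
  have div: "z * (LINT x|lebesgue. weak_partial k (weak_div u) x * W x)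
      = - (LINT x|lebesgue. (\<Sum>j\<in>UNIV. g j j x) * partial_deriv k W x)"
  proof -
    have wdiv: "weak_div u x = (\<Sum>j\<in>UNIV. D1 j j x)" for x
      by (simp add: weak_div_def D1_def)
    have "z * (LINT x|lebesgue. weak_div u x * partial_deriv k W x)
        = z * (\<Sum>j\<in>UNIV. LINT x|lebesgue. D1 j j x * partial_deriv k W x)"
      unfolding wdiv sum_distrib_right
      by (subst Bochner_Integration.integral_sum) (auto intro!: int[OF D1 dW])
    also have "\<dots> = (\<Sum>j\<in>UNIV. LINT x|lebesgue. g j j x * partial_deriv k W x)"
      unfolding sum_distrib_left
      by (intro sum.cong refl integral_weak_partial_scale[OF D1 g eq' dW])
    also have "\<dots> = (LINT x|lebesgue. (\<Sum>j\<in>UNIV. g j j x) * partial_deriv k W x)"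
      unfolding sum_distrib_right
      by (subst Bochner_Integration.integral_sum) (auto intro!: int[OF g dW])
    finally show ?thesis using ibp[OF D[of k]] by simp
  qed
  have "(LINT x|lebesgue. lame lam mu u x $ k * W x)
      = (LINT x|lebesgue. of_real mu * (\<Sum>j\<in>UNIV. weak_partial j (D1 j k) x * W x)
          + of_real (lam + mu) * (weak_partial k (weak_div u) x * W x))"
    by (simp add: lame_def weak_laplacian_def D1_def algebra_simps sum_distrib_right sum_distrib_left)
  also have "\<dots> = of_real mu * (\<Sum>j\<in>UNIV. LINT x|lebesgue. weak_partial j (D1 j k) x * W x)
      + of_real (lam + mu) * (LINT x|lebesgue. weak_partial k (weak_div u) x * W x)"
    using int[OF D2 W] int[OF D W]
    by (simp del: of_real_add)
  finally show ?thesis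
    by (simp only: distrib_left mult.left_commute[of z] sum_distrib_left[of z] lap div)
       (simp add: sum_negf g_def)
qed

text \<open>Component \<open>k\<close> of the equation is tested with the conjugate of
  \<open>w k n\<close>, and n tends to infinity. Only pairings of fixed \<open>L^2\<close> functions
  with \<open>w k n\<close> and its gradient occur, so the assumed convergence suffices.\<close>

lemma energy_identity:
  fixes u v :: "real^'n::finite \<Rightarrow> complex^'n" and a :: "real^'n \<Rightarrow> real" and z :: real
  assumes u: "u \<in> H2_vec" and v: "v \<in> Hdot1_vec" and vL2: "\<And>k. (\<lambda>y. v y $ k) \<in> Lp_space 2"
    and eq: "AE x in lebesgue. v x = of_real z *s u x"
    and lame: "AE x in lebesgue. lame lam mu u x - scalar_damping a x *v v x = of_real z *s v x"
    and a: "a \<in> Linfty_space"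
    and w: "\<And>k n. w k n \<in> test_functions"
      "\<And>k. (\<lambda>n. L2_sq (\<lambda>x. w k n x - v x $ k)) \<longlonglongrightarrow> 0"
      "\<And>k j. (\<lambda>n. L2_sq (\<lambda>x. partial_deriv j (w k n) x - weak_partial j (\<lambda>y. v y $ k) x)) \<longlonglongrightarrow> 0"
  shows "mu * (\<Sum>k\<in>UNIV. \<Sum>j\<in>UNIV. L2_sq (weak_partial j (\<lambda>y. v y $ k)))
      + (lam + mu) * L2_sq (\<lambda>x. \<Sum>j\<in>UNIV. weak_partial j (\<lambda>y. v y $ j) x)
      + z\<^sup>2 * (\<Sum>k\<in>UNIV. L2_sq (\<lambda>y. v y $ k))
      = - z * (\<Sum>k\<in>UNIV. LINT x|lebesgue. a x * (norm (v x $ k))\<^sup>2)"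
proof -
  define g where "g = (\<lambda>j k. weak_partial j (\<lambda>y. v y $ k))"
  define G where "G = (\<lambda>x. \<Sum>j\<in>UNIV. g j j x)"
  \<comment> \<open>Almost everywhere this is component \<open>k\<close> of the Lame term, solved
    for by means of the eigenvalue equation; it is in \<open>L^2\<close> because \<open>a\<close> is
    bounded.\<close>
  define f where "f = (\<lambda>k x. of_real (a x + z) * v x $ k)"
  have g: "g j k \<in> Lp_space 2" for j k
    using v by (auto simp: g_def Hdot1_vec_def Hdot1_def)
  have gw: "(\<lambda>n. L2_sq (\<lambda>x. partial_deriv j (w k n) x - g j k x)) \<longlonglongrightarrow> 0" for j k
    unfolding g_def by (rule w(3))
  have "(\<lambda>x. \<Sum>j\<in>J. g j j x) \<in> Lp_space 2" if "finite J" for J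
    using that
  proof induction
    case empty
    then show ?case by (simp add: Lp_space_2_iff)
  qed (simp add: Lp_space_2_add[OF g])
  then have G: "G \<in> Lp_space 2" by (simp add: G_def)
  obtain A where A: "AE x in lebesgue. \<bar>a x\<bar> \<le> A" and [measurable]: "a \<in> borel_measurable lebesgue"
    using a by (auto simp: Linfty_space_def)
  have v_meas [measurable]: "(\<lambda>x. v x $ k) \<in> borel_measurable lebesgue" for k
    using vL2 by (rule Lp_space_measurable)
  have f: "f k \<in> Lp_space 2" for k
  proof (rule Lp_space_2_bound[OF vL2])
    show "f k \<in> borel_measurable lebesgue" unfolding f_def by measurable
    show "AE x in lebesgue. norm (f k x) \<le> (A + \<bar>z\<bar>) * norm (v x $ k)"
      using A
    proof eventually_elim
      case (elim x)
      then have "\<bar>a x + z\<bar> \<le> A + \<bar>z\<bar>" by linarith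
      then show ?case unfolding f_def norm_mult norm_of_real by (intro mult_right_mono) auto
    qed
  qed
  have int_a: "integrable lebesgue (\<lambda>x. a x * (norm (v x $ k))\<^sup>2)" for k
    by (rule bounded_mult_L2_integrable[OF _ A vL2]) simp
  have f_cnj: "(LINT x|lebesgue. f k x * cnj (v x $ k))
      = of_real ((LINT x|lebesgue. a x * (norm (v x $ k))\<^sup>2) + z * L2_sq (\<lambda>y. v y $ k))" for k
  proof -
    have "(LINT x|lebesgue. f k x * cnj (v x $ k))
        = (LINT x|lebesgue. of_real (a x * (norm (v x $ k))\<^sup>2 + z * (norm (v x $ k))\<^sup>2))"
      unfolding f_def mult.assoc complex_norm_square[symmetric]
      by (intro Bochner_Integration.integral_cong) (auto simp: distrib_right)
    also have "\<dots> = of_real (LINT x|lebesgue. a x * (norm (v x $ k))\<^sup>2 + z * (norm (v x $ k))\<^sup>2)"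
      by (rule integral_complex_of_real)
    also have "(LINT x|lebesgue. a x * (norm (v x $ k))\<^sup>2 + z * (norm (v x $ k))\<^sup>2)
        = (LINT x|lebesgue. a x * (norm (v x $ k))\<^sup>2) + z * L2_sq (\<lambda>y. v y $ k)"
      using int_a[of k] vL2[of k] by (simp add: L2_sq_def Lp_space_2_iff)
    finally show ?thesis .
  qed
  \<comment> \<open>The two sides are the limits of one and the same sequence. The divergence
    pairing need not be real for a single component, so the identity stays complex until the
    components are summed.\<close>
  have comp: "of_real z * of_real ((LINT x|lebesgue. a x * (norm (v x $ k))\<^sup>2) + z * L2_sq (\<lambda>y. v y $ k))
      = - (of_real mu * (\<Sum>j\<in>UNIV. complex_of_real (L2_sq (g j k)))
           + of_real (lam + mu) * (LINT x|lebesgue. G x * cnj (g k k x)))" for k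
  proof (rule LIMSEQ_unique)
    have "AE x in lebesgue. lame lam mu u x $ k = f k x"
      using lame
    proof eventually_elim
      case (elim x)
      then have "lame lam mu u x $ k - (scalar_damping a x *v v x) $ k = (of_real z *s v x) $ k"
        by (simp add: vec_eq_iff)
      then show ?case by (simp add: f_def scalar_damping_def mat_vector_mult algebra_simps)
    qed
    then have lame_f: "(LINT x|lebesgue. lame lam mu u x $ k * W x) = (LINT x|lebesgue. f k x * W x)"
      if "W \<in> test_functions" for W
      using borel_measurable_times[OF lame_component_measurable[OF u] test_function_measurable[OF that]]
        borel_measurable_times[OF Lp_space_measurable[OF f] test_function_measurable[OF that]]
      by (intro integral_cong_AE) (auto elim: eventually_mono)
    have cnj_w: "(\<lambda>x. cnj (w k n x)) \<in> test_functions" for n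
      by (rule test_function_cnj[OF w(1)])
    have eqn: "of_real z * (LINT x|lebesgue. f k x * cnj (w k n x))
      = - (of_real mu * (\<Sum>j\<in>UNIV. LINT x|lebesgue. g j k x * cnj (partial_deriv j (w k n) x))
           + of_real (lam + mu) * (LINT x|lebesgue. G x * cnj (partial_deriv k (w k n) x)))" for n
      using integral_lame_test_function[OF u v eq cnj_w, of lam mu k n]
      by (simp add: lame_f[OF cnj_w] g_def G_def partial_deriv_cnj test_function_differentiable w(1))
    show "(\<lambda>n. of_real z * (LINT x|lebesgue. f k x * cnj (w k n x))) \<longlonglongrightarrow>
       of_real z * of_real ((LINT x|lebesgue. a x * (norm (v x $ k))\<^sup>2) + z * L2_sq (\<lambda>y. v y $ k))"
      unfolding f_cnj[symmetric]
      by (intro tendsto_intros L2_cnj_tendsto f vL2 w test_function_Lp_space_2)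
    show "(\<lambda>n. of_real z * (LINT x|lebesgue. f k x * cnj (w k n x))) \<longlonglongrightarrow>
       - (of_real mu * (\<Sum>j\<in>UNIV. complex_of_real (L2_sq (g j k)))
           + of_real (lam + mu) * (LINT x|lebesgue. G x * cnj (g k k x)))"
      unfolding eqn L2_sq_cnj[symmetric]
      by (intro tendsto_intros L2_cnj_tendsto g G gw test_function_Lp_space_2
            test_function_partial_deriv w(1))
  qed
  \<comment> \<open>The diagonal derivatives add up to the divergence, so the mixed pairings combine
    to its squared norm.\<close>
  have sum_G: "(\<Sum>k\<in>UNIV. LINT x|lebesgue. G x * cnj (g k k x)) = of_real (L2_sq G)"
  proof -
    have "(\<Sum>k\<in>UNIV. LINT x|lebesgue. G x * cnj (g k k x)) = (LINT x|lebesgue. (\<Sum>k\<in>UNIV. G x * cnj (g k k x)))"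
      by (rule Bochner_Integration.integral_sum[symmetric]) (rule L2_cnj_integrable[OF G g])
    also have "\<dots> = (LINT x|lebesgue. G x * cnj (G x))"
      by (simp add: G_def sum_distrib_left)
    finally show ?thesis by (simp add: L2_sq_cnj)
  qed
  have "complex_of_real (z * (\<Sum>k\<in>UNIV. (LINT x|lebesgue. a x * (norm (v x $ k))\<^sup>2) + z * L2_sq (\<lambda>y. v y $ k)))
      = of_real (- (mu * (\<Sum>k\<in>UNIV. \<Sum>j\<in>UNIV. L2_sq (g j k)) + (lam + mu) * L2_sq G))"
  proof -
    have "complex_of_real (z * (\<Sum>k\<in>UNIV. (LINT x|lebesgue. a x * (norm (v x $ k))\<^sup>2) + z * L2_sq (\<lambda>y. v y $ k)))
      = (\<Sum>k\<in>UNIV. of_real z * of_real ((LINT x|lebesgue. a x * (norm (v x $ k))\<^sup>2) + z * L2_sq (\<lambda>y. v y $ k)))"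
      by (simp only: of_real_mult of_real_sum sum_distrib_left)
    also have "\<dots> = - (of_real mu * (\<Sum>k\<in>UNIV. \<Sum>j\<in>UNIV. complex_of_real (L2_sq (g j k)))
        + of_real (lam + mu) * of_real (L2_sq G))"
      unfolding comp sum_G[symmetric] by (simp only: sum_negf sum.distrib sum_distrib_left)
    finally show ?thesis by simp
  qed
  then have "z * (\<Sum>k\<in>UNIV. (LINT x|lebesgue. a x * (norm (v x $ k))\<^sup>2) + z * L2_sq (\<lambda>y. v y $ k))
      = - (mu * (\<Sum>k\<in>UNIV. \<Sum>j\<in>UNIV. L2_sq (g j k)) + (lam + mu) * L2_sq G)"
    by (simp only: of_real_eq_iff)
  then have "z * ((\<Sum>k\<in>UNIV. LINT x|lebesgue. a x * (norm (v x $ k))\<^sup>2) + z * (\<Sum>k\<in>UNIV. L2_sq (\<lambda>y. v y $ k)))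
      = - (mu * (\<Sum>k\<in>UNIV. \<Sum>j\<in>UNIV. L2_sq (g j k)) + (lam + mu) * L2_sq G)"
    by (simp only: sum.distrib sum_distrib_left)
  then show ?thesis
    unfolding distrib_left[of z] mult.assoc[symmetric] power2_eq_square[symmetric, of z]
    by (simp add: g_def G_def)
qed

text \<open>Excludes that the approximating sequence of a nonzero function consists of zero
  functions; whence the profile of the cut-off.\<close>

lemma L1_loc_limit_of_zero:
  fixes v :: "real^'n::finite \<Rightarrow> complex"
  assumes v: "v \<in> L1_loc" and loc: "\<And>K. compact K \<Longrightarrow> (\<lambda>m::nat. LINT x:K|lebesgue. norm (0 - v x)) \<longlonglongrightarrow> 0"
  shows "AE x in lebesgue. v x = 0"
proof -
  have "AE x in lebesgue. norm x \<le> real n \<longrightarrow> v x = 0" for n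
  proof -
    have "(LINT x:cball 0 (real n)|lebesgue. norm (v x)) = 0"
      using LIMSEQ_unique[OF loc[of "cball 0 (real n)"] tendsto_const] by simp
    then have "(LINT x|lebesgue. norm (indicator (cball 0 (real n)) x *\<^sub>R v x)) = 0"
      unfolding set_lebesgue_integral_def by simp
    moreover have "integrable lebesgue (\<lambda>x. norm (indicator (cball 0 (real n)) x *\<^sub>R v x))"
      using v by (intro integrable_norm) (auto simp: L1_loc_def set_integrable_def)
    ultimately have "AE x in lebesgue. norm (indicator (cball 0 (real n)) x *\<^sub>R v x) = 0"
      by (subst (asm) integral_nonneg_eq_0_iff_AE) auto
    then show ?thesis by eventually_elim (auto simp: indicator_def split: if_splits)
  qed
  then have "AE x in lebesgue. \<forall>n. norm x \<le> real n \<longrightarrow> v x = 0"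
    by (intro AE_all_countable[THEN iffD2] allI)
  then show ?thesis by eventually_elim (meson real_arch_simple)
qed

text \<open>The function \<open>V\<close> stands for a_- or a_+, so that both signs of the
  eigenvalue are treated at once. The bound \<open>V x \<le> \<bar>a x\<bar>\<close> makes it
  essentially bounded, which permits the passage to the limit in the weighted integrals.\<close>

lemma eigenvalue_bound:
  fixes lam mu \<gamma> :: real
  assumes dim: "CARD('n::finite) \<ge> 2" and mu: "mu > 0" and lam: "lam + mu \<ge> 0"
    and \<gamma>: "if CARD('n) = 2 then \<gamma> > 0 else \<gamma> \<ge> 0"
  obtains c where "c > 0" "\<And>(a :: real^'n \<Rightarrow> real) V (z :: real).
    a \<in> Linfty_space \<Longrightarrow> V \<in> Lp_space (\<gamma> + CARD('n) / 2) \<Longrightarrow>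
    (\<And>x. 0 \<le> V x) \<Longrightarrow> (\<And>x. V x \<le> \<bar>a x\<bar>) \<Longrightarrow> (\<And>x. - z * a x \<le> \<bar>z\<bar> * V x) \<Longrightarrow>
    z \<noteq> 0 \<Longrightarrow> wave_eigenvalue lam mu (scalar_damping a) (complex_of_real z) \<Longrightarrow>
    \<bar>z\<bar> powr (\<gamma> - CARD('n) / 2) \<le> c * Lp_norm (\<gamma> + CARD('n) / 2) V powr (\<gamma> + CARD('n) / 2)"
proof -
  define p where "p = \<gamma> + CARD('n) / 2"
  define \<theta> where "\<theta> = CARD('n) / (2 * p)"
  \<comment> \<open>For d = 2 the condition p > 1 is exactly \<gamma> > 0; for d >= 3 already d/2
    exceeds 1.\<close>
  have p: "p > 1" "p \<ge> CARD('n) / 2"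
  proof -
    have "CARD('n) = 2 \<or> CARD('n) \<ge> 3" using dim by linarith
    then show "p > 1" "p \<ge> CARD('n) / 2" using \<gamma> by (auto simp: p_def)
  qed
  obtain C where C: "C > 0" and GN: "\<And>(w :: real^'n \<Rightarrow> complex) V X Y. w \<in> test_functions \<Longrightarrow> V \<in> Lp_space p \<Longrightarrow>
      (\<And>x. 0 \<le> V x) \<Longrightarrow> X > 0 \<Longrightarrow> Y > 0 \<Longrightarrow>
      (LINT x|lebesgue. V x * (norm (w x))\<^sup>2)
        \<le> C * Lp_norm p V * ((X * (\<Sum>i\<in>UNIV. L2_sq (partial_deriv i w)) + Y * L2_sq w)
             / (X powr \<theta> * Y powr (1 - \<theta>)))"
    using weighted_Gagliardo_Nirenberg[where 'n = 'n, OF dim p, folded \<theta>_def] by blast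
  show thesis
  proof (rule that)
    \<comment> \<open>The constant results from the weight \<open>X = mu\<close> in the
      interpolation inequality and the final power p.\<close>
    show "(C / mu powr \<theta>) powr p > 0" using C mu by simp
  next
    fix a V :: "real^'n \<Rightarrow> real" and z :: real
    assume a: "a \<in> Linfty_space" and V: "V \<in> Lp_space (\<gamma> + CARD('n) / 2)" "\<And>x. 0 \<le> V x" "\<And>x. V x \<le> \<bar>a x\<bar>"
      and aV: "\<And>x. - z * a x \<le> \<bar>z\<bar> * V x" and z: "z \<noteq> 0"
      and eig: "wave_eigenvalue lam mu (scalar_damping a) (complex_of_real z)"
    obtain A where A: "AE x in lebesgue. \<bar>a x\<bar> \<le> A" and a_meas [measurable]: "a \<in> borel_measurable lebesgue"
      using a by (auto simp: Linfty_space_def)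
    have V_meas [measurable]: "V \<in> borel_measurable lebesgue" using V(1) by (rule Lp_space_measurable)
    have V_le: "AE x in lebesgue. V x \<le> A"
      using A by eventually_elim (use V(3) order.trans in blast)
    obtain u v where u: "u \<in> H2_vec" and v: "v \<in> Hdot1_vec"
      and nontriv: "\<not> (AE x in lebesgue. u x = 0 \<and> v x = 0)"
      and uv: "AE x in lebesgue. v x = of_real z *s u x"
      and lame: "AE x in lebesgue. lame lam mu u x - scalar_damping a x *v v x = of_real z *s v x"
      using eig unfolding wave_eigenvalue_def wave_domain_def wave_op_def by auto
    define g where "g = (\<lambda>j k. weak_partial j (\<lambda>y. v y $ k))"
    have v1: "(\<lambda>y. v y $ k) \<in> Hdot1" for k using v by (simp add: Hdot1_vec_def)
    have v_loc: "(\<lambda>y. v y $ k) \<in> L1_loc" for k using v1 by (simp add: Hdot1_def)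
    have g: "g j k \<in> Lp_space 2" for j k using v1 by (simp add: g_def Hdot1_def)
    have vL2: "(\<lambda>y. v y $ k) \<in> Lp_space 2" for k
    proof (rule Lp_space_2_bound)
      show "(\<lambda>y. u y $ k) \<in> Lp_space 2" using u by (simp add: H2_vec_def H2_def)
      show "AE x in lebesgue. norm (v x $ k) \<le> \<bar>z\<bar> * norm (u x $ k)"
        using uv by eventually_elim (simp add: norm_mult)
    qed (rule L1_loc_measurable[OF v_loc])
    \<comment> \<open>The predicate bundles the three properties of a sequence, so that sequences
      for all components can be chosen together.\<close>
    define approximates where "approximates = (\<lambda>k \<phi>. (\<forall>m. \<phi> m \<in> test_functions) \<and>
        (\<forall>i. (\<lambda>m. Lp_norm 2 (\<lambda>x. partial_deriv i (\<phi> m) x - g i k x)) \<longlonglongrightarrow> 0) \<and>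
        (\<forall>K. compact K \<longrightarrow> (\<lambda>m. LINT x:K|lebesgue. norm (\<phi> m x - v x $ k)) \<longlonglongrightarrow> 0))"
    have "\<exists>\<phi>. approximates k \<phi>" for k
      using v1[of k] by (simp add: Hdot1_def approximates_def g_def)
    then obtain \<phi> where approx: "approximates k (\<phi> k)" for k by metis
    then have \<phi>: "\<phi> k m \<in> test_functions"
      and grad': "(\<lambda>m. Lp_norm 2 (\<lambda>x. partial_deriv i (\<phi> k m) x - g i k x)) \<longlonglongrightarrow> 0"
      and loc: "compact K \<Longrightarrow> (\<lambda>m. LINT x:K|lebesgue. norm (\<phi> k m x - v x $ k)) \<longlonglongrightarrow> 0" for k m i K
      by (auto simp: approximates_def)
    have grad: "(\<lambda>m. L2_sq (\<lambda>x. partial_deriv i (\<phi> k m) x - g i k x)) \<longlonglongrightarrow> 0" for k i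
      using tendsto_power[OF grad'[of i k], of 2] by (simp add: Lp_norm_2 L2_sq_nonneg)
    \<comment> \<open>Here z is nonzero: \<open>v = z u\<close> transfers the nontriviality of the
      pair to \<open>v\<close>.\<close>
    have v_nontriv: "\<not> (AE x in lebesgue. v x = 0)"
    proof
      assume "AE x in lebesgue. v x = 0"
      with uv have "AE x in lebesgue. u x = 0 \<and> v x = 0"
        by eventually_elim (use z in \<open>auto simp: vec_eq_iff\<close>)
      with nontriv show False by simp
    qed
    have "\<exists>k. \<not> (AE x in lebesgue. v x $ k = 0)"
    proof (rule ccontr)
      assume "\<not> ?thesis"
      then have "AE x in lebesgue. \<forall>k. v x $ k = 0"
        by (intro eventually_all_finite) auto
      then have "AE x in lebesgue. v x = 0" by eventually_elim (simp add: vec_eq_iff)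
      with v_nontriv show False by simp
    qed
    then obtain k\<^sub>0 where k\<^sub>0: "\<not> (AE x in lebesgue. v x $ k\<^sub>0 = 0)" by blast
    have "\<exists>m x. \<phi> k\<^sub>0 m x \<noteq> 0"
    proof (rule ccontr)
      assume "\<not> ?thesis"
      then have "AE x in lebesgue. v x $ k\<^sub>0 = 0"
        using L1_loc_limit_of_zero[OF v_loc[of k\<^sub>0]] loc[of _ k\<^sub>0] by simp
      with k\<^sub>0 show False by simp
    qed
    then obtain m\<^sub>0 x\<^sub>0 where \<psi>: "\<phi> k\<^sub>0 m\<^sub>0 x\<^sub>0 \<noteq> 0" by blast
    define converges where "converges = (\<lambda>k w. (\<forall>n. w n \<in> test_functions) \<and>
        (\<lambda>n. L2_sq (\<lambda>x. w n x - v x $ k)) \<longlonglongrightarrow> 0 \<and>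
        (\<forall>i. (\<lambda>n. L2_sq (\<lambda>x. partial_deriv i (w n) x - g i k x)) \<longlonglongrightarrow> 0))"
    have "\<exists>w. converges k w" for k
    \<comment> \<open>One cut-off profile, taken from the nonvanishing component, serves all
      components.\<close>
    proof (rule L2_approx_by_test_functions[where g = "\<lambda>i. g i k", OF v_loc[of k] vL2[of k] g \<phi> grad loc \<phi> \<psi>])
      fix w assume "\<And>n. w n \<in> test_functions" "(\<lambda>n. L2_sq (\<lambda>x. w n x - v x $ k)) \<longlonglongrightarrow> 0"
        "\<And>i. (\<lambda>n. L2_sq (\<lambda>x. partial_deriv i (w n) x - g i k x)) \<longlonglongrightarrow> 0"
      then show ?thesis unfolding converges_def by blast
    qed
    then obtain w where conv: "converges k (w k)" for k by metis
    then have w: "w k n \<in> test_functions"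
      and w_lim: "(\<lambda>n. L2_sq (\<lambda>x. w k n x - v x $ k)) \<longlonglongrightarrow> 0"
      and dw_lim: "(\<lambda>n. L2_sq (\<lambda>x. partial_deriv i (w k n) x - g i k x)) \<longlonglongrightarrow> 0" for k n i
      by (auto simp: converges_def)
    define E where "E = mu * (\<Sum>k\<in>UNIV. \<Sum>j\<in>UNIV. L2_sq (g j k)) + z\<^sup>2 * (\<Sum>k\<in>UNIV. L2_sq (\<lambda>y. v y $ k))"
    have int_V: "integrable lebesgue (\<lambda>x. V x * (norm (v x $ k))\<^sup>2)" for k
      using V V_le by (intro bounded_mult_L2_integrable[OF V_meas _ vL2]) auto
    have int_a: "integrable lebesgue (\<lambda>x. a x * (norm (v x $ k))\<^sup>2)" for k
      by (rule bounded_mult_L2_integrable[OF a_meas A vL2])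
    have E_le: "E \<le> \<bar>z\<bar> * (\<Sum>k\<in>UNIV. LINT x|lebesgue. V x * (norm (v x $ k))\<^sup>2)"
    proof -
      have "E \<le> E + (lam + mu) * L2_sq (\<lambda>x. \<Sum>j\<in>UNIV. g j j x)"
        using lam by (simp add: L2_sq_nonneg)
      also have "\<dots> = - z * (\<Sum>k\<in>UNIV. LINT x|lebesgue. a x * (norm (v x $ k))\<^sup>2)"
        using energy_identity[OF u v vL2 uv lame a w w_lim dw_lim[unfolded g_def]]
        by (simp add: E_def g_def)
      also have "\<dots> = (\<Sum>k\<in>UNIV. LINT x|lebesgue. - z * a x * (norm (v x $ k))\<^sup>2)"
        by (simp add: sum_distrib_left mult.assoc sum_negf)
      also have "\<dots> \<le> (\<Sum>k\<in>UNIV. LINT x|lebesgue. \<bar>z\<bar> * V x * (norm (v x $ k))\<^sup>2)"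
        using int_V int_a aV
        by (intro sum_mono integral_mono mult_right_mono) (auto simp: mult.assoc)
      also have "\<dots> = \<bar>z\<bar> * (\<Sum>k\<in>UNIV. LINT x|lebesgue. V x * (norm (v x $ k))\<^sup>2)"
        by (simp add: sum_distrib_left mult.assoc)
      finally show ?thesis .
    qed
    \<comment> \<open>With \<open>X = mu\<close> and \<open>Y = z\<^sup>2\<close> the interpolation
      inequality reproduces the energy \<open>E\<close> on its right-hand side.\<close>
    define B where "B = C * Lp_norm p V / (mu powr \<theta> * (z\<^sup>2) powr (1 - \<theta>))"
    have V_comp: "(LINT x|lebesgue. V x * (norm (v x $ k))\<^sup>2)
        \<le> B * (mu * (\<Sum>j\<in>UNIV. L2_sq (g j k)) + z\<^sup>2 * L2_sq (\<lambda>y. v y $ k))" for k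
    proof (rule LIMSEQ_le)
      show "(\<lambda>n. LINT x|lebesgue. V x * (norm (w k n x))\<^sup>2) \<longlonglongrightarrow> (LINT x|lebesgue. V x * (norm (v x $ k))\<^sup>2)"
        by (rule L2_sq_weighted_tendsto[OF test_function_Lp_space_2[OF w] vL2 w_lim V_meas V(2) V_le])
      show "(\<lambda>n. B * (mu * (\<Sum>j\<in>UNIV. L2_sq (partial_deriv j (w k n))) + z\<^sup>2 * L2_sq (w k n)))
          \<longlonglongrightarrow> B * (mu * (\<Sum>j\<in>UNIV. L2_sq (g j k)) + z\<^sup>2 * L2_sq (\<lambda>y. v y $ k))"
        by (intro tendsto_intros L2_sq_tendsto dw_lim w_lim g vL2 test_function_Lp_space_2
              test_function_partial_deriv w)
      show "\<exists>N. \<forall>n\<ge>N. (LINT x|lebesgue. V x * (norm (w k n x))\<^sup>2)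
          \<le> B * (mu * (\<Sum>j\<in>UNIV. L2_sq (partial_deriv j (w k n))) + z\<^sup>2 * L2_sq (w k n))"
        using GN[OF w _ V(2) mu, where Y = "z\<^sup>2"] V(1) z by (simp add: B_def p_def)
    qed
    have "(\<Sum>k\<in>UNIV. LINT x|lebesgue. V x * (norm (v x $ k))\<^sup>2) \<le> B * E"
    proof -
      have "(\<Sum>k\<in>UNIV. LINT x|lebesgue. V x * (norm (v x $ k))\<^sup>2)
          \<le> (\<Sum>k\<in>UNIV. B * (mu * (\<Sum>j\<in>UNIV. L2_sq (g j k)) + z\<^sup>2 * L2_sq (\<lambda>y. v y $ k)))"
        by (intro sum_mono V_comp)
      also have "\<dots> = B * E"
        by (simp add: E_def sum_distrib_left sum.distrib distrib_left)
      finally show ?thesis .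
    qed
    \<comment> \<open>Positivity of \<open>E\<close> allows it to be cancelled; it comes from the
      z^2 term and a nonvanishing component of \<open>v\<close>.\<close>
    with E_le have "E \<le> \<bar>z\<bar> * (B * E)"
      by (meson abs_ge_zero mult_left_mono order.trans)
    moreover have "E > 0"
    proof -
      have "L2_sq (\<lambda>y. v y $ k\<^sub>0) \<noteq> 0"
      proof
        assume "L2_sq (\<lambda>y. v y $ k\<^sub>0) = 0"
        then have "AE x in lebesgue. (norm (v x $ k\<^sub>0))\<^sup>2 = 0"
          using vL2[of k\<^sub>0] unfolding L2_sq_def
          by (subst (asm) integral_nonneg_eq_0_iff_AE) (auto simp: Lp_space_2_iff)
        with k\<^sub>0 show False by simp
      qed
      then have "0 < L2_sq (\<lambda>y. v y $ k\<^sub>0)" using L2_sq_nonneg[of "\<lambda>y. v y $ k\<^sub>0"] by simp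
      also have "\<dots> \<le> (\<Sum>k\<in>UNIV. L2_sq (\<lambda>y. v y $ k))"
        by (intro member_le_sum) (auto simp: L2_sq_nonneg)
      finally show ?thesis
        using mu z unfolding E_def
        by (intro add_nonneg_pos mult_nonneg_nonneg mult_pos_pos sum_nonneg) (auto simp: L2_sq_nonneg)
    qed
    ultimately have "1 \<le> \<bar>z\<bar> * B" by simp
    have z_pos: "\<bar>z\<bar> > 0" using z by simp
    have "(z\<^sup>2) powr (1 - \<theta>) = \<bar>z\<bar> powr (2 * (1 - \<theta>))"
    proof -
      have "z\<^sup>2 = \<bar>z\<bar> powr 2" by simp
      then show ?thesis by (simp only: powr_powr)
    qed
    moreover have "\<bar>z\<bar> powr (2 * (1 - \<theta>)) = \<bar>z\<bar> * \<bar>z\<bar> powr (1 - 2 * \<theta>)"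
    proof -
      have "\<bar>z\<bar> powr (2 * (1 - \<theta>)) = \<bar>z\<bar> powr (1 + (1 - 2 * \<theta>))" by (simp add: algebra_simps)
      then show ?thesis using z_pos by (simp only: powr_add) simp
    qed
    ultimately have "\<bar>z\<bar> * B = C / mu powr \<theta> * Lp_norm p V / \<bar>z\<bar> powr (1 - 2 * \<theta>)"
      using z_pos by (simp add: B_def)
    with \<open>1 \<le> \<bar>z\<bar> * B\<close> have "1 \<le> C / mu powr \<theta> * Lp_norm p V / \<bar>z\<bar> powr (1 - 2 * \<theta>)"
      by (simp only:)
    then have "\<bar>z\<bar> powr (1 - 2 * \<theta>) \<le> C / mu powr \<theta> * Lp_norm p V"
      using z_pos by (subst (asm) pos_le_divide_eq) (simp_all only: mult_1_left powr_gt_zero)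
    then have "(\<bar>z\<bar> powr (1 - 2 * \<theta>)) powr p \<le> (C / mu powr \<theta> * Lp_norm p V) powr p"
      using p by (intro powr_mono2) auto
    also have "\<dots> = (C / mu powr \<theta>) powr p * Lp_norm p V powr p"
      using C by (intro powr_mult)
    also have "(\<bar>z\<bar> powr (1 - 2 * \<theta>)) powr p = \<bar>z\<bar> powr (\<gamma> - CARD('n) / 2)"
    proof -
      \<comment> \<open>Since 2 \<theta> p = d, the exponent is p - d.\<close>
      have "(1 - 2 * \<theta>) * p = \<gamma> - CARD('n) / 2"
        using p by (simp add: \<theta>_def left_diff_distrib) (simp add: p_def)
      then show ?thesis by (simp add: powr_powr)
    qed
    finally show "\<bar>z\<bar> powr (\<gamma> - CARD('n) / 2)
        \<le> (C / mu powr \<theta>) powr p * Lp_norm (\<gamma> + CARD('n) / 2) V powr (\<gamma> + CARD('n) / 2)"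
      by (simp add: p_def)
  qed
qed

theorem theorem1p3:
  fixes lam mu \<gamma> :: real
  assumes "CARD('n::finite) \<ge> 2"
    and "mu > 0"
    and "lam + mu \<ge> 0"
    and "if CARD('n) = 2 then \<gamma> > 0 else \<gamma> \<ge> 0"
  shows "\<exists>c>0. \<forall>a :: real^'n \<Rightarrow> real. a \<in> Linfty_space \<longrightarrow>
    (neg_part a \<in> Lp_space (\<gamma> + CARD('n) / 2) \<longrightarrow>
      (\<forall>z::real. z > 0 \<and> wave_eigenvalue lam mu (scalar_damping a) (complex_of_real z) \<longrightarrow>
        z powr (\<gamma> - CARD('n) / 2)
          \<le> c * Lp_norm (\<gamma> + CARD('n) / 2) (neg_part a) powr (\<gamma> + CARD('n) / 2))) \<and>
    (pos_part a \<in> Lp_space (\<gamma> + CARD('n) / 2) \<longrightarrow>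
      (\<forall>z::real. z < 0 \<and> wave_eigenvalue lam mu (scalar_damping a) (complex_of_real z) \<longrightarrow>
        (- z) powr (\<gamma> - CARD('n) / 2)
          \<le> c * Lp_norm (\<gamma> + CARD('n) / 2) (pos_part a) powr (\<gamma> + CARD('n) / 2)))"
proof -
  obtain c where c: "c > 0" and bound: "\<And>(a :: real^'n \<Rightarrow> real) V (z :: real).
    a \<in> Linfty_space \<Longrightarrow> V \<in> Lp_space (\<gamma> + CARD('n) / 2) \<Longrightarrow>
    (\<And>x. 0 \<le> V x) \<Longrightarrow> (\<And>x. V x \<le> \<bar>a x\<bar>) \<Longrightarrow> (\<And>x. - z * a x \<le> \<bar>z\<bar> * V x) \<Longrightarrow>
    z \<noteq> 0 \<Longrightarrow> wave_eigenvalue lam mu (scalar_damping a) (complex_of_real z) \<Longrightarrow>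
    \<bar>z\<bar> powr (\<gamma> - CARD('n) / 2) \<le> c * Lp_norm (\<gamma> + CARD('n) / 2) V powr (\<gamma> + CARD('n) / 2)"
    using eigenvalue_bound[where 'n = 'n, OF assms] by blast
  \<comment> \<open>The constant was fixed before \<open>a\<close>, \<open>V\<close> and
    \<open>z\<close>, so it serves both parts.\<close>
  show ?thesis
  proof (intro exI[of _ c] conjI c allI impI; elim conjE)
    fix a :: "real^'n \<Rightarrow> real" and z :: real
    assume a: "a \<in> Linfty_space" and V: "neg_part a \<in> Lp_space (\<gamma> + CARD('n) / 2)"
      and z: "z > 0" "wave_eigenvalue lam mu (scalar_damping a) (complex_of_real z)"
    have "- z * a x \<le> \<bar>z\<bar> * neg_part a x" for x
      using mult_left_mono[of "- a x" "max (- a x) 0" z] z by (simp add: neg_part_def)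
    moreover have "0 \<le> neg_part a x" "neg_part a x \<le> \<bar>a x\<bar>" for x by (auto simp: neg_part_def)
    ultimately show "z powr (\<gamma> - CARD('n) / 2)
          \<le> c * Lp_norm (\<gamma> + CARD('n) / 2) (neg_part a) powr (\<gamma> + CARD('n) / 2)"
      using bound[OF a V _ _ _ _ z(2)] z by simp
  next
    fix a :: "real^'n \<Rightarrow> real" and z :: real
    assume a: "a \<in> Linfty_space" and V: "pos_part a \<in> Lp_space (\<gamma> + CARD('n) / 2)"
      and z: "z < 0" "wave_eigenvalue lam mu (scalar_damping a) (complex_of_real z)"
    have "- z * a x \<le> \<bar>z\<bar> * pos_part a x" for x
      using mult_left_mono[of "a x" "max (a x) 0" "- z"] z by (simp add: pos_part_def)
    moreover have "0 \<le> pos_part a x" "pos_part a x \<le> \<bar>a x\<bar>" for x by (auto simp: pos_part_def)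
    ultimately show "(- z) powr (\<gamma> - CARD('n) / 2)
          \<le> c * Lp_norm (\<gamma> + CARD('n) / 2) (pos_part a) powr (\<gamma> + CARD('n) / 2)"
      using bound[OF a V _ _ _ _ z(2)] z by simp
  qed
qed

end
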